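(* Let $k\ge1$ be an integer, let $r\in\mathbb{N}$, consider the CM point $\tau_r=2^ri$, and let $a=\pi^{1/4}/\Gamma(3/4)$. Then $$H_k(\tau_r)=\frac{a^{4k+2}}{2^{(2k+1)(r+3)}}\left(\frac{e^{-2^{r+1}(k+1)\pi}}{4^{k+1}}+\sum_{\ell=1}^{k-1}\frac{\alpha_k(\ell)}{4^\ell}e^{M(\ell,r)}+\sum_{\ell=k}^{2k}\frac{\beta_k(\ell)}{4^\ell}e^{M(\ell,r)}\right)e^{J(k,r)},$$ where $$J(k,r)=\frac{\pi(2k+1)}{3}-\frac{2k+1}{\pi}\sum_{m=1}^{r+1}2^mL_m-\frac{2^{r+2}(4k+1)}{\pi}L_{r+2}-\frac{2^{r+4}}{\pi}L_{r+3},$$ $$M(\ell,r)=-\frac{\ell\cdot2^{r+1}}{\pi}\sum_{m=1}^{r+1}2^mL_m-\frac{2^{r+3}(k-\ell+1)}{\pi}L_{r+2}+\frac{2^{r+5}(k-\ell+1)}{\pi}L_{r+3},$$ and $L_\ell$ is defined by the convergent double series $$L_\ell=\sum_{m,n\ge1}\frac{(-1)^m}{n^2+2^\ell m^2}.$$ In particular, $$\sum_{m,n\ge1}\frac{(-1)^m}{n^2+2^\ell m^2}=\begin{cases}-\dfrac{\pi^2}{24}-\dfrac{\pi\log2}{8},&\ell=1,\\[2mm]-\dfrac{7\pi^2}{96}-\dfrac{\pi\log2}{32}-\dfrac{\pi\log(\sqrt2-1)}{8},&\ell=2,\\[2mm]-\dfrac{31\pi^2}{384}-\dfrac{5\pi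\log2}{128}+\dfrac{\pi\log(\sqrt2-1)}{32}-\dfrac{\pi\log(1-2^{-1/4})}{8},&\ell=3.\end{cases}$$
   Context: Here $q=e^{2\pi i\tau}$ for $\tau$ in the upper half-plane, $\eta(\tau)=q^{1/24}\prod_{n\ge1}(1-q^n)$, and $\chi_{-4}=\left(\frac{-4}{\cdot}\right)$ is the nontrivial Dirichlet character mod $4$. The Euler numbers $E_n$ are defined by $\frac{2}{e^{z}+e^{-z}}=\sum_{n\ge0}E_n\frac{z^n}{n!}$. $1$ is the trivial character of modulus $1$ and $\chi_2$ is the principal Dirichlet character of modulus $2$ (conductor $1$). Normalized Eisenstein series: for a non-principal Dirichlet character $\chi$ and a Dirichlet character $\psi$ of modulus $R$, conductor $r_\psi$ and associated primitive character $\psi^0$, with $\chi(-1)\psi(-1)=(-1)^w$ and $s=R/r_\psi$, $$\mathscr{E}_{w,\chi,\psi}(\tau)=\sum_{n\ge1}a(n)q^{n/R},\qquad a(n)=\sum_{d\mid n}\chi(n/d)d^{w-1}\sum_{c\mid(s,d)}c\,\mu(s/c)\psi^0(s/c)\overline{\psi^0}(d/c),$$ with $\mu$ the Möbius function (the coefficients $a(n)$ are unrelated to the constant $a$ of the claim). Define $$H_k(\tau)=\begin{cases}\dfrac{1}{2^{2k}E_{2k}}\left(2^{2k}\mathscr{E}_{2k+1,\chi_{-4},1}(2\tau)-\mathscr{E}_{2k+1,\chi_{-4},\chi_2}(2\tau)\right),&k\text{ even},\\[2mm]-\dfrac{1}{E_{2k}}\mathscr{E}_{2k+1,\chi_{-4},1}(2\tau),&k\text{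 odd}.\end{cases}$$ Coefficients $\alpha_k(\ell),\beta_k(\ell)$: let $f_k(\tau)=\frac{\eta(4\tau)^{8k-2}\eta(8\tau)^4}{\eta(2\tau)^{4k}}$, $F(\tau)=\frac{\eta(4\tau)^8}{\eta(2\tau)^4}$, $\theta(\tau)=\sum_{n\in\mathbb{Z}}q^{n^2}=\frac{\eta(2\tau)^5}{\eta(\tau)^2\eta(4\tau)^2}$. The difference $H_k-f_k$ is a cusp form of weight $2k+1$ on $\Gamma_0(8)$ with Nebentypus $\chi_{-4}$, and $\alpha_k(\ell)$ ($1\le\ell\le k-1$), $\beta_k(\ell)$ ($k\le\ell\le2k$) are the uniquely determined complex numbers with $$H_k(\tau)=f_k(\tau)+\sum_{\ell=1}^{k-1}\alpha_k(\ell)F(\tau)^\ell\theta(2\tau)^{4(k-\ell)+2}+\sum_{\ell=k}^{2k}\beta_k(\ell)F(\tau)^{2k-\ell}F(2\tau)^{\ell-k}\theta(2\tau)^2.$$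
   Formalization: The double series is taken with n^2+4^(l-1)m^2 instead of n^2+2^l m^2 (which contradicts the stated value at l=1), and the first term of M(l,r) is -l 2^(r+1) pi instead of -(l 2^(r+1)/pi) times the sum of 2^m L_m, since the claim is false as printed. *)

theory Defs
  imports
    "HOL-Analysis.Analysis"
    "HOL-Computational_Algebra.Computational_Algebra"
    "HOL-Number_Theory.Cong"
begin

definition dirichlet_char :: "nat \<Rightarrow> (int \<Rightarrow> complex) \<Rightarrow> bool" where
  "dirichlet_char N chi \<longleftrightarrow> chi 1 = 1 \<and> (\<forall>m n. chi (m * n) = chi m * chi n) \<and>
     (\<forall>n. chi (n + int N) = chi n) \<and> (\<forall>n. chi n = 0 \<longleftrightarrow> \<not> coprime n (int N))"

definition char_conductor :: "nat \<Rightarrow> (int \<Rightarrow> complex) \<Rightarrow> nat" where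
  "char_conductor N chi =
     (LEAST r. r dvd N \<and> (\<forall>n. coprime n (int N) \<and> [n = 1] (mod int r) \<longrightarrow> chi n = 1))"

definition primitive_char :: "nat \<Rightarrow> (int \<Rightarrow> complex) \<Rightarrow> (int \<Rightarrow> complex)" where
  "primitive_char N chi =
     (THE chi0. dirichlet_char (char_conductor N chi) chi0 \<and>
             (\<forall>n. coprime n (int N) \<longrightarrow> chi0 n = chi n))"

definition principal_char :: "nat \<Rightarrow> int \<Rightarrow> complex" where
  "principal_char N n = (if coprime n (int N) then 1 else 0)"

definition chi_m4 :: "int \<Rightarrow> complex" where
  "chi_m4 n = (if n mod 4 = 1 then 1 else if n mod 4 = 3 then -1 else 0)"

definition moebius_mu :: "nat \<Rightarrow> int" where
  "moebius_mu n = (if squarefree n then (-1) ^ card (prime_factors n) else 0)"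

lemma dirichlet_char_principal: "dirichlet_char N (principal_char N)"
proof -
  have "coprime (n + int N) (int N) \<longleftrightarrow> coprime n (int N)" for n
    by (metis add.commute coprime_iff_gcd_eq_1 gcd_add1 gcd.commute)
  then show ?thesis
    by (auto simp: dirichlet_char_def principal_char_def)
qed

lemma char_conductor_principal: "N > 0 \<Longrightarrow> char_conductor N (principal_char N) = 1"
  unfolding char_conductor_def
  by (rule Least_equality) (auto simp: principal_char_def Suc_le_eq intro: Nat.gr0I)

lemma primitive_char_principal:
  assumes "N > 0"
  shows "primitive_char N (principal_char N) = (\<lambda>_. 1)"
  unfolding primitive_char_def char_conductor_principal[OF assms]
proof (rule the_equality)
  show "dirichlet_char 1 (\<lambda>_. 1) \<and> (\<forall>n. coprime n (int N) \<longrightarrow> 1 = principal_char N n)"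
    by (auto simp: dirichlet_char_def principal_char_def)
next
  fix chi assume "dirichlet_char 1 chi \<and> (\<forall>n. coprime n (int N) \<longrightarrow> chi n = principal_char N n)"
  then have 1: "chi 1 = 1" and per: "chi (n + 1) = chi n" for n
    by (auto simp: dirichlet_char_def)
  have "chi n = 1" for n
  proof (induction n rule: int_induct[where k = 1])
    case (step2 i) then show ?case using per[of "i - 1"] by simp
  qed (use 1 per in auto)
  then show "chi = (\<lambda>_. 1)" by blast
qed

definition euler_number :: "nat \<Rightarrow> complex" where
  "euler_number n = fact n * fps_nth (2 / (fps_exp 1 + fps_exp (-1))) n"

definition eisenstein_coeff ::
    "nat \<Rightarrow> (int \<Rightarrow> complex) \<Rightarrow> nat \<Rightarrow> (int \<Rightarrow> complex) \<Rightarrow> nat \<Rightarrow> complex" where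
  "eisenstein_coeff w chi R psi n =
     (let s = R div char_conductor R psi; psi0 = primitive_char R psi in
      \<Sum>d | d dvd n. chi (int (n div d)) * of_nat d ^ (w - 1) *
        (\<Sum>c | c dvd gcd s d. of_nat c * of_int (moebius_mu (s div c)) *
           psi0 (int (s div c)) * cnj (psi0 (int (d div c)))))"

text \<open>The modulus \<open>R\<close> of \<open>psi\<close> is an explicit argument, since a function on the integers does not
  determine the modulus of the character it represents.\<close>

definition eisenstein ::
    "nat \<Rightarrow> (int \<Rightarrow> complex) \<Rightarrow> nat \<Rightarrow> (int \<Rightarrow> complex) \<Rightarrow> complex \<Rightarrow> complex" where
  "eisenstein w chi R psi \<tau> =
     (\<Sum>n. eisenstein_coeff w chi R psi (Suc n) *
           exp (2 * of_real pi * \<i> * \<tau> * of_nat (Suc n) / of_nat R))"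

definition H :: "nat \<Rightarrow> complex \<Rightarrow> complex" where
  "H k \<tau> =
     (if even k then
        1 / (2 ^ (2 * k) * euler_number (2 * k)) *
          (2 ^ (2 * k) * eisenstein (2 * k + 1) chi_m4 1 (principal_char 1) (2 * \<tau>)
           - eisenstein (2 * k + 1) chi_m4 2 (principal_char 2) (2 * \<tau>))
      else
        - (1 / euler_number (2 * k)) *
          eisenstein (2 * k + 1) chi_m4 1 (principal_char 1) (2 * \<tau>))"

definition eta :: "complex \<Rightarrow> complex" where
  "eta \<tau> = exp (2 * of_real pi * \<i> * \<tau> / 24) *
     (\<Prod>n. 1 - exp (2 * of_real pi * \<i> * \<tau>) ^ Suc n)"

definition theta :: "complex \<Rightarrow> complex" where
  "theta \<tau> = (\<Sum>\<^sub>\<infinity>n::int. exp (2 * of_real pi * \<i> * \<tau> * of_int (n ^ 2)))"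

definition F :: "complex \<Rightarrow> complex" where
  "F \<tau> = eta (4 * \<tau>) ^ 8 / eta (2 * \<tau>) ^ 4"

definition f :: "nat \<Rightarrow> complex \<Rightarrow> complex" where
  "f k \<tau> = eta (4 * \<tau>) ^ (8 * k - 2) * eta (8 * \<tau>) ^ 4 / eta (2 * \<tau>) ^ (4 * k)"

text \<open>The coefficients \<open>\<alpha> l\<close> for \<open>1 \<le> l \<le> k - 1\<close> and \<open>\<beta> l\<close> for \<open>k \<le> l \<le> 2k\<close> are determined by this
  predicate; the values of \<open>\<alpha>\<close> and \<open>\<beta>\<close> outside these ranges are irrelevant.\<close>

definition H_expansion :: "nat \<Rightarrow> (nat \<Rightarrow> complex) \<Rightarrow> (nat \<Rightarrow> complex) \<Rightarrow> bool" where
  "H_expansion k \<alpha> \<beta> \<longleftrightarrow> (\<forall>\<tau>. Im \<tau> > 0 \<longrightarrow>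
     H k \<tau> = f k \<tau>
       + (\<Sum>l=1..k-1. \<alpha> l * F \<tau> ^ l * theta (2 * \<tau>) ^ (4 * (k - l) + 2))
       + (\<Sum>l=k..2*k. \<beta> l * F \<tau> ^ (2 * k - l) * F (2 * \<tau>) ^ (l - k) * theta (2 * \<tau>) ^ 2))"

definition L_partial :: "nat \<Rightarrow> nat \<times> nat \<Rightarrow> real" where
  "L_partial l = (\<lambda>(M, N). \<Sum>m=1..M. \<Sum>n=1..N. (-1) ^ m / (real n ^ 2 + 4 ^ (l - 1) * real m ^ 2))"

text \<open>The double series is not absolutely convergent; its value is the limit of the rectangular
  partial sums as both bounds tend to infinity independently. The coefficient of \<open>m\<^sup>2\<close> must be
  \<open>4\<^sup>l\<^sup>-\<^sup>1\<close>: the value \<open>- \<pi>\<^sup>2 / 24 - \<pi> log 2 / 8\<close> at \<open>l = 1\<close> belongs to the form \<open>n\<^sup>2 + m\<^sup>2\<close>, and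
  with \<open>2\<^sup>l\<close> instead neither the values at \<open>l = 1, 3\<close> nor the evaluation of \<open>H\<close> would be correct.\<close>

definition L :: "nat \<Rightarrow> real" where
  "L l = Lim (sequentially \<times>\<^sub>F sequentially) (L_partial l)"

definition J :: "nat \<Rightarrow> nat \<Rightarrow> real" where
  "J k r = pi * (2 * real k + 1) / 3
     - (2 * real k + 1) / pi * (\<Sum>m=1..r+1. 2 ^ m * L m)
     - 2 ^ (r + 2) * (4 * real k + 1) / pi * L (r + 2)
     - 2 ^ (r + 4) / pi * L (r + 3)"

text \<open>The first term is the logarithm of \<open>\<bar>q\<bar>\<^sup>l\<close> at \<open>\<tau> = 2\<^sup>r \<i>\<close>; at \<open>l = k + 1\<close>, where the other two
  vanish, the exponent is that of the contribution of \<open>f k\<close>. No sum over the \<open>L m\<close> occurs here,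
  since the quotient of two terms of the expansion only involves \<open>eta (8 \<tau>) / eta (4 \<tau>)\<close> and
  \<open>eta (4 \<tau>) / eta (2 \<tau>)\<close>.\<close>

definition M :: "nat \<Rightarrow> nat \<Rightarrow> nat \<Rightarrow> real" where
  "M k l r = - (real l * 2 ^ (r + 1) * pi)
     - 2 ^ (r + 3) * (real k - real l + 1) / pi * L (r + 2)
     + 2 ^ (r + 5) * (real k - real l + 1) / pi * L (r + 3)"

end

theory Submission
  imports Defs
begin

text \<open>
  Summing the series of \<open>L l\<close> over \<open>n\<close> with the partial fractions of \<open>coth\<close> leaves a Lambert series,
  which shows that \<open>L l\<close> is elementary up to \<open>ln (\<eta>(2 c \<i>) / \<eta>(c \<i>))\<close> with \<open>c = 2\<^sup>l\<^sup>-\<^sup>1\<close>. Hence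
  \<open>\<eta>(2\<^sup>j \<i>)\<close> is \<open>\<eta>(\<i>)\<close> times an exponential of a combination of the \<open>L m\<close>. Since by the triple product
  \<open>f k\<close>, \<open>F\<close> and \<open>\<theta>\<close> are eta quotients, every term of the expansion of \<open>H k\<close> at \<open>2\<^sup>r \<i>\<close> becomes a power
  of \<open>\<eta>(\<i>)\<close> times such an exponential.

  Summing \<open>L 1\<close> in the other order gives \<open>\<eta>(\<i> / 2) = sqrt 2 \<eta>(2 \<i>)\<close>. Together with Jacobi's quartic
  identity and the duplication formulas for theta constants this determines \<open>\<eta>(2\<^sup>j \<i>) / \<eta>(\<i>)\<close> for
  \<open>j \<le> 3\<close> and thereby \<open>L 1\<close>, \<open>L 2\<close>, \<open>L 3\<close>. Finally, the squares of two theta constants form an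
  arithmetic-geometric mean sequence with limit 1 under \<open>q \<mapsto> q\<^sup>2\<close>; at \<open>\<tau> = \<i>\<close> Gauss's integral for the mean
  is a Beta integral, which evaluates \<open>\<eta>(\<i>)\<close>.
\<close>

section \<open>The triple product identity\<close>

text \<open>The double series converges only conditionally, so rows and columns cannot be exchanged
  by absolute convergence. Instead, for every cut-off \<open>N\<close> the inner sums over
  \<open>n\<close> are nonnegative and decrease in \<open>m\<close>: the Leibniz bound on the tail
  in \<open>m\<close> is uniform in \<open>N\<close>, which gives the limit over rectangles as well
  as the exchange.

  The only modular transformation used is the one at \<open>2 * \<i>\<close>, which that exchange
  provides. It suffices because at \<tau> = \<i> it makes \<open>theta4 x ^ 4\<close> and
  \<open>16 * x * psi x ^ 4\<close> equal, so that the quartic identity becomes one equation between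
  \<open>eta_real 1\<close> and \<open>eta_real 2\<close>; the differences of squares and of first
  powers of \<open>theta3\<close> and \<open>theta4\<close> then reach \<open>eta_real 4\<close> and
  \<open>eta_real 8\<close>. The constant \<open>a\<close> is \<open>theta3 (exp (- pi))\<close>,
  that is sqrt 2 times eta(\<i>).

  The common shape of all terms of the expansion comes from theta(2 \<tau>)^4 / F(\<tau>) =
  F(\<tau>) / F(2 \<tau>), an identity of eta quotients: in both sums, raising \<open>l\<close> by
  one divides the product of \<open>F\<close> and \<open>theta\<close> by the same number, and
  \<open>f k\<close> sits where the index would be \<open>k + 1\<close>.\<close>

definition qprod :: "real \<Rightarrow> nat \<Rightarrow> real" where
  "qprod x n = (\<Prod>j<n. 1 - x ^ Suc j)"

text \<open>Euler's product (x; x)_\<infinity>, which is eta without its factor q^(1/24);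
  \<open>qprod\<close> is the finite q-Pochhammer symbol (x; x)_n.\<close>

definition qprod_inf :: "real \<Rightarrow> real" where
  "qprod_inf x = (\<Prod>n. 1 - x ^ Suc n)"

lemma qprod_0 [simp]: "qprod x 0 = 1"
  by (simp add: qprod_def)

lemma qprod_Suc: "qprod x (Suc n) = qprod x n * (1 - x ^ Suc n)"
  by (simp add: qprod_def)

context
  fixes x :: real
  assumes x: "0 < x" "x < 1"
begin

lemma qprod_pos: "qprod x n > 0"
  unfolding qprod_def using x by (intro prod_pos) (simp add: power_Suc_less_one del: power_Suc)

lemma convergent_prod_qprod: "convergent_prod (\<lambda>n. 1 - x ^ Suc n)"
proof -
  have "summable (\<lambda>n. norm (- (x ^ Suc n)))"
    using x by (simp add: summable_mult summable_geometric)
  then have "abs_convergent_prod (\<lambda>n. 1 + - (x ^ Suc n))"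
    by (simp add: abs_convergent_prod_conv_summable del: power_Suc)
  then show ?thesis
    using abs_convergent_prod_imp_convergent_prod by simp
qed

lemma qprod_tendsto: "qprod x \<longlonglongrightarrow> qprod_inf x"
  using has_prod_imp_tendsto'[OF convergent_prod_has_prod[OF convergent_prod_qprod]]
  unfolding qprod_def qprod_inf_def by simp

lemma qprod_inf_pos: "qprod_inf x > 0"
  unfolding qprod_inf_def using x
  by (intro less_0_prodinf convergent_prod_qprod) (simp add: power_Suc_less_one del: power_Suc)

lemma qprod_le_1: "qprod x n \<le> 1"
  unfolding qprod_def using x by (intro prod_le_1) (auto simp: power_le_one simp del: power_Suc)

lemma qprod_inf_le: "qprod_inf x \<le> qprod x n"
proof -
  have "decseq (qprod x)"
    unfolding decseq_Suc_iff using x qprod_pos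
    by (auto simp: qprod_Suc intro!: mult_right_le_one_le less_imp_le[OF qprod_pos] power_le_one)
  then show ?thesis
    using qprod_tendsto by (rule decseq_ge)
qed

end

section \<open>Gaussian binomials and the finite form of the identity\<close>

text \<open>The Gaussian binomial coefficient in base \<open>p\<close>. The value 0 for
  \<open>k > N\<close> lets sums be lengthened by one term before they are shifted.\<close>

definition qbinom :: "real \<Rightarrow> nat \<Rightarrow> nat \<Rightarrow> real" where
  "qbinom p N k = (if k \<le> N then qprod p N / (qprod p k * qprod p (N - k)) else 0)"

context
  fixes p :: real
  assumes p: "0 < p" "p < 1"
begin

lemma qprod_nz: "qprod p n \<noteq> 0"
  using qprod_pos[OF p, of n] by simp

lemma one_minus_power_nz: "1 - p ^ Suc n \<noteq> 0"
  using p power_Suc_less_one[of p n] by simp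

lemma qbinom_0_right [simp]: "qbinom p N 0 = 1"
  by (simp add: qbinom_def qprod_nz)

text \<open>Pascal's rule has two q-analogues, according to how \<open>1 - p ^ Suc N\<close> is
  split over the two denominators. Here it is (1 - p^(N-k)) + p^(N-k) (1 - p^(k+1)); the primed
  version attaches a power of \<open>p\<close> to the other summand.\<close>

lemma qbinom_Suc_Suc:
  assumes "k \<le> N"
  shows "qbinom p (Suc N) (Suc k) = qbinom p N (Suc k) + p ^ (N - k) * qbinom p N k"
proof (cases "k = N")
  case False
  then obtain d where d: "N = Suc (k + d)"
    using assms less_imp_Suc_add[of k N] by auto
  have e: "1 - p ^ Suc N = 1 - p ^ Suc d + p ^ Suc d * (1 - p ^ Suc k)"
    by (simp add: d algebra_simps power_add)
  have nz: "qprod p d \<noteq> 0" "qprod p k \<noteq> 0" "1 - p ^ Suc d \<noteq> 0" "1 - p ^ Suc k \<noteq> 0"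
    by (rule qprod_nz one_minus_power_nz)+
  have 1: "qbinom p (Suc N) (Suc k) = qprod p N * (1 - p ^ Suc N) /
      (qprod p k * (1 - p ^ Suc k) * (qprod p d * (1 - p ^ Suc d)))"
    by (simp add: qbinom_def d qprod_Suc del: power_Suc)
  have 2: "qbinom p N (Suc k) = qprod p N / (qprod p k * (1 - p ^ Suc k) * qprod p d)"
    by (simp add: qbinom_def d qprod_Suc[of p k] del: power_Suc)
  have 3: "qbinom p N k = qprod p N / (qprod p k * (qprod p d * (1 - p ^ Suc d)))"
    by (simp add: qbinom_def d qprod_Suc[of p d] del: power_Suc)
  have "N - k = Suc d" by (simp add: d)
  then show ?thesis
    unfolding 1 2 3 e using nz by (simp add: divide_simps del: power_Suc) (simp add: algebra_simps)
qed (simp add: qbinom_def qprod_nz)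

lemma qbinom_Suc_Suc':
  assumes "k \<le> N"
  shows "qbinom p (Suc N) (Suc k) = p ^ Suc k * qbinom p N (Suc k) + qbinom p N k"
proof (cases "k = N")
  case False
  then obtain d where d: "N = Suc (k + d)"
    using assms less_imp_Suc_add[of k N] by auto
  have e: "1 - p ^ Suc N = p ^ Suc k * (1 - p ^ Suc d) + (1 - p ^ Suc k)"
    by (simp add: d algebra_simps power_add)
  have nz: "qprod p d \<noteq> 0" "qprod p k \<noteq> 0" "1 - p ^ Suc d \<noteq> 0" "1 - p ^ Suc k \<noteq> 0"
    by (rule qprod_nz one_minus_power_nz)+
  have 1: "qbinom p (Suc N) (Suc k) = qprod p N * (1 - p ^ Suc N) /
      (qprod p k * (1 - p ^ Suc k) * (qprod p d * (1 - p ^ Suc d)))"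
    by (simp add: qbinom_def d qprod_Suc del: power_Suc)
  have 2: "qbinom p N (Suc k) = qprod p N / (qprod p k * (1 - p ^ Suc k) * qprod p d)"
    by (simp add: qbinom_def d qprod_Suc[of p k] del: power_Suc)
  have 3: "qbinom p N k = qprod p N / (qprod p k * (qprod p d * (1 - p ^ Suc d)))"
    by (simp add: qbinom_def d qprod_Suc[of p d] del: power_Suc)
  show ?thesis
    unfolding 1 2 3 e using nz by (simp add: divide_simps del: power_Suc) (simp add: algebra_simps)
qed (simp add: qbinom_def qprod_nz)

end

text \<open>Allowing different numbers of factors of the two kinds turns both induction steps into the
  two Pascal recursions.\<close>

lemma finite_triple_product_general:
  fixes x z :: real
  assumes x: "0 < x" "x < 1"
  shows "(\<Prod>j<a. 1 + z * x ^ (2 * j + 1)) * (\<Prod>j<b. z + x ^ (2 * j + 1)) =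
    (\<Sum>k\<le>a+b. qbinom (x\<^sup>2) (a + b) k * z ^ k * x powi ((int k - int b)\<^sup>2))"
proof -
  have p: "0 < x\<^sup>2" "x\<^sup>2 < 1"
    using x by (auto simp: power_less_one_iff abs_square_less_1)
  have pw: "(x\<^sup>2) ^ n = x powi (2 * int n)" for n
    by (metis int_ops(3) int_ops(7) of_nat_numeral power_int_of_nat power_mult)
  have pw': "x ^ n = x powi int n" for n by simp
  have mul: "x powi i * x powi j = x powi (i + j)" for i j
    using x by (simp add: power_int_add)
  \<comment> \<open>A factor of the second kind leaves the excess \<open>(x\<^sup>2) ^ Suc k\<close>
    on one of two neighbouring coefficients, the weight in the primed Pascal rule; a factor of the
    first kind, in the induction on \<open>a\<close> below, leaves
    \<open>(x\<^sup>2) ^ (?N - k)\<close>, the weight in the other.\<close>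
  have B: "(\<Prod>j<b. z + x ^ (2 * j + 1)) = (\<Sum>k\<le>b. qbinom (x\<^sup>2) b k * z ^ k * x powi ((int k - int b)\<^sup>2))"
  proof (induction b)
    case (Suc b)
    let ?t = "\<lambda>k. qbinom (x\<^sup>2) b k * z ^ k * x powi ((int k - int b)\<^sup>2)"
    have "(\<Prod>j<Suc b. z + x ^ (2 * j + 1)) = (\<Sum>k\<le>b. ?t k) * (z + x ^ (2 * b + 1))"
      using Suc.IH by simp
    also have "\<dots> = (\<Sum>k\<le>b. ?t k * x ^ (2 * b + 1)) + (\<Sum>k\<le>b. ?t k * z)"
      by (simp add: distrib_left sum_distrib_right)
    also have "(\<Sum>k\<le>b. ?t k * x ^ (2 * b + 1)) = (\<Sum>k\<le>Suc b. ?t k * x ^ (2 * b + 1))"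
      by (simp add: qbinom_def)
    also have "\<dots> = ?t 0 * x ^ (2 * b + 1) + (\<Sum>k\<le>b. ?t (Suc k) * x ^ (2 * b + 1))"
      by (rule sum.atMost_Suc_shift)
    also have "\<dots> + (\<Sum>k\<le>b. ?t k * z) = ?t 0 * x ^ (2 * b + 1)
        + (\<Sum>k\<le>b. ?t (Suc k) * x ^ (2 * b + 1) + ?t k * z)"
      by (simp add: sum.distrib)
    also have "(\<Sum>k\<le>b. ?t (Suc k) * x ^ (2 * b + 1) + ?t k * z) =
       (\<Sum>k\<le>b. qbinom (x\<^sup>2) (Suc b) (Suc k) * z ^ Suc k * x powi ((int (Suc k) - int (Suc b))\<^sup>2))"
    proof (intro sum.cong refl)
      fix k assume "k \<in> {..b}"
      then have k: "k \<le> b" by simp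
      have e: "x powi ((int (Suc k) - int b)\<^sup>2) * x ^ (2 * b + 1) =
               (x\<^sup>2) ^ Suc k * x powi ((int k - int b)\<^sup>2)"
        unfolding pw pw'[of "2 * b + 1"] mul by (rule arg_cong[where f = "\<lambda>i. x powi i"]) (simp add: power2_eq_square algebra_simps)
      have "?t (Suc k) * x ^ (2 * b + 1) = qbinom (x\<^sup>2) b (Suc k) * z ^ Suc k * (x powi ((int (Suc k) - int b)\<^sup>2) * x ^ (2 * b + 1))"
        by (simp only: mult.assoc)
      then show "?t (Suc k) * x ^ (2 * b + 1) + ?t k * z =
         qbinom (x\<^sup>2) (Suc b) (Suc k) * z ^ Suc k * x powi ((int (Suc k) - int (Suc b))\<^sup>2)"
        unfolding e qbinom_Suc_Suc'[OF p k] by (simp add: algebra_simps)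
    qed
    also have "?t 0 * x ^ (2 * b + 1) = x powi ((int 0 - int (Suc b))\<^sup>2)"
    proof -
      have "?t 0 * x ^ (2 * b + 1) = x powi ((int b)\<^sup>2) * x ^ (2 * b + 1)"
        using qbinom_0_right[OF p] by simp
      also have "\<dots> = x powi ((int 0 - int (Suc b))\<^sup>2)"
        unfolding pw'[of "2 * b + 1"] mul by (rule arg_cong[where f = "\<lambda>i. x powi i"]) (simp add: power2_eq_square algebra_simps)
      finally show ?thesis .
    qed
    finally show ?case
      by (subst sum.atMost_Suc_shift) (use qbinom_0_right[OF p] in simp)
  qed (use qbinom_0_right[OF p] in simp)
  show ?thesis
  proof (induction a)
    case 0
    then show ?case using B by simp
  next
    case (Suc a)
    let ?N = "a + b"
    let ?t = "\<lambda>k. qbinom (x\<^sup>2) ?N k * z ^ k * x powi ((int k - int b)\<^sup>2)"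
    have "(\<Prod>j<Suc a. 1 + z * x ^ (2 * j + 1)) * (\<Prod>j<b. z + x ^ (2 * j + 1)) =
        (\<Sum>k\<le>?N. ?t k) * (1 + z * x ^ (2 * a + 1))"
      using Suc.IH by (simp add: mult_ac)
    also have "\<dots> = (\<Sum>k\<le>?N. ?t k) + (\<Sum>k\<le>?N. ?t k * (z * x ^ (2 * a + 1)))"
      by (simp add: distrib_left sum_distrib_right)
    also have "(\<Sum>k\<le>?N. ?t k) = (\<Sum>k\<le>Suc ?N. ?t k)"
      by (simp add: qbinom_def)
    also have "\<dots> = ?t 0 + (\<Sum>k\<le>?N. ?t (Suc k))"
      by (rule sum.atMost_Suc_shift)
    also have "\<dots> + (\<Sum>k\<le>?N. ?t k * (z * x ^ (2 * a + 1))) = ?t 0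
        + (\<Sum>k\<le>?N. ?t (Suc k) + ?t k * (z * x ^ (2 * a + 1)))"
      by (simp add: sum.distrib)
    also have "(\<Sum>k\<le>?N. ?t (Suc k) + ?t k * (z * x ^ (2 * a + 1))) =
       (\<Sum>k\<le>?N. qbinom (x\<^sup>2) (Suc ?N) (Suc k) * z ^ Suc k * x powi ((int (Suc k) - int b)\<^sup>2))"
    proof (intro sum.cong refl)
      fix k assume "k \<in> {..?N}"
      then have k: "k \<le> ?N" by simp
      have e: "x powi ((int k - int b)\<^sup>2) * x ^ (2 * a + 1) =
               (x\<^sup>2) ^ (?N - k) * x powi ((int (Suc k) - int b)\<^sup>2)"
        unfolding pw pw'[of "2 * a + 1"] mul using k
        by (intro arg_cong[where f = "\<lambda>i. x powi i"]) (simp add: power2_eq_square algebra_simps of_nat_diff)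
      have "?t k * (z * x ^ (2 * a + 1)) = qbinom (x\<^sup>2) ?N k * z ^ Suc k * (x powi ((int k - int b)\<^sup>2) * x ^ (2 * a + 1))"
        by (simp add: mult_ac)
      then show "?t (Suc k) + ?t k * (z * x ^ (2 * a + 1)) =
         qbinom (x\<^sup>2) (Suc ?N) (Suc k) * z ^ Suc k * x powi ((int (Suc k) - int b)\<^sup>2)"
        unfolding e qbinom_Suc_Suc[OF p k] by (simp add: algebra_simps)
    qed
    finally show ?case
      by (simp add: sum.atMost_Suc_shift qbinom_0_right[OF p] del: sum.atMost_Suc)
  qed
qed

lemma sum_lessThan_add: "(\<Sum>k<m+n. g k) = (\<Sum>k<m. g k) + (\<Sum>k<n. g (m + k))"
  for g :: "nat \<Rightarrow> 'a :: comm_monoid_add"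
  by (induction n) (auto simp: add_ac)

lemma qbinom_sym: "k \<le> N \<Longrightarrow> qbinom p N (N - k) = qbinom p N k"
  by (simp add: qbinom_def mult.commute)

text \<open>The numerator is at most 1 and both denominators are at least the infinite product. The
  bound is uniform in \<open>N\<close> and \<open>k\<close>, as Tannery's theorem will
  require.\<close>

lemma qbinom_nonneg_le:
  assumes p: "0 < p" "p < 1"
  shows "0 \<le> qbinom p N k" "qbinom p N k \<le> 1 / (qprod_inf p)\<^sup>2"
proof -
  note pos = qprod_pos[OF p] qprod_inf_pos[OF p]
  show "0 \<le> qbinom p N k"
    using pos by (auto simp: qbinom_def intro!: divide_nonneg_nonneg mult_nonneg_nonneg less_imp_le)
  have "qprod p N / (qprod p k * qprod p (N - k)) \<le> 1 / (qprod_inf p * qprod_inf p)"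
    using pos qprod_le_1[OF p, of N] qprod_inf_le[OF p]
    by (intro frac_le mult_mono mult_pos_pos) (auto intro: less_imp_le)
  then show "qbinom p N k \<le> 1 / (qprod_inf p)\<^sup>2"
    using pos(2) by (auto simp: qbinom_def power2_eq_square)
qed

text \<open>All three indices \<open>2 * n\<close>, \<open>n + m\<close> and \<open>n - m\<close>
  tend to infinity, so each finite product tends to \<open>qprod_inf p\<close>, and one of the two
  in the denominator cancels.\<close>

lemma qbinom_central_tendsto:
  assumes p: "0 < p" "p < 1"
  shows "(\<lambda>n. qbinom p (2 * n) (n + m)) \<longlonglongrightarrow> 1 / qprod_inf p"
proof -
  have P: "qprod_inf p \<noteq> 0" using qprod_inf_pos[OF p] by simp
  have T: "(\<lambda>n. qprod p (h n)) \<longlonglongrightarrow> qprod_inf p" if "filterlim h at_top sequentially" for h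
    using filterlim_compose[OF qprod_tendsto[OF p] that] .
  have 1: "filterlim (\<lambda>n::nat. 2 * n) at_top sequentially"
    by (rule mult_nat_left_at_top) simp
  have 2: "filterlim (\<lambda>n::nat. n + m) at_top sequentially"
    by (rule filterlim_add_const_nat_at_top)
  have 3: "filterlim (\<lambda>n::nat. n - m) at_top sequentially"
    by (rule filterlim_minus_const_nat_at_top)
  have "(\<lambda>n. qprod p (2 * n) / (qprod p (n + m) * qprod p (n - m)))
      \<longlonglongrightarrow> qprod_inf p / (qprod_inf p * qprod_inf p)"
    by (intro tendsto_intros T 1 2 3) (use P in auto)
  moreover have "\<forall>\<^sub>F n in sequentially. qprod p (2 * n) / (qprod p (n + m) * qprod p (n - m)) =
      qbinom p (2 * n) (n + m)"
    using eventually_ge_at_top[of m] by eventually_elim (simp add: qbinom_def mult_2)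
  ultimately show ?thesis
    using P by (simp add: tendsto_cong)
qed

text \<open>The case a = b = n, divided by \<open>z ^ n\<close>: the terms of index
  \<open>n + Suc m\<close> and \<open>n - Suc m\<close> have the same coefficient and the same
  square in the exponent, and pair up.\<close>

lemma finite_triple_product:
  fixes x z :: real
  assumes x: "0 < x" "x < 1" and z: "z \<noteq> 0"
  shows "(\<Prod>j<n. (1 + z * x ^ (2 * j + 1)) * (1 + x ^ (2 * j + 1) / z)) = qbinom (x\<^sup>2) (2 * n) n +
    (\<Sum>m<n. qbinom (x\<^sup>2) (2 * n) (n + Suc m) * ((z ^ Suc m + 1 / z ^ Suc m) * x ^ (Suc m)\<^sup>2))"
proof -
  let ?g = "\<lambda>k. qbinom (x\<^sup>2) (2 * n) k * z ^ k * x powi ((int k - int n)\<^sup>2)"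
  have pw: "x powi ((int m)\<^sup>2) = x ^ m\<^sup>2" for m
    by (metis of_nat_power power_int_of_nat)
  have "z ^ n * (\<Prod>j<n. (1 + z * x ^ (2 * j + 1)) * (1 + x ^ (2 * j + 1) / z)) =
     (\<Prod>j<n. (1 + z * x ^ (2 * j + 1)) * (z + x ^ (2 * j + 1)))"
  proof -
    have "z * ((1 + z * y) * (1 + y / z)) = (1 + z * y) * (z + y)" for y
      using z by (simp add: algebra_simps)
    then have "(\<Prod>j<n. (1 + z * x ^ (2 * j + 1)) * (z + x ^ (2 * j + 1))) =
       (\<Prod>j<n. z * ((1 + z * x ^ (2 * j + 1)) * (1 + x ^ (2 * j + 1) / z)))"
      by (simp only:)
    also have "\<dots> = (\<Prod>j<n. z) * (\<Prod>j<n. (1 + z * x ^ (2 * j + 1)) * (1 + x ^ (2 * j + 1) / z))"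
      by (rule prod.distrib)
    finally show ?thesis by simp
  qed
  also have "\<dots> = (\<Sum>k<n + Suc n. ?g k)"
    using finite_triple_product_general[OF x, of z n n]
    by (simp add: prod.distrib lessThan_Suc_atMost mult_2 del: sum.lessThan_Suc)
  also have "\<dots> = (\<Sum>k<n. ?g (n - Suc k)) + (\<Sum>k<Suc n. ?g (n + k))"
    by (simp only: sum_lessThan_add sum.nat_diff_reindex[of ?g n])
  also have "(\<Sum>k<n. ?g (n - Suc k)) = z ^ n * (\<Sum>m<n. qbinom (x\<^sup>2) (2 * n) (n + Suc m) * (1 / z ^ Suc m * x ^ (Suc m)\<^sup>2))"
    unfolding sum_distrib_left
  proof (intro sum.cong refl)
    fix m assume "m \<in> {..<n}"
    then have m: "m < n" by simp
    have "qbinom (x\<^sup>2) (2 * n) (n - Suc m) = qbinom (x\<^sup>2) (2 * n) (n + Suc m)"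
      using qbinom_sym[of "n + Suc m" "2 * n" "x\<^sup>2"] m by (simp add: mult_2)
    moreover have "z ^ (n - Suc m) = z ^ n * (1 / z ^ Suc m)"
      using z m by (simp add: power_diff del: power_Suc)
    moreover have "x powi ((int (n - Suc m) - int n)\<^sup>2) = x ^ (Suc m)\<^sup>2"
    proof -
      have "int (n - Suc m) - int n = - int (Suc m)" using m by simp
      then show ?thesis using pw[of "Suc m"] by (simp only: power2_minus)
    qed
    ultimately show "?g (n - Suc m) = z ^ n * (qbinom (x\<^sup>2) (2 * n) (n + Suc m) * (1 / z ^ Suc m * x ^ (Suc m)\<^sup>2))"
      by (simp only: mult_ac)
  qed
  also have "(\<Sum>k<Suc n. ?g (n + k)) = ?g n + (\<Sum>m<n. ?g (n + Suc m))"
    by (subst sum.lessThan_Suc_shift) simp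
  also have "(\<Sum>m<n. ?g (n + Suc m)) = z ^ n * (\<Sum>m<n. qbinom (x\<^sup>2) (2 * n) (n + Suc m) * (z ^ Suc m * x ^ (Suc m)\<^sup>2))"
    unfolding sum_distrib_left
  proof (intro sum.cong refl)
    fix m
    have "int (n + Suc m) - int n = int (Suc m)" by simp
    then show "?g (n + Suc m) = z ^ n * (qbinom (x\<^sup>2) (2 * n) (n + Suc m) * (z ^ Suc m * x ^ (Suc m)\<^sup>2))"
      using pw[of "Suc m"] by (simp only: power_add mult_ac)
  qed
  also have "?g n = z ^ n * qbinom (x\<^sup>2) (2 * n) n"
    by simp
  finally have "z ^ n * (\<Prod>j<n. (1 + z * x ^ (2 * j + 1)) * (1 + x ^ (2 * j + 1) / z)) =
    z ^ n * (qbinom (x\<^sup>2) (2 * n) n +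
    (\<Sum>m<n. qbinom (x\<^sup>2) (2 * n) (n + Suc m) * ((z ^ Suc m + 1 / z ^ Suc m) * x ^ (Suc m)\<^sup>2)))"
    by (simp only: distrib_left distrib_right sum.distrib add_ac)
  then show ?thesis using z by simp
qed

text \<open>Limit of the finite identity by Tannery's theorem. The range of \<open>z\<close> covers
  the three uses z = 1, z = -1 and z = x; the value \<open>W\<close> of the product is left to the
  caller, as each use expresses it differently through \<open>qprod_inf\<close>.\<close>

lemma triple_product:
  fixes x z :: real
  assumes x: "0 < x" "x < 1" and z: "x \<le> \<bar>z\<bar>" "\<bar>z\<bar> \<le> 1"
    and W: "(\<lambda>n. \<Prod>j<n. (1 + z * x ^ (2 * j + 1)) * (1 + x ^ (2 * j + 1) / z)) \<longlonglongrightarrow> W"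
  shows "(\<lambda>m. (z ^ Suc m + 1 / z ^ Suc m) * x ^ (Suc m)\<^sup>2) sums (W * qprod_inf (x\<^sup>2) - 1)"
proof -
  have z0: "z \<noteq> 0" using x z by auto
  have p: "0 < x\<^sup>2" "x\<^sup>2 < 1"
    using x by (auto simp: power_less_one_iff abs_square_less_1)
  define P where "P = qprod_inf (x\<^sup>2)"
  have P: "P > 0" unfolding P_def by (rule qprod_inf_pos[OF p])
  define t where "t = (\<lambda>m. (z ^ Suc m + 1 / z ^ Suc m) * x ^ (Suc m)\<^sup>2)"
  define a where "a = (\<lambda>m n. if m < n then qbinom (x\<^sup>2) (2 * n) (n + Suc m) * t m else 0)"
  \<comment> \<open>At worst \<open>\<bar>z\<bar> = x\<close>, where 1 / z^(m+1) costs a factor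
    \<open>x ^ Suc m\<close>; the square in the exponent absorbs it and still leaves the decay
    \<open>x ^ m\<close>.\<close>
  have t_le: "\<bar>t m\<bar> \<le> 2 * x ^ m" for m
  proof -
    have le: "x ^ Suc m \<le> \<bar>z\<bar> ^ Suc m" "\<bar>z\<bar> ^ Suc m \<le> 1"
      using x z by (auto intro!: power_mono power_le_one simp del: power_Suc)
    have pos: "0 < x ^ Suc m" using x by simp
    have "1 / \<bar>z\<bar> ^ Suc m \<le> 1 / x ^ Suc m"
      using le pos by (intro divide_left_mono mult_pos_pos) (auto simp del: power_Suc)
    moreover have "1 \<le> 1 / x ^ Suc m"
      using pos le by (simp add: le_divide_eq_1_pos del: power_Suc)
    ultimately have "\<bar>z\<bar> ^ Suc m + 1 / \<bar>z\<bar> ^ Suc m \<le> 2 / x ^ Suc m"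
      using le by linarith
    moreover have "\<bar>z ^ Suc m + 1 / z ^ Suc m\<bar> \<le> \<bar>z\<bar> ^ Suc m + 1 / \<bar>z\<bar> ^ Suc m"
      by (rule order_trans[OF abs_triangle_ineq]) (simp add: power_abs abs_mult del: power_Suc)
    ultimately have "\<bar>z ^ Suc m + 1 / z ^ Suc m\<bar> \<le> 2 / x ^ Suc m" by linarith
    then have "\<bar>t m\<bar> \<le> 2 / x ^ Suc m * x ^ (Suc m)\<^sup>2"
      unfolding t_def abs_mult using x by (intro mult_mono) (auto simp: power_abs)
    also have "(Suc m)\<^sup>2 = Suc m + (m + m * m)"
      by (simp add: power2_eq_square)
    also have "2 / x ^ Suc m * x ^ (Suc m + (m + m * m)) = 2 * x ^ (m + m * m)"
      using x by (simp add: power_add)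
    also have "\<dots> \<le> 2 * x ^ m"
      using x by (intro mult_left_mono power_decreasing) auto
    finally show ?thesis .
  qed
  have tannery: "(\<forall>\<^sub>F n in sequentially. summable (\<lambda>k. norm (a k n))) \<and>
      summable (\<lambda>m. norm (1 / P * t m)) \<and>
      ((\<lambda>n. suminf (\<lambda>k. a k n)) \<longlongrightarrow> (\<Sum>m. 1 / P * t m)) sequentially"
  proof (rule tannerys_theorem)
    fix m
    have "(\<lambda>n. qbinom (x\<^sup>2) (2 * n) (n + Suc m) * t m) \<longlonglongrightarrow> 1 / P * t m"
      unfolding P_def by (intro tendsto_intros qbinom_central_tendsto p)
    moreover have "\<forall>\<^sub>F n in sequentially. qbinom (x\<^sup>2) (2 * n) (n + Suc m) * t m = a m n"
      using eventually_gt_at_top[of m] by eventually_elim (simp add: a_def)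
    ultimately show "(\<lambda>n. a m n) \<longlonglongrightarrow> 1 / P * t m"
      by (simp add: tendsto_cong)
  next
    show "\<forall>\<^sub>F (k, n) in sequentially \<times>\<^sub>F sequentially. norm (a k n) \<le> 1 / P\<^sup>2 * (2 * x ^ k)"
    proof (intro always_eventually allI, clarify)
      fix k n
      have "\<bar>qbinom (x\<^sup>2) (2 * n) (n + Suc k)\<bar> * \<bar>t k\<bar> \<le> 1 / P\<^sup>2 * (2 * x ^ k)"
        using qbinom_nonneg_le[OF p, of "2 * n" "n + Suc k"] t_le[of k]
        by (intro mult_mono) (auto simp: P_def)
      then show "norm (a k n) \<le> 1 / P\<^sup>2 * (2 * x ^ k)"
        using x by (auto simp: a_def abs_mult)
    qed
  qed (use x in \<open>auto intro!: summable_mult summable_geometric\<close>)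
  note lim = tannery[THEN conjunct2, THEN conjunct2]
  have sm: "summable (\<lambda>m. 1 / P * t m)"
    by (rule summable_norm_cancel) (rule tannery[THEN conjunct2, THEN conjunct1])
  \<comment> \<open>The middle coefficient is written with \<open>n + 0\<close> so that
    \<open>qbinom_central_tendsto\<close> applies to it too.\<close>
  have "suminf (\<lambda>k. a k n) = (\<Prod>j<n. (1 + z * x ^ (2 * j + 1)) * (1 + x ^ (2 * j + 1) / z))
      - qbinom (x\<^sup>2) (2 * n) (n + 0)" for n
  proof -
    have "suminf (\<lambda>k. a k n) = (\<Sum>k<n. a k n)"
      by (rule suminf_finite) (auto simp: a_def)
    also have "\<dots> = (\<Sum>m<n. qbinom (x\<^sup>2) (2 * n) (n + Suc m) * t m)"
      by (intro sum.cong) (auto simp: a_def)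
    finally show ?thesis
      unfolding finite_triple_product[OF x z0] t_def by simp
  qed
  then have "(\<lambda>n. suminf (\<lambda>k. a k n)) \<longlonglongrightarrow> W - 1 / P"
    unfolding P_def by (simp only:) (intro tendsto_intros W qbinom_central_tendsto p)
  then have "(\<Sum>m. 1 / P * t m) = W - 1 / P"
    using lim LIMSEQ_unique by blast
  then have "(\<lambda>m. 1 / P * t m) sums (W - 1 / P)"
    using sm by (simp add: sums_iff)
  then have "(\<lambda>m. P * (1 / P * t m)) sums (P * (W - 1 / P))"
    by (rule sums_mult)
  then have "t sums (W * P - 1)"
    using P by (simp add: algebra_simps)
  then show ?thesis
    unfolding t_def P_def .
qed

section \<open>Theta constants\<close>

lemma prod_odd_qprod:
  "(\<Prod>j<n. 1 - x ^ (2 * j + 1)) * qprod (x\<^sup>2) n = qprod x (2 * n)"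
proof (induction n)
  case (Suc n)
  have "(\<Prod>j<Suc n. 1 - x ^ (2 * j + 1)) * qprod (x\<^sup>2) (Suc n) =
      (\<Prod>j<n. 1 - x ^ (2 * j + 1)) * qprod (x\<^sup>2) n * (1 - x ^ (2 * n + 1)) * (1 - (x\<^sup>2) ^ Suc n)"
    by (simp add: qprod_Suc del: power_Suc)
  also have "\<dots> = qprod x (2 * n) * (1 - x ^ Suc (2 * n)) * (1 - x ^ Suc (Suc (2 * n)))"
    unfolding Suc.IH power_mult[symmetric] by simp
  also have "\<dots> = qprod x (2 * Suc n)"
    by (simp add: qprod_Suc del: power_Suc)
  finally show ?case .
qed simp

lemma prod_odd_plus_qprod:
  "(\<Prod>j<n. 1 + x ^ (2 * j + 1)) * (\<Prod>j<n. 1 - x ^ (2 * j + 1)) * qprod (x ^ 4) n = qprod (x\<^sup>2) (2 * n)"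
proof -
  have "(\<Prod>j<n. 1 + x ^ (2 * j + 1)) * (\<Prod>j<n. 1 - x ^ (2 * j + 1)) = (\<Prod>j<n. 1 - (x\<^sup>2) ^ (2 * j + 1))"
    unfolding prod.distrib[symmetric] power_mult[symmetric]
    by (intro prod.cong refl) (simp add: algebra_simps power_add[symmetric] mult_2 del: power_Suc flip: power_mult_distrib)
  then show ?thesis
    using prod_odd_qprod[where x = "x\<^sup>2" and n = n] by simp
qed

lemma prod_plus_qprod: "(\<Prod>j<n. 1 + y ^ Suc j) * qprod y n = qprod (y\<^sup>2) n"
  unfolding qprod_def prod.distrib[symmetric]
  by (intro prod.cong refl) (simp add: algebra_simps power2_eq_square power_mult_distrib)

text \<open>For z = x the factors of the triple product are 1 + y^j and 1 + y^(j+1) with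
  \<open>y = x\<^sup>2\<close>. The two products run one step apart, and the factor at
  \<open>j = 0\<close> is the 2.\<close>

lemma prod_plus_shift: "(\<Prod>j<n. 1 + y ^ j) * (1 + y ^ n) = 2 * (\<Prod>j<n. 1 + y ^ Suc j)"
  for y :: real
proof (induction n)
  case (Suc n)
  have "(\<Prod>j<Suc n. 1 + y ^ j) * (1 + y ^ Suc n) = (\<Prod>j<n. 1 + y ^ j) * (1 + y ^ n) * (1 + y ^ Suc n)"
    by simp
  also have "\<dots> = 2 * (\<Prod>j<Suc n. 1 + y ^ Suc j)"
    unfolding Suc.IH by simp
  finally show ?case .
qed simp

text \<open>Jacobi's theta constant with the nome as argument. In the convention of the statement,
  \<open>theta \<tau>\<close> is \<open>theta3\<close> at exp(2 pi \<i> \<tau>).\<close>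

definition theta3 :: "real \<Rightarrow> real" where
  "theta3 x = 1 + 2 * (\<Sum>k. x ^ (Suc k)\<^sup>2)"

definition theta4 :: "real \<Rightarrow> real" where
  "theta4 x = 1 + 2 * (\<Sum>k. (-1) ^ Suc k * x ^ (Suc k)\<^sup>2)"

text \<open>In the nome \<open>x\<close> the second theta constant is \<open>2 x\<^sup>1\<^sup>/\<^sup>4 psi x\<close>.\<close>

definition psi :: "real \<Rightarrow> real" where
  "psi x = (\<Sum>k. x ^ (k * Suc k))"

lemma powers_less_1:
  fixes x :: real
  assumes "0 < x" "x < 1" "0 < n"
  shows "0 < x ^ n" "x ^ n < 1"
  using assms by (auto simp: power_less_one_iff)

lemma filterlim_double: "filterlim (\<lambda>n::nat. 2 * n) at_top sequentially"
  by (rule mult_nat_left_at_top) simp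

context
  fixes x :: real
  assumes x: "0 < x" "x < 1"
begin

lemma unit_interval_power2: "0 < x\<^sup>2" "x\<^sup>2 < 1"
  by (rule powers_less_1[OF x], simp)+

lemma unit_interval_power4: "0 < x ^ 4" "x ^ 4 < 1"
  by (rule powers_less_1[OF x], simp)+

lemma qprod_double_tendsto: "(\<lambda>n. qprod x (2 * n)) \<longlonglongrightarrow> qprod_inf x"
  by (rule filterlim_compose[OF qprod_tendsto[OF x] filterlim_double])

lemma prod_odd_tendsto:
  "(\<lambda>n. \<Prod>j<n. 1 - x ^ (2 * j + 1)) \<longlonglongrightarrow> qprod_inf x / qprod_inf (x\<^sup>2)"
proof -
  have "(\<Prod>j<n. 1 - x ^ (2 * j + 1)) = qprod x (2 * n) / qprod (x\<^sup>2) n" for n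
    using prod_odd_qprod[of x n] qprod_pos[OF unit_interval_power2, of n] by (simp add: field_simps)
  then show ?thesis
    using qprod_inf_pos[OF unit_interval_power2]
    by (simp only:) (intro tendsto_intros qprod_double_tendsto qprod_tendsto[OF unit_interval_power2], simp)
qed

lemma prod_odd_plus_tendsto:
  "(\<lambda>n. \<Prod>j<n. 1 + x ^ (2 * j + 1)) \<longlonglongrightarrow> (qprod_inf (x\<^sup>2))\<^sup>2 / (qprod_inf x * qprod_inf (x ^ 4))"
proof -
  have B: "(\<Prod>j<n. 1 - x ^ (2 * j + 1)) > 0" for n
    using x by (intro prod_pos) (simp add: power_less_one_iff power_Suc_less_one del: power_Suc)
  have "(\<Prod>j<n. 1 + x ^ (2 * j + 1)) = qprod (x\<^sup>2) (2 * n) / ((\<Prod>j<n. 1 - x ^ (2 * j + 1)) * qprod (x ^ 4) n)" for n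
  proof -
    have "a = r / (b * q)" if "a * b * q = r" "0 < b" "0 < q" for a b q r :: real
      using that by (auto simp: field_simps)
    from this[OF prod_odd_plus_qprod B qprod_pos[OF unit_interval_power4]] show ?thesis .
  qed
  moreover have "(\<lambda>n. qprod (x\<^sup>2) (2 * n) / ((\<Prod>j<n. 1 - x ^ (2 * j + 1)) * qprod (x ^ 4) n))
      \<longlonglongrightarrow> qprod_inf (x\<^sup>2) / (qprod_inf x / qprod_inf (x\<^sup>2) * qprod_inf (x ^ 4))"
    using qprod_inf_pos[OF x] qprod_inf_pos[OF unit_interval_power2] qprod_inf_pos[OF unit_interval_power4]
    by (intro tendsto_intros prod_odd_tendsto qprod_tendsto[OF unit_interval_power4]
        filterlim_compose[OF qprod_tendsto[OF unit_interval_power2] filterlim_double]) auto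
  ultimately show ?thesis
    by (simp add: power2_eq_square)
qed

lemma prod_plus_tendsto:
  "(\<lambda>n. \<Prod>j<n. 1 + x ^ Suc j) \<longlonglongrightarrow> qprod_inf (x\<^sup>2) / qprod_inf x"
proof -
  have "(\<Prod>j<n. 1 + x ^ Suc j) = qprod (x\<^sup>2) n / qprod x n" for n
    using prod_plus_qprod[of x n] qprod_pos[OF x, of n] by (simp add: field_simps)
  then show ?thesis
    using qprod_inf_pos[OF x]
    by (simp only:) (intro tendsto_intros qprod_tendsto x unit_interval_power2, auto)
qed

text \<open>The triple product at z = 1, which yields convergence and value together; z = -1 does
  the same for \<open>theta4\<close> below.\<close>

lemma theta3_sums: "(\<lambda>k. x ^ (Suc k)\<^sup>2) sums ((theta3 x - 1) / 2)"
  and theta3_prod: "theta3 x = qprod_inf (x\<^sup>2) ^ 5 / ((qprod_inf x)\<^sup>2 * (qprod_inf (x ^ 4))\<^sup>2)"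
proof -
  define W where "W = ((qprod_inf (x\<^sup>2))\<^sup>2 / (qprod_inf x * qprod_inf (x ^ 4)))\<^sup>2"
  have "(\<lambda>n. (\<Prod>j<n. 1 + x ^ (2 * j + 1)) ^ 2) \<longlonglongrightarrow> W"
    unfolding W_def by (intro tendsto_intros prod_odd_plus_tendsto)
  then have "(\<lambda>n. \<Prod>j<n. (1 + 1 * x ^ (2 * j + 1)) * (1 + x ^ (2 * j + 1) / 1)) \<longlonglongrightarrow> W"
    by (simp add: prod.distrib power2_eq_square)
  from triple_product[OF x _ _ this]
  have "(\<lambda>m. 2 * x ^ (Suc m)\<^sup>2) sums (W * qprod_inf (x\<^sup>2) - 1)"
    using x by simp
  from sums_divide[OF this, of 2]
  have s: "(\<lambda>m. x ^ (Suc m)\<^sup>2) sums ((W * qprod_inf (x\<^sup>2) - 1) / 2)" by simp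
  then have e: "theta3 x = W * qprod_inf (x\<^sup>2)"
    by (simp add: theta3_def sums_iff)
  show "(\<lambda>k. x ^ (Suc k)\<^sup>2) sums ((theta3 x - 1) / 2)" using s e by simp
  show "theta3 x = qprod_inf (x\<^sup>2) ^ 5 / ((qprod_inf x)\<^sup>2 * (qprod_inf (x ^ 4))\<^sup>2)"
    unfolding e W_def by (simp add: power_divide power_mult_distrib flip: power_mult) (simp add: eval_nat_numeral)
qed

lemma theta4_sums: "(\<lambda>k. (-1) ^ Suc k * x ^ (Suc k)\<^sup>2) sums ((theta4 x - 1) / 2)"
  and theta4_prod: "theta4 x = (qprod_inf x)\<^sup>2 / qprod_inf (x\<^sup>2)"
proof -
  define W where "W = (qprod_inf x / qprod_inf (x\<^sup>2))\<^sup>2"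
  have "(\<lambda>n. (\<Prod>j<n. 1 - x ^ (2 * j + 1)) ^ 2) \<longlonglongrightarrow> W"
    unfolding W_def by (intro tendsto_intros prod_odd_tendsto)
  then have "(\<lambda>n. \<Prod>j<n. (1 + (- 1) * x ^ (2 * j + 1)) * (1 + x ^ (2 * j + 1) / (- 1))) \<longlonglongrightarrow> W"
    by (simp add: prod.distrib power2_eq_square)
  from triple_product[OF x _ _ this]
  have "(\<lambda>m. ((-1) ^ Suc m + 1 / (-1) ^ Suc m) * x ^ (Suc m)\<^sup>2) sums (W * qprod_inf (x\<^sup>2) - 1)"
    using x by simp
  also have "(\<lambda>m. ((-1) ^ Suc m + 1 / (-1) ^ Suc m) * x ^ (Suc m)\<^sup>2) = (\<lambda>m. 2 * ((-1) ^ Suc m * x ^ (Suc m)\<^sup>2))"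
    by (rule ext, case_tac "even m") auto
  finally have "(\<lambda>m. 2 * ((-1) ^ Suc m * x ^ (Suc m)\<^sup>2)) sums (W * qprod_inf (x\<^sup>2) - 1)" .
  from sums_divide[OF this, of 2]
  have s: "(\<lambda>m. (-1) ^ Suc m * x ^ (Suc m)\<^sup>2) sums ((W * qprod_inf (x\<^sup>2) - 1) / 2)" by simp
  then have "(\<Sum>m. (-1) ^ Suc m * x ^ (Suc m)\<^sup>2) = (W * qprod_inf (x\<^sup>2) - 1) / 2"
    by (simp only: sums_iff)
  then have e: "theta4 x = W * qprod_inf (x\<^sup>2)"
    by (simp add: theta4_def del: power_Suc)
  show "(\<lambda>k. (-1) ^ Suc k * x ^ (Suc k)\<^sup>2) sums ((theta4 x - 1) / 2)" using s e by simp
  show "theta4 x = (qprod_inf x)\<^sup>2 / qprod_inf (x\<^sup>2)"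
    unfolding e W_def by (simp add: power_divide) (simp add: eval_nat_numeral)
qed

end

text \<open>The triple product at the boundary value z = x: its term of index m splits into
  x^(m(m+1)) + x^((m+1)(m+2)), two consecutive terms of \<open>psi\<close>, so the series sums to
  \<open>psi x + (psi x - 1)\<close>.\<close>

lemma
  fixes x :: real
  assumes x: "0 < x" "x < 1"
  shows psi_sums: "(\<lambda>k. x ^ (k * Suc k)) sums psi x"
    and psi_prod: "psi x = (qprod_inf (x ^ 4))\<^sup>2 / qprod_inf (x\<^sup>2)"
proof -
  define W where "W = 2 * (qprod_inf (x ^ 4) / qprod_inf (x\<^sup>2))\<^sup>2"
  let ?C = "\<lambda>n. \<Prod>j<n. 1 + (x\<^sup>2) ^ Suc j"
  have C: "?C \<longlonglongrightarrow> qprod_inf (x ^ 4) / qprod_inf (x\<^sup>2)"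
    using prod_plus_tendsto[OF unit_interval_power2[OF x]] by simp
  have Z: "(\<lambda>n. (x\<^sup>2) ^ n) \<longlonglongrightarrow> 0"
    by (intro LIMSEQ_realpow_zero less_imp_le unit_interval_power2 x)
  have "(\<lambda>n. 2 * ?C n / (1 + (x\<^sup>2) ^ n) * ?C n) \<longlonglongrightarrow>
      2 * (qprod_inf (x ^ 4) / qprod_inf (x\<^sup>2)) / (1 + 0) * (qprod_inf (x ^ 4) / qprod_inf (x\<^sup>2))"
    by (intro tendsto_mult tendsto_divide tendsto_add tendsto_const C Z) auto
  also have "(\<lambda>n. 2 * ?C n / (1 + (x\<^sup>2) ^ n) * ?C n) =
      (\<lambda>n. \<Prod>j<n. (1 + x * x ^ (2 * j + 1)) * (1 + x ^ (2 * j + 1) / x))"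
  proof
    fix n
    have "1 + (x\<^sup>2) ^ n > 0" using x by (intro add_pos_pos) auto
    then have "2 * ?C n / (1 + (x\<^sup>2) ^ n) = (\<Prod>j<n. 1 + (x\<^sup>2) ^ j)"
      using prod_plus_shift[of "x\<^sup>2" n] by (simp add: field_simps del: power_Suc)
    then have "2 * ?C n / (1 + (x\<^sup>2) ^ n) * ?C n = ?C n * (\<Prod>j<n. 1 + (x\<^sup>2) ^ j)"
      by (simp only: mult.commute)
    also have "\<dots> = (\<Prod>j<n. (1 + x * x ^ (2 * j + 1)) * (1 + x ^ (2 * j + 1) / x))"
      unfolding prod.distrib[symmetric] using x
      by (intro prod.cong refl) (simp add: power_mult power2_eq_square)
    finally show "2 * ?C n / (1 + (x\<^sup>2) ^ n) * ?C n = \<dots>" .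
  qed
  also have "2 * (qprod_inf (x ^ 4) / qprod_inf (x\<^sup>2)) / (1 + 0) * (qprod_inf (x ^ 4) / qprod_inf (x\<^sup>2)) = W"
    unfolding W_def by (simp add: power2_eq_square)
  finally have "(\<lambda>n. \<Prod>j<n. (1 + x * x ^ (2 * j + 1)) * (1 + x ^ (2 * j + 1) / x)) \<longlonglongrightarrow> W" .
  from triple_product[OF x _ _ this]
  have A: "(\<lambda>m. (x ^ Suc m + 1 / x ^ Suc m) * x ^ (Suc m)\<^sup>2) sums (W * qprod_inf (x\<^sup>2) - 1)"
    using x by simp
  have B: "(x ^ Suc m + 1 / x ^ Suc m) * x ^ (Suc m)\<^sup>2 = x ^ (m * Suc m) + x ^ (Suc m * Suc (Suc m))" for m
  proof -
    have "x ^ (Suc m)\<^sup>2 = x ^ Suc m * x ^ (m * Suc m)"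
      unfolding power_add[symmetric] by (simp add: power2_eq_square)
    moreover have "x ^ (Suc m * Suc (Suc m)) = x ^ Suc m * x ^ (Suc m)\<^sup>2"
      unfolding power_add[symmetric] by (simp add: power2_eq_square)
    ultimately show ?thesis
      using x by (simp add: distrib_right del: power_Suc)
  qed
  have sm: "summable (\<lambda>k. x ^ (k * Suc k))"
    using x by (intro summable_comparison_test'[OF summable_geometric[of x]])
      (auto simp: power_abs intro!: power_decreasing)
  then have 1: "(\<lambda>k. x ^ (k * Suc k)) sums psi x"
    by (simp add: psi_def summable_sums)
  then have "(\<lambda>k. x ^ (Suc k * Suc (Suc k))) sums (psi x - x ^ (0 * Suc 0))"
    by (subst sums_Suc_iff) simp
  from sums_add[OF 1 this] A have "psi x + (psi x - 1) = W * qprod_inf (x\<^sup>2) - 1"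
    unfolding B using sums_unique2 by fastforce
  then have "psi x = W * qprod_inf (x\<^sup>2) / 2" by simp
  then show "psi x = (qprod_inf (x ^ 4))\<^sup>2 / qprod_inf (x\<^sup>2)"
    unfolding W_def by (simp add: power_divide) (simp add: eval_nat_numeral)
  show "(\<lambda>k. x ^ (k * Suc k)) sums psi x" by (rule 1)
qed

section \<open>Relations between theta constants\<close>

context
  fixes x :: real
  assumes x: "0 < x" "x < 1"
begin

lemma theta3_pos: "theta3 x > 0"
  unfolding theta3_prod[OF x] using qprod_inf_pos[OF x] qprod_inf_pos[OF unit_interval_power2[OF x]] qprod_inf_pos[OF unit_interval_power4[OF x]]
  by simp

lemma theta4_pos: "theta4 x > 0"
  unfolding theta4_prod[OF x] using qprod_inf_pos[OF x] qprod_inf_pos[OF unit_interval_power2[OF x]]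
  by simp

text \<open>Only the even squares survive, and (2j)^2 = 4 j^2; in the difference below the odd ones
  survive, with (2j+1)^2 = 4 j (j+1) + 1.\<close>

lemma theta_add: "theta3 x + theta4 x = 2 * theta3 (x ^ 4)"
proof -
  have "(\<lambda>k. x ^ (Suc k)\<^sup>2 + (-1) ^ Suc k * x ^ (Suc k)\<^sup>2) sums ((theta3 x - 1) / 2 + (theta4 x - 1) / 2)"
    (is "?s sums _") by (intro sums_add theta3_sums theta4_sums x)
  moreover have "(\<lambda>j. ?s (2 * j + 1)) sums c \<longleftrightarrow> ?s sums c" for c
  proof (rule sums_mono_reindex)
    fix n :: nat assume "n \<notin> range (\<lambda>j. 2 * j + 1)"
    then have "even n" by (metis oddE rangeI)
    then show "?s n = 0" by simp
  qed (simp add: strict_mono_def)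
  moreover have "?s (2 * j + 1) = 2 * (x ^ 4) ^ (Suc j)\<^sup>2" for j
  proof -
    have "(Suc (2 * j + 1))\<^sup>2 = 4 * (Suc j)\<^sup>2"
      by (simp add: power2_eq_square)
    then show ?thesis
      by (simp only: power_mult[symmetric]) simp
  qed
  ultimately have "(\<lambda>j. 2 * (x ^ 4) ^ (Suc j)\<^sup>2) sums ((theta3 x - 1) / 2 + (theta4 x - 1) / 2)"
    by (simp only:)
  moreover have "(\<lambda>j. 2 * (x ^ 4) ^ (Suc j)\<^sup>2) sums (2 * ((theta3 (x ^ 4) - 1) / 2))"
    by (intro sums_mult theta3_sums unit_interval_power4 x)
  ultimately have "(theta3 x - 1) / 2 + (theta4 x - 1) / 2 = 2 * ((theta3 (x ^ 4) - 1) / 2)"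
    by (rule sums_unique2)
  note e = this
  have "a + b = 2 * c" if "(a - 1) / 2 + (b - 1) / 2 = 2 * ((c - 1) / 2)" for a b c :: real
    using that by argo
  from this[OF e] show ?thesis .
qed

lemma theta_diff: "theta3 x - theta4 x = 4 * x * psi (x ^ 4)"
proof -
  have "(\<lambda>k. x ^ (Suc k)\<^sup>2 - (-1) ^ Suc k * x ^ (Suc k)\<^sup>2) sums ((theta3 x - 1) / 2 - (theta4 x - 1) / 2)"
    (is "?s sums _") by (intro sums_diff theta3_sums theta4_sums x)
  moreover have "(\<lambda>j. ?s (2 * j)) sums c \<longleftrightarrow> ?s sums c" for c
  proof (rule sums_mono_reindex)
    fix n :: nat assume "n \<notin> range (\<lambda>j. 2 * j)"
    then have "odd n" by auto
    then show "?s n = 0" by simp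
  qed (simp add: strict_mono_def)
  moreover have "?s (2 * j) = 2 * x * (x ^ 4) ^ (j * Suc j)" for j
  proof -
    have "(Suc (2 * j))\<^sup>2 = Suc (4 * (j * Suc j))"
      by (simp add: power2_eq_square)
    then show ?thesis
      by (simp only: power_Suc power_mult[symmetric]) simp
  qed
  ultimately have "(\<lambda>j. 2 * x * (x ^ 4) ^ (j * Suc j)) sums ((theta3 x - 1) / 2 - (theta4 x - 1) / 2)"
    by (simp only:)
  moreover have "(\<lambda>j. 2 * x * (x ^ 4) ^ (j * Suc j)) sums (2 * x * psi (x ^ 4))"
    by (intro sums_mult psi_sums unit_interval_power4 x)
  ultimately have "(theta3 x - 1) / 2 - (theta4 x - 1) / 2 = 2 * x * psi (x ^ 4)"
    by (rule sums_unique2)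
  note e = this
  have "a - b = 2 * c" if "(a - 1) / 2 - (b - 1) / 2 = c" for a b c :: real
    using that by argo
  from this[OF e] show ?thesis by simp
qed

lemma theta3_mult_theta4: "theta3 x * theta4 x = (theta4 (x\<^sup>2))\<^sup>2"
proof -
  have "theta4 (x\<^sup>2) = (qprod_inf (x\<^sup>2))\<^sup>2 / qprod_inf (x ^ 4)"
    using theta4_prod[OF unit_interval_power2[OF x]] by simp
  then show ?thesis
    unfolding theta3_prod[OF x] theta4_prod[OF x]
    using qprod_inf_pos[OF x] qprod_inf_pos[OF unit_interval_power2[OF x]]
    by (simp add: field_simps) (simp add: eval_nat_numeral)
qed

text \<open>For the second theta constant this is the duplication formula theta2(x)^2 = 2
  theta2(x^2) theta3(x^2); both sides are the same quotient of Euler products.\<close>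

lemma theta3_mult_psi: "theta3 (x\<^sup>2) * psi (x\<^sup>2) = (psi x)\<^sup>2"
proof -
  have 1: "theta3 (x\<^sup>2) = qprod_inf (x ^ 4) ^ 5 / ((qprod_inf (x\<^sup>2))\<^sup>2 * (qprod_inf (x ^ 8))\<^sup>2)"
    using theta3_prod[OF unit_interval_power2[OF x]] by simp
  have 2: "psi (x\<^sup>2) = (qprod_inf (x ^ 8))\<^sup>2 / qprod_inf (x ^ 4)"
    using psi_prod[OF unit_interval_power2[OF x]] by simp
  have "x ^ 8 = (x ^ 4)\<^sup>2" by simp
  then have "qprod_inf (x ^ 8) > 0"
    using qprod_inf_pos[OF unit_interval_power2[OF unit_interval_power4[OF x]]] by (simp only:)
  then show ?thesis
    unfolding 1 2 psi_prod[OF x]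
    using qprod_inf_pos[OF unit_interval_power2[OF x]] qprod_inf_pos[OF unit_interval_power4[OF x]]
    by (simp add: field_simps) (simp add: eval_nat_numeral)
qed

lemma theta_square_series_bound:
  assumes "\<And>k. \<bar>c k\<bar> \<le> 1" and s: "(\<lambda>k. c k * x ^ (Suc k)\<^sup>2) sums S"
  shows "\<bar>S\<bar> \<le> x / (1 - x)"
proof -
  have g: "(\<lambda>k. x * x ^ k) sums (x * (1 / (1 - x)))"
    using x by (intro sums_mult geometric_sums) auto
  have le: "\<bar>c k * x ^ (Suc k)\<^sup>2\<bar> \<le> x * x ^ k" for k
  proof -
    have "\<bar>c k * x ^ (Suc k)\<^sup>2\<bar> \<le> 1 * x ^ Suc k"
      unfolding abs_mult using x assms(1)[of k]
      by (intro mult_mono) (auto simp: power_abs power2_eq_square intro!: power_decreasing simp del: power_Suc)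
    then show ?thesis by simp
  qed
  have sm: "summable (\<lambda>k. \<bar>c k * x ^ (Suc k)\<^sup>2\<bar>)"
    by (rule summable_comparison_test'[OF sums_summable[OF g]]) (use le in auto)
  have "\<bar>S\<bar> \<le> (\<Sum>k. \<bar>c k * x ^ (Suc k)\<^sup>2\<bar>)"
    using summable_rabs[OF sm] s by (simp add: sums_iff)
  also have "\<dots> \<le> (\<Sum>k. x * x ^ k)"
    by (rule suminf_le[OF le sm sums_summable[OF g]])
  also have "\<dots> = x / (1 - x)"
    using g by (simp add: sums_iff)
  finally show ?thesis .
qed

lemma theta_near_1: "\<bar>theta3 x - 1\<bar> \<le> 2 * x / (1 - x)" "\<bar>theta4 x - 1\<bar> \<le> 2 * x / (1 - x)"
proof -
  have "\<bar>(theta3 x - 1) / 2\<bar> \<le> x / (1 - x)"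
    using theta3_sums[OF x] by (intro theta_square_series_bound[where c = "\<lambda>_. 1"]) auto
  then show "\<bar>theta3 x - 1\<bar> \<le> 2 * x / (1 - x)" by (simp add: mult.commute)
  have "\<bar>(theta4 x - 1) / 2\<bar> \<le> x / (1 - x)"
    using theta4_sums[OF x] by (intro theta_square_series_bound[where c = "\<lambda>k. (-1) ^ Suc k"]) (auto simp: power_abs)
  then show "\<bar>theta4 x - 1\<bar> \<le> 2 * x / (1 - x)" by (simp add: mult.commute)
qed

end

lemma iterated_square_tendsto_0:
  fixes x :: real
  assumes "0 < x" "x < 1"
  shows "(\<lambda>n. 2 ^ n * x ^ 2 ^ n) \<longlonglongrightarrow> 0" "(\<lambda>n. x ^ 2 ^ n) \<longlonglongrightarrow> 0"
proof -
  have f: "filterlim (\<lambda>n. 2 ^ n :: nat) at_top sequentially"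
    by (rule filterlim_subseq) (simp add: strict_mono_def)
  have "(\<lambda>n. of_nat n * x ^ n) \<longlonglongrightarrow> 0"
    using assms by (intro powser_times_n_limit_0) auto
  from filterlim_compose[OF this f] show "(\<lambda>n. 2 ^ n * x ^ 2 ^ n) \<longlonglongrightarrow> 0" by simp
  have "(\<lambda>n. x ^ n) \<longlonglongrightarrow> 0"
    using assms by (intro LIMSEQ_realpow_zero) auto
  from filterlim_compose[OF this f] show "(\<lambda>n. x ^ 2 ^ n) \<longlonglongrightarrow> 0" by simp
qed

lemma theta_iterate_tendsto:
  fixes x :: real
  assumes x: "0 < x" "x < 1"
  shows "(\<lambda>n. theta3 (x ^ 2 ^ n)) \<longlonglongrightarrow> 1" "(\<lambda>n. theta4 (x ^ 2 ^ n)) \<longlonglongrightarrow> 1"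
proof -
  let ?b = "\<lambda>n. 2 * x ^ 2 ^ n / (1 - x ^ 2 ^ n)"
  have "?b \<longlonglongrightarrow> 2 * 0 / (1 - 0)"
    by (intro tendsto_mult tendsto_divide tendsto_diff tendsto_const iterated_square_tendsto_0[OF x]) auto
  then have b: "?b \<longlonglongrightarrow> 0" by simp
  have "0 < x ^ 2 ^ n" "x ^ 2 ^ n < 1" for n
    by (rule powers_less_1[OF x]; simp)+
  note le = theta_near_1[OF this]
  have "(\<lambda>n. theta3 (x ^ 2 ^ n) - 1) \<longlonglongrightarrow> 0"
    by (rule Lim_null_comparison[OF _ b]) (use le in auto)
  then show "(\<lambda>n. theta3 (x ^ 2 ^ n)) \<longlonglongrightarrow> 1"
    by (simp add: LIM_zero_iff)
  have "(\<lambda>n. theta4 (x ^ 2 ^ n) - 1) \<longlonglongrightarrow> 0"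
    by (rule Lim_null_comparison[OF _ b]) (use le in auto)
  then show "(\<lambda>n. theta4 (x ^ 2 ^ n)) \<longlonglongrightarrow> 1"
    by (simp add: LIM_zero_iff)
qed

lemma theta_square_add:
  fixes x :: real
  assumes x: "0 < x" "x < 1"
  shows "(theta3 x)\<^sup>2 + (theta4 x)\<^sup>2 = 2 * (theta3 (x\<^sup>2))\<^sup>2"
proof -
  \<comment> \<open>The defect \<open>D\<close> satisfies \<open>D x = - 2 D (x\<^sup>2)\<close> and \<open>D x = O(x)\<close>, so it vanishes.\<close>
  define D where "D = (\<lambda>x. (theta3 x)\<^sup>2 + (theta4 x)\<^sup>2 - 2 * (theta3 (x\<^sup>2))\<^sup>2)"
  \<comment> \<open>Squaring \<open>theta_add\<close> expresses theta3^2 + theta4^2 by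
    \<open>theta3 (y ^ 4)\<close> and the product theta3 theta4, and that product is
    \<open>(theta4 (y\<^sup>2))\<^sup>2\<close>: these are ingredients of
    \<open>D (y\<^sup>2)\<close>.\<close>
  have step: "D y = - 2 * D (y\<^sup>2)" if y: "0 < y" "y < 1" for y
  proof -
    have "(theta3 y + theta4 y)\<^sup>2 = (2 * theta3 (y ^ 4))\<^sup>2"
      using theta_add[OF y] by simp
    then have "(theta3 y)\<^sup>2 + (theta4 y)\<^sup>2 = 4 * (theta3 (y ^ 4))\<^sup>2 - 2 * (theta3 y * theta4 y)"
      by (simp add: power2_sum power_mult_distrib)
    then show ?thesis
      unfolding D_def theta3_mult_theta4[OF y] by (simp flip: power_mult)
  qed
  have iter: "\<bar>D x\<bar> = 2 ^ n * \<bar>D (x ^ 2 ^ n)\<bar>" for n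
  proof (induction n)
    case (Suc n)
    have "0 < x ^ 2 ^ n" "x ^ 2 ^ n < 1" by (rule powers_less_1[OF x]; simp)+
    from step[OF this] have "\<bar>D (x ^ 2 ^ n)\<bar> = 2 * \<bar>D (x ^ 2 ^ Suc n)\<bar>"
      by (simp add: abs_mult mult.commute flip: power_mult)
    then show ?case using Suc.IH by simp
  qed simp
  \<comment> \<open>Below 1/2 the bound 2 z / (1 - z) is at most 4 z. Each of the three squares then
    differs from 1 by at most 16 y, and the last one counts twice: 64 = 16 + 16 + 32.\<close>
  have bound: "\<bar>D y\<bar> \<le> 64 * y" if y: "0 < y" "y < 1 / 2" for y
  proof -
    have sq: "\<bar>t\<^sup>2 - 1\<bar> \<le> 16 * y" if "\<bar>t - 1\<bar> \<le> 4 * y" for t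
    proof -
      have "\<bar>t\<^sup>2 - 1\<bar> = \<bar>t - 1\<bar> * \<bar>t + 1\<bar>"
        by (simp add: power2_eq_square algebra_simps flip: abs_mult)
      also have "\<dots> \<le> (4 * y) * 4"
        using that y by (intro mult_mono) auto
      finally show ?thesis by simp
    qed
    have near: "\<bar>theta3 z - 1\<bar> \<le> 4 * z" "\<bar>theta4 z - 1\<bar> \<le> 4 * z" if z: "0 < z" "z < 1 / 2" for z
    proof -
      have "2 * z / (1 - z) \<le> 4 * z"
        using z by (simp add: field_simps)
      then show "\<bar>theta3 z - 1\<bar> \<le> 4 * z" "\<bar>theta4 z - 1\<bar> \<le> 4 * z"
        using theta_near_1[of z] z by linarith+
    qed
    have y2: "0 < y\<^sup>2" "y\<^sup>2 \<le> y"
      using y by (auto simp: power2_eq_square)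
    have "\<bar>theta3 (y\<^sup>2) - 1\<bar> \<le> 4 * y"
      using near(1)[of "y\<^sup>2"] y2 y by linarith
    then have "\<bar>(theta3 (y\<^sup>2))\<^sup>2 - 1\<bar> \<le> 16 * y" by (rule sq)
    then show ?thesis
      unfolding D_def using sq[OF near(1)[OF y]] sq[OF near(2)[OF y]] by linarith
  qed
  \<comment> \<open>Iterating costs a factor 2^n, but the argument decreases doubly
    exponentially.\<close>
  have "(\<lambda>n. 64 * (2 ^ n * x ^ 2 ^ n)) \<longlonglongrightarrow> 64 * 0"
    by (intro tendsto_intros iterated_square_tendsto_0 x)
  moreover have "\<forall>\<^sub>F n in sequentially. \<bar>D x\<bar> \<le> 64 * (2 ^ n * x ^ 2 ^ n)"
    using order_tendstoD(2)[OF iterated_square_tendsto_0(2)[OF x], of "1/2", simplified]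
  proof eventually_elim
    case (elim n)
    have "0 < x ^ 2 ^ n" using x by simp
    moreover have "x ^ 2 ^ n < 1 / 2" using elim by simp
    ultimately show ?case
      using bound unfolding iter[of n] by simp
  qed
  ultimately have "\<bar>D x\<bar> \<le> 64 * 0"
    by (intro tendsto_lowerbound) auto
  then show ?thesis by (simp add: D_def)
qed

lemma theta_square_diff:
  fixes x :: real
  assumes x: "0 < x" "x < 1"
  shows "(theta3 x)\<^sup>2 - (theta4 x)\<^sup>2 = 8 * x * (psi (x\<^sup>2))\<^sup>2"
proof -
  have "(theta3 x)\<^sup>2 - (theta4 x)\<^sup>2 = (theta3 x + theta4 x) * (theta3 x - theta4 x)"
    by (simp add: power2_eq_square algebra_simps)
  also have "\<dots> = 8 * x * (theta3 ((x\<^sup>2)\<^sup>2) * psi ((x\<^sup>2)\<^sup>2))"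
    unfolding theta_add[OF x] theta_diff[OF x] by simp
  finally show ?thesis
    unfolding theta3_mult_psi[OF unit_interval_power2[OF x]] .
qed

text \<open>The product of the two preceding formulas, followed by duplication. The right-hand side
  is theta2^4, so this is Jacobi's theta3^4 = theta2^4 + theta4^4.\<close>

lemma theta_quartic:
  fixes x :: real
  assumes x: "0 < x" "x < 1"
  shows "theta3 x ^ 4 - theta4 x ^ 4 = 16 * x * psi x ^ 4"
proof -
  have "theta3 x ^ 4 - theta4 x ^ 4 = ((theta3 x)\<^sup>2 + (theta4 x)\<^sup>2) * ((theta3 x)\<^sup>2 - (theta4 x)\<^sup>2)"
    by (simp add: eval_nat_numeral algebra_simps)
  also have "\<dots> = 16 * x * (theta3 (x\<^sup>2) * psi (x\<^sup>2))\<^sup>2"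
    unfolding theta_square_add[OF x] theta_square_diff[OF x] by (simp add: power_mult_distrib)
  finally show ?thesis
    unfolding theta3_mult_psi[OF x] by simp
qed

section \<open>The arithmetic-geometric mean integral\<close>

text \<open>For a nonnegative integrand integrability is absolute integrability, so the theorem for
  absolutely integrable functions becomes an equivalence of \<open>has_integral\<close> statements,
  usable in either direction.\<close>

lemma has_integral_change_of_variables_nonneg:
  fixes h :: "real \<Rightarrow> real" and g g' :: "real \<Rightarrow> real"
  assumes S: "open S"
    and der: "\<And>x. x \<in> S \<Longrightarrow> (g has_field_derivative g' x) (at x)"
    and inj: "inj_on g S"
    and nonneg: "\<And>y. h y \<ge> 0"
  shows "((\<lambda>x. \<bar>g' x\<bar> * h (g x)) has_integral b) S \<longleftrightarrow> (h has_integral b) (g ` S)"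
proof -
  have S': "S \<in> sets lebesgue" using S by (simp add: borel_open)
  have der': "(g has_field_derivative g' x) (at x within S)" if "x \<in> S" for x
    using der[OF that] by (rule has_field_derivative_at_within)
  have iff: "u absolutely_integrable_on A \<and> integral A u = b \<longleftrightarrow> (u has_integral b) A"
    if "\<And>x. u x \<ge> 0" for u :: "real \<Rightarrow> real" and A
    using nonnegative_absolutely_integrable_1[of u A] that
    by (auto simp: has_integral_iff dest: absolutely_integrable_on_def[THEN iffD1])
  show ?thesis
    using has_absolute_integral_change_of_variables_1'[OF S' der' inj, of h b]
      iff[of "\<lambda>x. \<bar>g' x\<bar> * h (g x)" S] iff[of h "g ` S"] nonneg
    by simp
qed

lemma has_integral_inverse_square_plus:
  fixes m :: real
  assumes "m > 0"
  shows "((\<lambda>t. 1 / (t\<^sup>2 + m\<^sup>2)) has_integral (pi / (2 * m))) {0<..}"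
proof -
  let ?S = "{0<..<pi/2}"
  let ?g = "\<lambda>\<theta>. m * tan \<theta>" and ?g' = "\<lambda>\<theta>. m * inverse ((cos \<theta>)\<^sup>2)"
  have c: "cos \<theta> > 0" if "\<theta> \<in> ?S" for \<theta>
    using that by (intro cos_gt_zero) auto
  have "inj_on ?g ?S"
    using assms by (intro inj_onI) (auto dest: arg_cong[where f = arctan] simp: arctan_tan)
  moreover have "(?g has_field_derivative ?g' \<theta>) (at \<theta>)" if "\<theta> \<in> ?S" for \<theta>
    using c[OF that] by (auto intro!: derivative_eq_intros)
  moreover have "?g ` ?S = {0<..}"
  proof (intro equalityI subsetI)
    fix y :: real assume "y \<in> {0<..}"
    then have "y = ?g (arctan (y / m))" "arctan (y / m) \<in> ?S"
      using assms arctan_ubound[of "y / m"] by (auto simp: tan_arctan)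
    then show "y \<in> ?g ` ?S" by blast
  qed (use assms in \<open>auto intro!: mult_pos_pos tan_gt_zero\<close>)
  moreover have "((\<lambda>\<theta>. \<bar>?g' \<theta>\<bar> * (1 / ((?g \<theta>)\<^sup>2 + m\<^sup>2))) has_integral (pi / (2 * m))) ?S"
  proof (rule has_integral_eq)
    have "((\<lambda>\<theta>. 1 / m) has_integral ((pi / 2 - 0) *\<^sub>R (1 / m))) {0..pi/2}"
      using has_integral_const_real[of "1 / m" 0 "pi/2"] by simp
    then show "((\<lambda>\<theta>. 1 / m) has_integral (pi / (2 * m))) ?S"
      by (simp add: has_integral_Icc_iff_Ioo)
  next
    fix \<theta> assume \<theta>: "\<theta> \<in> ?S"
    have t: "1 + (tan \<theta>)\<^sup>2 = inverse ((cos \<theta>)\<^sup>2)"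
      using tan_sec[of \<theta>] c[OF \<theta>] by (simp add: power_inverse)
    have "(?g \<theta>)\<^sup>2 + m\<^sup>2 = m * (m * (1 + (tan \<theta>)\<^sup>2))"
      by (simp add: power2_eq_square algebra_simps)
    then show "1 / m = \<bar>?g' \<theta>\<bar> * (1 / ((?g \<theta>)\<^sup>2 + m\<^sup>2))"
      unfolding t using c[OF \<theta>] assms by (simp add: abs_mult field_simps)
  qed
  ultimately show ?thesis
    using has_integral_change_of_variables_nonneg[of ?S ?g ?g' "\<lambda>t. 1 / (t\<^sup>2 + m\<^sup>2)" "pi / (2 * m)"]
    by auto
qed

text \<open>Gauss's integrand in algebraic form: t = b tan \<theta> turns its integral over the
  half-line into that of 1 / sqrt (a^2 cos^2 \<theta> + b^2 sin^2 \<theta>) over [0, pi/2].\<close>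

definition agm_integrand :: "real \<Rightarrow> real \<Rightarrow> real \<Rightarrow> real" where
  "agm_integrand a b t = 1 / sqrt ((t\<^sup>2 + a\<^sup>2) * (t\<^sup>2 + b\<^sup>2))"

definition agm_integral :: "real \<Rightarrow> real \<Rightarrow> real" where
  "agm_integral a b = integral {0<..} (agm_integrand a b)"

lemma agm_integrand_nonneg: "agm_integrand a b t \<ge> 0"
  by (simp add: agm_integrand_def)

lemma agm_integrand_bounds:
  assumes "0 < b" "b \<le> a"
  shows "1 / (t\<^sup>2 + a\<^sup>2) \<le> agm_integrand a b t" "agm_integrand a b t \<le> 1 / (t\<^sup>2 + b\<^sup>2)"
proof -
  have ba: "b\<^sup>2 \<le> a\<^sup>2" using assms by (intro power_mono) auto
  have pos: "0 < t\<^sup>2 + b\<^sup>2" using assms by (intro add_nonneg_pos) auto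
  have le: "t\<^sup>2 + b\<^sup>2 \<le> sqrt ((t\<^sup>2 + a\<^sup>2) * (t\<^sup>2 + b\<^sup>2))"
    "sqrt ((t\<^sup>2 + a\<^sup>2) * (t\<^sup>2 + b\<^sup>2)) \<le> t\<^sup>2 + a\<^sup>2"
    using ba pos by (auto intro!: real_le_rsqrt real_le_lsqrt mult_mono simp: power2_eq_square[of "t\<^sup>2 + _"])
  show "1 / (t\<^sup>2 + a\<^sup>2) \<le> agm_integrand a b t" "agm_integrand a b t \<le> 1 / (t\<^sup>2 + b\<^sup>2)"
    unfolding agm_integrand_def using pos le ba by (auto intro!: divide_left_mono mult_pos_pos)
qed

lemma agm_integrand_commute: "agm_integrand a b = agm_integrand b a"
  by (simp add: agm_integrand_def fun_eq_iff mult.commute)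

lemma has_integral_agm:
  assumes "0 < a" "0 < b"
  shows "(agm_integrand a b has_integral agm_integral a b) {0<..}"
proof -
  have *: "agm_integrand a b integrable_on {0<..}" if ab: "0 < b" "b \<le> a" for a b
  proof -
    have "0 < t\<^sup>2 + b\<^sup>2" "0 < t\<^sup>2 + a\<^sup>2" for t :: real
      using ab by (auto intro!: add_nonneg_pos)
    then have "(t\<^sup>2 + a\<^sup>2) * (t\<^sup>2 + b\<^sup>2) \<noteq> 0" for t :: real
      by (metis less_irrefl mult_eq_0_iff)
    then have "continuous_on {0<..} (agm_integrand a b)"
      unfolding agm_integrand_def by (intro continuous_intros) auto
    then have "agm_integrand a b \<in> borel_measurable (lebesgue_on {0<..})"
      by (intro continuous_imp_measurable_on_sets_lebesgue) auto
    then have "agm_integrand a b absolutely_integrable_on {0<..}"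
    proof (rule measurable_bounded_by_integrable_imp_absolutely_integrable)
      show "(\<lambda>t. 1 / (t\<^sup>2 + b\<^sup>2)) integrable_on {0<..}"
        using has_integral_inverse_square_plus[OF ab(1)] by blast
    qed (use agm_integrand_bounds(2)[OF ab] agm_integrand_nonneg in auto)
    then show ?thesis by (simp add: absolutely_integrable_on_def)
  qed
  have "agm_integrand a b integrable_on {0<..}"
    using *[of b a] *[of a b] assms by (cases "b \<le> a") (auto simp: agm_integrand_commute)
  then show ?thesis
    unfolding agm_integral_def by (rule integrable_integral)
qed

text \<open>Comparison with the two cases of equal parameters. Along the mean iteration both bounds
  close up, which replaces a continuity argument for the integral.\<close>

lemma agm_integral_bounds:
  assumes "0 < b" "b \<le> a"
  shows "pi / (2 * a) \<le> agm_integral a b" "agm_integral a b \<le> pi / (2 * b)"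
  using assms agm_integrand_bounds[OF assms]
  by (auto intro!: has_integral_le[OF has_integral_inverse_square_plus has_integral_agm]
       has_integral_le[OF has_integral_agm has_integral_inverse_square_plus])

lemma agm_integral_mean:
  assumes ab: "0 < a" "0 < b"
  shows "agm_integral ((a + b) / 2) (sqrt (a * b)) = agm_integral a b"
proof -
  \<comment> \<open>The substitution \<open>t - ab/t = 2s\<close> maps the half-line onto the whole line, and the integrand is even.\<close>
  define u where "u = agm_integrand ((a + b) / 2) (sqrt (a * b))"
  define g where "g = (\<lambda>t. (t - a * b / t) / 2)"
  define g' where "g' = (\<lambda>t. (1 + a * b / t\<^sup>2) / 2)"
  define J where "J = agm_integral ((a + b) / 2) (sqrt (a * b))"
  have abp: "a * b > 0" using ab by simp
  have u: "\<bar>g' t\<bar> * u (g t) = 2 * agm_integrand a b t" if t: "t \<in> {0<..}" for t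
  proof -
    have t: "t > 0" using that by simp
    define s where "s = sqrt ((t\<^sup>2 + a\<^sup>2) * (t\<^sup>2 + b\<^sup>2))"
    have s: "s > 0" unfolding s_def using t by (intro real_sqrt_gt_zero mult_pos_pos add_pos_nonneg) auto
    have 1: "(g t)\<^sup>2 + ((a + b) / 2)\<^sup>2 = (t\<^sup>2 + a\<^sup>2) * (t\<^sup>2 + b\<^sup>2) / (2 * t)\<^sup>2"
      unfolding g_def using t by (simp add: power2_eq_square field_simps)
    have 2: "(g t)\<^sup>2 + (sqrt (a * b))\<^sup>2 = (t\<^sup>2 + a * b)\<^sup>2 / (2 * t)\<^sup>2"
      unfolding g_def using t abp by (simp add: power2_eq_square field_simps)
    have "sqrt (((g t)\<^sup>2 + ((a + b) / 2)\<^sup>2) * ((g t)\<^sup>2 + (sqrt (a * b))\<^sup>2)) = (s / (2 * t)) * ((t\<^sup>2 + a * b) / (2 * t))"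
    proof -
      have "sqrt ((t\<^sup>2 + a\<^sup>2) * (t\<^sup>2 + b\<^sup>2) / (2 * t)\<^sup>2) = s / (2 * t)"
        using t by (simp only: real_sqrt_divide s_def real_sqrt_abs abs_of_pos zero_less_mult_iff zero_less_numeral simp_thms)
      moreover have "sqrt ((t\<^sup>2 + a * b)\<^sup>2 / (2 * t)\<^sup>2) = (t\<^sup>2 + a * b) / (2 * t)"
        using t abp by (simp only: real_sqrt_divide real_sqrt_abs) simp
      ultimately show ?thesis
        unfolding 1 2 by (simp only: real_sqrt_mult)
    qed
    then have "u (g t) = 1 / ((s / (2 * t)) * ((t\<^sup>2 + a * b) / (2 * t)))"
      by (simp add: u_def agm_integrand_def)
    moreover have "\<bar>g' t\<bar> = (t\<^sup>2 + a * b) / (2 * t\<^sup>2)"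
      unfolding g'_def using t abp by (simp add: field_simps)
    moreover have "t\<^sup>2 + a * b > 0" using abp by (intro add_nonneg_pos) auto
    moreover have "w / (2 * t\<^sup>2) * (1 / ((s / (2 * t)) * (w / (2 * t)))) = 2 * (1 / s)" if "w > 0" for w
      using that s t by (simp add: field_simps power2_eq_square)
    ultimately have "\<bar>g' t\<bar> * u (g t) = 2 * (1 / s)"
      by (simp only:)
    then show ?thesis
      by (simp add: agm_integrand_def s_def)
  qed
  have inj: "inj_on g {0<..}"
  proof (rule inj_onI)
    fix s t assume st: "s \<in> {0<..}" "t \<in> {0<..}" and "g s = g t"
    then have "(s - t) * (s * t + a * b) = 0"
      by (simp add: g_def field_simps)
    moreover have "s * t + a * b > 0" using st ab by (intro add_pos_pos mult_pos_pos) auto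
    ultimately show "s = t" by simp
  qed
  have img: "g ` {0<..} = UNIV"
  proof (rule equalityI[OF subset_UNIV], rule subsetI)
    fix y :: real
    \<comment> \<open>The positive root of t^2 - 2 y t - a b = 0, which is the equation
      \<open>g t = y\<close>.\<close>
    define t where "t = y + sqrt (y\<^sup>2 + a * b)"
    have "\<bar>y\<bar> < sqrt (y\<^sup>2 + a * b)"
      using abp by (metis less_add_same_cancel1 real_sqrt_abs real_sqrt_less_iff)
    then have t: "t > 0" by (simp add: t_def)
    have "t * (sqrt (y\<^sup>2 + a * b) - y) = (sqrt (y\<^sup>2 + a * b))\<^sup>2 - y\<^sup>2"
      unfolding t_def by (simp add: power2_eq_square algebra_simps)
    also have "\<dots> = a * b" using abp by simp
    finally have "a * b / t = sqrt (y\<^sup>2 + a * b) - y" using t by (simp add: field_simps)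
    then have "g t = y" by (simp add: g_def t_def)
    then show "y \<in> g ` {0<..}" using t by blast
  qed
  have "((\<lambda>t. 2 * agm_integrand a b t) has_integral (2 * agm_integral a b)) {0<..}"
    by (intro has_integral_mult_right has_integral_agm ab)
  then have "((\<lambda>t. \<bar>g' t\<bar> * u (g t)) has_integral (2 * agm_integral a b)) {0<..}"
    by (rule has_integral_eq[rotated]) (simp add: u)
  moreover have "(g has_field_derivative g' t) (at t)" if "t \<in> {0<..}" for t
    using that unfolding g_def g'_def
    by (auto intro!: derivative_eq_intros simp: field_simps power2_eq_square)
  ultimately have UN: "(u has_integral (2 * agm_integral a b)) UNIV"
    using has_integral_change_of_variables_nonneg[of "{0<..}" g g' u "2 * agm_integral a b", OF _ _ inj] img
    by (simp add: u_def agm_integrand_nonneg)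
  have pos: "(u has_integral J) {0<..}"
    unfolding u_def J_def using ab by (intro has_integral_agm) auto
  \<comment> \<open>Evenness of \<open>u\<close> carries the integral over to the negative
    half-line; the remaining point 0 is negligible.\<close>
  have "((\<lambda>t. \<bar>- 1\<bar> * u (- t)) has_integral J) {0<..} \<longleftrightarrow> (u has_integral J) (uminus ` {0<..})"
    by (intro has_integral_change_of_variables_nonneg)
      (auto intro!: derivative_eq_intros simp: inj_on_def u_def agm_integrand_nonneg)
  moreover have "(\<lambda>t. \<bar>- 1\<bar> * u (- t)) = u"
    by (simp add: u_def agm_integrand_def fun_eq_iff)
  ultimately have neg: "(u has_integral J) {..<0}"
    using pos by simp
  have "(u has_integral (J + J)) ({..<0} \<union> {0<..})"
  proof (rule has_integral_Un[OF neg pos])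
    have "{..<0::real} \<inter> {0<..} = {}" by auto
    then show "negligible ({..<0::real} \<inter> {0<..})" by simp
  qed
  then have "(u has_integral (J + J)) UNIV"
  proof (rule has_integral_spike_set_eq[THEN iffD1, rotated 2])
    show "negligible {x \<in> ({..<0} \<union> {0<..}) - UNIV. u x \<noteq> 0}" by simp
    show "negligible {x \<in> UNIV - ({..<0} \<union> {0<..}). u x \<noteq> 0}"
      by (rule negligible_subset[OF negligible_sing[of 0]]) auto
  qed
  with UN have "J + J = 2 * agm_integral a b"
    by (rule has_integral_unique[symmetric])
  then show ?thesis by (simp add: J_def)
qed

lemma agm_integral_scale:
  assumes c: "0 < c" and ab: "0 < a" "0 < b"
  shows "agm_integral (c * a) (c * b) = agm_integral a b / c"
proof -
  have "((\<lambda>t. \<bar>c\<bar> * agm_integrand (c * a) (c * b) (c * t)) has_integral (agm_integral a b / c)) {0<..} \<longleftrightarrow>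
      (agm_integrand (c * a) (c * b) has_integral (agm_integral a b / c)) ((\<lambda>t. c * t) ` {0<..})"
    using c by (intro has_integral_change_of_variables_nonneg)
      (auto intro!: derivative_eq_intros simp: inj_on_def agm_integrand_nonneg)
  moreover have "(\<lambda>t. c * t) ` {0<..} = {0<..}"
    using c by (auto intro!: image_eqI[where x = "_ / c"])
  moreover have "\<bar>c\<bar> * agm_integrand (c * a) (c * b) (c * t) = agm_integrand a b t / c" for t
  proof -
    have "((c * t)\<^sup>2 + (c * a)\<^sup>2) * ((c * t)\<^sup>2 + (c * b)\<^sup>2) = (c\<^sup>2)\<^sup>2 * ((t\<^sup>2 + a\<^sup>2) * (t\<^sup>2 + b\<^sup>2))"
      by (simp add: power2_eq_square algebra_simps)
    then have "sqrt (((c * t)\<^sup>2 + (c * a)\<^sup>2) * ((c * t)\<^sup>2 + (c * b)\<^sup>2)) = c\<^sup>2 * sqrt ((t\<^sup>2 + a\<^sup>2) * (t\<^sup>2 + b\<^sup>2))"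
      by (simp only: real_sqrt_mult real_sqrt_abs) simp
    then show ?thesis
      using c by (simp add: agm_integrand_def power2_eq_square)
  qed
  moreover have "((\<lambda>t. agm_integrand a b t / c) has_integral (agm_integral a b / c)) {0<..}"
    by (intro has_integral_divide has_integral_agm ab)
  ultimately have "(agm_integrand (c * a) (c * b) has_integral (agm_integral a b / c)) {0<..}"
    by simp
  then show ?thesis
    unfolding agm_integral_def by (rule integral_unique)
qed

lemma agm_integral_lemniscate: "agm_integral (sqrt 2) 1 = Beta (1 / 4) (1 / 2) / 4"
proof -
  \<comment> \<open>Substitute \<open>s = (t\<^sup>2 + 1)\<^sup>-\<^sup>2\<close> in the Beta integral.\<close>
  define g where "g = (\<lambda>t::real. inverse ((t\<^sup>2 + 1)\<^sup>2))"
  define g' where "g' = (\<lambda>t::real. - (4 * t * inverse ((t\<^sup>2 + 1) ^ 3)))"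
  define h where "h = (\<lambda>s::real. s powr (1 / 4 - 1) * (1 - s) powr (1 / 2 - 1))"
  have inj: "inj_on g {0<..}"
  proof (rule inj_onI)
    fix s t :: real assume st: "s \<in> {0<..}" "t \<in> {0<..}" and "g s = g t"
    then have "(s\<^sup>2 + 1)\<^sup>2 = (t\<^sup>2 + 1)\<^sup>2" by (simp add: g_def)
    then have "s\<^sup>2 + 1 = t\<^sup>2 + 1" by (subst (asm) power2_eq_iff_nonneg) auto
    then show "s = t" using st by (simp add: power2_eq_iff_nonneg)
  qed
  have p: "t\<^sup>2 + 1 > 0" for t :: real by (intro add_nonneg_pos) auto
  have der: "(g has_field_derivative g' t) (at t)" for t
  proof -
    have gen: "- (inverse (w\<^sup>2) * (of_nat 2 * (2 * t * w ^ (2 - Suc 0))) * inverse (w\<^sup>2)) = - (4 * t * inverse (w ^ 3))"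
      if "w > 0" for w :: real
      using that by (simp add: field_simps eval_nat_numeral)
    have d: "((\<lambda>t. t\<^sup>2 + 1) has_field_derivative 2 * t) (at t)"
      by (auto intro!: derivative_eq_intros)
    have "(t\<^sup>2 + 1)\<^sup>2 \<noteq> 0" using p[of t] by simp
    from DERIV_cong[OF DERIV_inverse'[OF DERIV_power[OF d, of 2] this] gen[OF p]]
    show ?thesis unfolding g_def g'_def .
  qed
  have img: "g ` {0<..} = {0<..<1}"
  proof (intro equalityI subsetI)
    fix s assume "s \<in> g ` {0<..}"
    then obtain t where t: "t > 0" "s = g t" by auto
    have "1 < (t\<^sup>2 + 1)\<^sup>2" using t by (intro one_less_power) auto
    then show "s \<in> {0<..<1}" unfolding t g_def using p[of t] by (auto simp: inverse_eq_divide divide_less_eq)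
  next
    fix s :: real assume s: "s \<in> {0<..<1}"
    define t where "t = sqrt (1 / sqrt s - 1)"
    have "sqrt s < 1" "sqrt s > 0" using s by auto
    then have "1 / sqrt s - 1 > 0" by simp
    then have t: "t > 0" "t\<^sup>2 + 1 = 1 / sqrt s" by (simp_all add: t_def)
    have "g t = s" unfolding g_def t using s by (simp add: power_divide)
    then show "s \<in> g ` {0<..}" using t by blast
  qed
  have h: "\<bar>g' t\<bar> * h (g t) = 4 * agm_integrand (sqrt 2) 1 t" if "t \<in> {0<..}" for t
  proof -
    have t: "t > 0" using that by simp
    define w where "w = t\<^sup>2 + 1"
    have w: "w > 1" using t by (simp add: w_def)
    have gw: "g t = inverse (w\<^sup>2)" by (simp add: g_def w_def)
    then have g: "g t = w powr (- 2)"
      using w by (simp add: powr_minus)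
    have "g t powr (1 / 4 - 1) = w powr (3 / 2)"
      unfolding g powr_powr by simp
    moreover have "(1 - g t) powr (1 / 2 - 1) = w / (t * sqrt (t\<^sup>2 + 2))"
    proof -
      have "1 - g t = (w\<^sup>2 - 1) / w\<^sup>2" using w by (simp add: gw field_simps)
      \<comment> \<open>The factor t^2 + 2 is where the parameter \<open>sqrt 2\<close> enters;
        \<open>w\<close> supplies the parameter 1.\<close>
      also have "w\<^sup>2 - 1 = t\<^sup>2 * (t\<^sup>2 + 2)" by (simp add: w_def power2_eq_square algebra_simps)
      finally have "sqrt (1 - g t) = t * sqrt (t\<^sup>2 + 2) / w"
        using t w by (simp add: real_sqrt_mult real_sqrt_divide)
      moreover have "(1 - g t) powr (1 / 2 - 1) = 1 / sqrt (1 - g t)"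
      proof -
        have "g t < 1" using img t by auto
        then show ?thesis by (simp add: powr_minus powr_half_sqrt inverse_eq_divide)
      qed
      ultimately show ?thesis by simp
    qed
    moreover have "\<bar>g' t\<bar> = 4 * t / w ^ 3"
      using t w by (simp add: g'_def w_def[symmetric] abs_mult inverse_eq_divide)
    moreover have "w powr (3 / 2) * (w / w ^ 3) = 1 / sqrt w"
    proof -
      have "w powr (3 / 2) = w powr 1 * w powr (1 / 2)" unfolding powr_add[symmetric] by simp
      then have "w powr (3 / 2) = w * sqrt w" using w by (simp add: powr_half_sqrt)
      moreover have "sqrt w * sqrt w = w" using w by simp
      ultimately show ?thesis using w by (simp add: field_simps eval_nat_numeral)
    qed
    moreover have "4 * t / w ^ 3 * (w powr (3 / 2) * (w / (t * sqrt (t\<^sup>2 + 2)))) =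
        4 * (w powr (3 / 2) * (w / w ^ 3)) * (1 / sqrt (t\<^sup>2 + 2))"
      using t by simp
    ultimately have "\<bar>g' t\<bar> * h (g t) = 4 * (1 / sqrt w) * (1 / sqrt (t\<^sup>2 + 2))"
      unfolding h_def by (simp only:)
    also have "\<dots> = 4 * agm_integrand (sqrt 2) 1 t"
      by (simp add: agm_integrand_def w_def real_sqrt_mult)
    finally show ?thesis .
  qed
  have "(h has_integral Beta (1 / 4) (1 / 2)) {0<..<1}"
    using has_integral_Beta_real[of "1 / 4" "1 / 2"] by (simp add: has_integral_Icc_iff_Ioo h_def)
  then have "((\<lambda>t. \<bar>g' t\<bar> * h (g t)) has_integral Beta (1 / 4) (1 / 2)) {0<..}"
    using has_integral_change_of_variables_nonneg[of "{0<..}" g g' h "Beta (1 / 4) (1 / 2)", OF _ der inj]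
    by (simp add: img h_def)
  then have "((\<lambda>t. 4 * agm_integrand (sqrt 2) 1 t) has_integral Beta (1 / 4) (1 / 2)) {0<..}"
    by (rule has_integral_eq[rotated]) (simp add: h)
  moreover have "((\<lambda>t. 4 * agm_integrand (sqrt 2) 1 t) has_integral (4 * agm_integral (sqrt 2) 1)) {0<..}"
    by (intro has_integral_mult_right has_integral_agm) auto
  ultimately have "Beta (1 / 4) (1 / 2) = 4 * agm_integral (sqrt 2) 1"
    by (rule has_integral_unique)
  then show ?thesis by simp
qed

text \<open>The Beta value is Gamma(1/4) sqrt pi / Gamma(3/4), and the reflection formula at 1/4
  trades Gamma(1/4) for sqrt 2 pi / Gamma(3/4).\<close>

lemma Beta_quarter_half: "Beta (1 / 4) (1 / 2 :: real) = sqrt 2 * pi * sqrt pi / (Gamma (3 / 4))\<^sup>2"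
proof -
  have "Gamma (of_real (1 / 4)) * Gamma (1 - of_real (1 / 4) :: complex) = of_real pi / sin (of_real pi * of_real (1 / 4))"
    by (rule Gamma_reflection_complex)
  also have "1 - of_real (1 / 4) = (of_real (3 / 4) :: complex)" by simp
  also have "of_real pi / sin (of_real pi * of_real (1 / 4) :: complex) = of_real (pi / sin (pi * (1 / 4)))"
    by (simp only: of_real_mult[symmetric] sin_of_real of_real_divide[symmetric])
  finally have "complex_of_real (Gamma (1 / 4) * Gamma (3 / 4)) = of_real (pi / sin (pi * (1 / 4)))"
    unfolding Gamma_complex_of_real of_real_mult .
  then have "Gamma (1 / 4) * Gamma (3 / 4) = pi / sin (pi * (1 / 4))"
    by (simp only: of_real_eq_iff)
  also have "\<dots> = sqrt 2 * pi"
    by (simp add: sin_45 field_simps)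
  finally have e: "Gamma (1 / 4) * Gamma (3 / 4) = sqrt 2 * pi" .
  have nz: "Gamma (3 / 4 :: real) \<noteq> 0"
    using Gamma_real_pos[of "3 / 4"] by linarith
  have "Gamma (1 / 4) = sqrt 2 * pi / Gamma (3 / 4)"
    using nonzero_eq_divide_eq[OF nz] e by blast
  then show ?thesis
    by (simp add: Beta_def Gamma_one_half_real power2_eq_square)
qed

text \<open>The arithmetic mean of the two squares is theta3(x^2)^2 and their geometric mean
  theta4(x^2)^2, so passing from x to x^2 leaves the integral unchanged. Both squares tend to 1,
  which squeezes it to pi / 2.\<close>

lemma agm_integral_theta:
  assumes x: "0 < x" "x < 1"
  shows "agm_integral ((theta3 x)\<^sup>2) ((theta4 x)\<^sup>2) = pi / 2"
proof -
  have xn: "0 < x ^ 2 ^ n" "x ^ 2 ^ n < 1" for n by (rule powers_less_1[OF x]; simp)+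
  have step: "agm_integral ((theta3 (y\<^sup>2))\<^sup>2) ((theta4 (y\<^sup>2))\<^sup>2) = agm_integral ((theta3 y)\<^sup>2) ((theta4 y)\<^sup>2)"
    if y: "0 < y" "y < 1" for y
  proof -
    note pos = theta3_pos[OF y] theta4_pos[OF y]
    have "((theta3 y)\<^sup>2 + (theta4 y)\<^sup>2) / 2 = (theta3 (y\<^sup>2))\<^sup>2"
      using theta_square_add[OF y] by simp
    moreover have "sqrt ((theta3 y)\<^sup>2 * (theta4 y)\<^sup>2) = (theta4 (y\<^sup>2))\<^sup>2"
      unfolding theta3_mult_theta4[OF y, symmetric] power_mult_distrib[symmetric]
      using pos by simp
    ultimately show ?thesis
      using agm_integral_mean[of "(theta3 y)\<^sup>2" "(theta4 y)\<^sup>2"] pos by simp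
  qed
  have iter: "agm_integral ((theta3 (x ^ 2 ^ n))\<^sup>2) ((theta4 (x ^ 2 ^ n))\<^sup>2) = agm_integral ((theta3 x)\<^sup>2) ((theta4 x)\<^sup>2)" for n
  proof (induction n)
    case (Suc n)
    then show ?case
      using step[OF xn, of n] by (simp add: mult.commute flip: power_mult)
  qed simp
  have le: "theta4 y \<le> theta3 y" if y: "0 < y" "y < 1" for y
  proof -
    have "psi (y ^ 4) \<ge> 0"
      unfolding psi_prod[OF unit_interval_power4[OF y]] using qprod_inf_pos[OF unit_interval_power2[OF unit_interval_power4[OF y]]] by simp
    then have "0 \<le> theta3 y - theta4 y"
      unfolding theta_diff[OF y] using y by (intro mult_nonneg_nonneg) auto
    then show ?thesis by simp
  qed
  have bnd: "pi / (2 * (theta3 (x ^ 2 ^ n))\<^sup>2) \<le> agm_integral ((theta3 x)\<^sup>2) ((theta4 x)\<^sup>2)"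
    "agm_integral ((theta3 x)\<^sup>2) ((theta4 x)\<^sup>2) \<le> pi / (2 * (theta4 (x ^ 2 ^ n))\<^sup>2)" for n
  proof -
    have "0 < (theta4 (x ^ 2 ^ n))\<^sup>2" "(theta4 (x ^ 2 ^ n))\<^sup>2 \<le> (theta3 (x ^ 2 ^ n))\<^sup>2"
      using theta4_pos[OF xn[of n]] le[OF xn[of n]] by (auto intro: power_mono)
    from agm_integral_bounds[OF this]
    show "pi / (2 * (theta3 (x ^ 2 ^ n))\<^sup>2) \<le> agm_integral ((theta3 x)\<^sup>2) ((theta4 x)\<^sup>2)"
      "agm_integral ((theta3 x)\<^sup>2) ((theta4 x)\<^sup>2) \<le> pi / (2 * (theta4 (x ^ 2 ^ n))\<^sup>2)"
      unfolding iter by simp_all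
  qed
  have "(\<lambda>n. pi / (2 * (theta3 (x ^ 2 ^ n))\<^sup>2)) \<longlonglongrightarrow> pi / (2 * 1\<^sup>2)"
    "(\<lambda>n. pi / (2 * (theta4 (x ^ 2 ^ n))\<^sup>2)) \<longlonglongrightarrow> pi / (2 * 1\<^sup>2)"
    by (intro tendsto_intros theta_iterate_tendsto x; simp)+
  then show ?thesis
    using LIMSEQ_le_const2[of _ "pi / 2"] LIMSEQ_le_const[of _ "pi / 2"] bnd
    by (intro antisym) fastforce+
qed

section \<open>The double series\<close>

text \<open>This is pi/(2y) coth(pi y) - 1/(2 y^2). At \<open>y = c * real m\<close> the exponential
  is the m-th power of a fixed nome, which is how Lambert series arise.\<close>

definition coth_sum :: "real \<Rightarrow> real" where
  "coth_sum y = pi / (2 * y) * ((1 + exp (- (2 * pi * y))) / (1 - exp (- (2 * pi * y)))) - 1 / (2 * y\<^sup>2)"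

text \<open>Differentiate both sides of Gamma(z) Gamma(1-z) = pi / sin(pi z) and cancel the common
  nonzero factor.\<close>

lemma Digamma_reflection:
  fixes z :: complex
  assumes z: "z \<notin> \<int>"
  shows "Digamma (1 - z) - Digamma z = of_real pi * cot (of_real pi * z)"
proof -
  have z': "z \<notin> \<int>\<^sub>\<le>\<^sub>0" "1 - z \<notin> \<int>\<^sub>\<le>\<^sub>0" "z \<noteq> 0"
    using z by (auto elim!: nonpos_Ints_cases) (metis Ints_1 Ints_diff Ints_of_int diff_diff_eq2 add_diff_cancel_left')
  have s: "sin (of_real pi * z) \<noteq> 0"
    using z by (auto simp: sin_eq_0 mult.commute)
  have "((\<lambda>z. Gamma z * Gamma (1 - z)) has_field_derivative
      Gamma z * Gamma (1 - z) * (Digamma z - Digamma (1 - z))) (at z)"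
    using z' by (auto intro!: derivative_eq_intros simp: algebra_simps)
  moreover have "((\<lambda>z. Gamma z * Gamma (1 - z)) has_field_derivative
      - (of_real pi * of_real pi * cos (of_real pi * z) / (sin (of_real pi * z))\<^sup>2)) (at z)"
    unfolding Gamma_reflection_complex using s
    by (auto intro!: derivative_eq_intros simp: power2_eq_square)
  ultimately have "Gamma z * Gamma (1 - z) * (Digamma z - Digamma (1 - z)) =
      - (of_real pi * of_real pi * cos (of_real pi * z) / (sin (of_real pi * z))\<^sup>2)"
    by (rule DERIV_unique)
  then have "of_real pi / sin (of_real pi * z) * (Digamma (1 - z) - Digamma z) =
      of_real pi / sin (of_real pi * z) * (of_real pi * cot (of_real pi * z))"
    unfolding Gamma_reflection_complex by (simp add: cot_def power2_eq_square algebra_simps)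
  then show ?thesis
    using s by simp
qed

text \<open>With z = \<i> y, 1 / (n^2 + y^2) is (1/(n - z) - 1/(n + z)) / (2z), a difference of
  terms of two digamma series; the reflection formula turns their sum into a cotangent at an
  imaginary argument.\<close>

lemma sums_inverse_squares_coth:
  assumes y: "y > 0"
  shows "(\<lambda>n. 1 / ((real (Suc n))\<^sup>2 + y\<^sup>2)) sums coth_sum y"
proof -
  define z where "z = \<i> * complex_of_real y"
  have z0: "z \<noteq> 0" "1 + z \<noteq> 0" "1 - z \<noteq> 0"
    using y by (auto simp: z_def complex_eq_iff)
  have zn: "z \<notin> \<int>"
    using y by (auto simp: z_def complex_eq_iff elim!: Ints_cases)
  define D where "D = Digamma (1 + z) - Digamma (1 - z)"
  have sD: "(\<lambda>n. inverse (of_nat (Suc n)) - inverse (w + of_nat n)) sums (Digamma w + euler_mascheroni)"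
    if "w \<noteq> 0" for w :: complex
    using summable_sums[OF summable_Digamma[OF that]] by (simp add: Digamma_def)
  have "(\<lambda>n. inverse (1 - z + of_nat n) - inverse (1 + z + of_nat n)) sums D"
    using sums_diff[OF sD[OF z0(2)] sD[OF z0(3)]] by (simp add: D_def)
  then have "(\<lambda>n. (inverse (1 - z + of_nat n) - inverse (1 + z + of_nat n)) / (2 * z)) sums (D / (2 * z))"
    by (rule sums_divide)
  moreover have "(inverse (1 - z + of_nat n) - inverse (1 + z + of_nat n)) / (2 * z) =
      of_real (1 / ((real (Suc n))\<^sup>2 + y\<^sup>2))" for n
  proof -
    have 1: "1 - z + of_nat n = of_nat (Suc n) - z" "1 + z + of_nat n = of_nat (Suc n) + z" by auto
    have nz: "of_nat (Suc n) - z \<noteq> 0" "of_nat (Suc n) + z \<noteq> 0"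
      using y by (auto simp: z_def complex_eq_iff)
    have "inverse (of_nat (Suc n) - z) - inverse (of_nat (Suc n) + z) =
       (2 * z) / ((of_nat (Suc n) - z) * (of_nat (Suc n) + z))"
      using nz by (simp add: inverse_eq_divide diff_frac_eq)
    also have "(of_nat (Suc n) - z) * (of_nat (Suc n) + z) = of_real ((real (Suc n))\<^sup>2 + y\<^sup>2)"
      by (simp add: z_def power2_eq_square algebra_simps)
    finally show ?thesis
      unfolding 1 using z0 by simp
  qed
  moreover have "D / (2 * z) = of_real (coth_sum y)"
  proof -
    have "D = Digamma z + 1 / z - Digamma (1 - z)"
      using Digamma_plus1[OF z0(1)] by (simp add: D_def add.commute)
    also have "\<dots> = 1 / z - of_real pi * cot (of_real pi * z)"
      using Digamma_reflection[OF zn] by (simp add: algebra_simps)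
    finally have D: "D = 1 / z - of_real pi * cot (of_real pi * z)" .
    define E where "E = exp (pi * y)"
    have E: "E > 1" using y by (simp add: E_def)
    have e: "exp (- (2 * pi * y)) = 1 / (E * E)"
      unfolding E_def exp_add[symmetric] by (simp add: exp_minus inverse_eq_divide algebra_simps)
    have "\<i> * (of_real pi * z) = of_real (- (pi * y))"
      by (simp add: z_def algebra_simps)
    then have x: "exp (\<i> * (of_real pi * z)) = of_real (1 / E)" "exp (- (\<i> * (of_real pi * z))) = of_real E"
      by (simp_all only: exp_of_real of_real_minus[symmetric]) (simp_all add: E_def exp_minus inverse_eq_divide)
    have "cot (of_real pi * z) = \<i> * of_real ((1 / E + E) / (1 / E - E))"
    proof -
      have "(p / 2) / (q / (2 * \<i>)) = \<i> * (p / q)" for p q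
        by (cases "q = 0") (simp_all add: field_simps)
      from this[of "of_real (1 / E) + of_real E" "of_real (1 / E) - of_real E"] show ?thesis
        unfolding cot_def cos_exp_eq sin_exp_eq x by (simp only: of_real_divide of_real_add of_real_diff)
    qed
    also have "(1 / E + E) / (1 / E - E) = - ((1 + 1 / (E * E)) / (1 - 1 / (E * E)))"
    proof -
      have "1 - E * E \<noteq> 0" "E * E - 1 \<noteq> 0" "E \<noteq> 0"
        using E less_1_mult[of E E] by auto
      then show ?thesis by (simp add: divide_simps) (simp add: algebra_simps)
    qed
    finally have c: "cot (of_real pi * z) = - \<i> * of_real ((1 + exp (- (2 * pi * y))) / (1 - exp (- (2 * pi * y))))"
      unfolding e by simp
    have "D / (2 * z) = 1 / (2 * z * z) + of_real pi * \<i> / (2 * z) * of_real ((1 + exp (- (2 * pi * y))) / (1 - exp (- (2 * pi * y))))"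
    proof -
      have "(1 / z - p * (- \<i> * X)) / (2 * z) = 1 / (2 * z * z) + p * \<i> / (2 * z) * X" for p X
        using z0(1) by (simp add: add_divide_distrib mult_ac)
      then show ?thesis
        unfolding D c by (simp only:)
    qed
    also have "1 / (2 * z * z) = of_real (- (1 / (2 * y\<^sup>2)))"
    proof -
      have "2 * z * z = of_real (- (2 * y\<^sup>2))"
        by (simp add: z_def power2_eq_square complex_eq_iff)
      then show ?thesis by (simp only:) simp
    qed
    also have "of_real pi * \<i> / (2 * z) = of_real (pi / (2 * y))"
      using y by (simp add: z_def)
    finally show ?thesis
      unfolding coth_sum_def by simp
  qed
  ultimately have "(\<lambda>n. complex_of_real (1 / ((real (Suc n))\<^sup>2 + y\<^sup>2))) sums of_real (coth_sum y)"
    by (simp only:)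
  then show ?thesis
    by (simp only: sums_of_real_iff)
qed

lemma coth_sum_tendsto_0:
  assumes "c > 0"
  shows "(\<lambda>m. coth_sum (c * real m)) \<longlonglongrightarrow> 0"
proof -
  have c: "filterlim (\<lambda>m. c * real m) at_top sequentially"
    using assms by (intro filterlim_tendsto_pos_mult_at_top[OF tendsto_const] filterlim_real_sequentially)
  have "coth_sum = (\<lambda>y. inverse y * (pi / 2 * ((1 + exp (- (2 * pi * y))) / (1 - exp (- (2 * pi * y)))) - inverse y / 2))"
  proof
    have "pi / (2 * y) * X - 1 / (2 * y\<^sup>2) = inverse y * (pi / 2 * X - inverse y / 2)" for X y :: real
      by (simp add: right_diff_distrib power2_eq_square inverse_eq_divide)
    then show "coth_sum y = inverse y * (pi / 2 * ((1 + exp (- (2 * pi * y))) / (1 - exp (- (2 * pi * y)))) - inverse y / 2)" for y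
      unfolding coth_sum_def .
  qed
  moreover have "((\<lambda>y. inverse y * (pi / 2 * ((1 + exp (- (2 * pi * y))) / (1 - exp (- (2 * pi * y)))) - inverse y / 2))
      \<longlongrightarrow> 0 * (pi / 2 * ((1 + 0) / (1 - 0)) - 0 / 2)) at_top"
  proof -
    have i: "(inverse \<longlongrightarrow> (0::real)) at_top" by (rule tendsto_inverse_0_at_top[OF filterlim_ident])
    have "filterlim (\<lambda>y. - (2 * pi * y)) at_bot at_top"
      unfolding filterlim_uminus_at_bot
      by (simp, intro filterlim_tendsto_pos_mult_at_top[OF tendsto_const] filterlim_ident) simp
    then have e: "((\<lambda>y. exp (- (2 * pi * y))) \<longlongrightarrow> 0) at_top"
      by (rule filterlim_compose[OF exp_at_bot])
    show ?thesis
      by (intro tendsto_mult tendsto_diff tendsto_divide tendsto_add tendsto_const i e) auto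
  qed
  ultimately have "(coth_sum \<longlongrightarrow> 0) at_top" by simp
  from filterlim_compose[OF this c] show ?thesis .
qed

section \<open>Lambert series for the logarithm of Euler's product\<close>

text \<open>Both sides are the double sum of x^(n k) / n over n, k >= 1: over n it gives a
  logarithm, over k a geometric series. All terms are nonnegative, which justifies the
  exchange.\<close>

lemma Lambert_log_sums:
  assumes x: "0 < x" "x < 1"
  shows "(\<lambda>n. x ^ Suc n / (real (Suc n) * (1 - x ^ Suc n))) sums (- ln (qprod_inf x))"
proof -
  define w where "w = (\<lambda>(n, k). x ^ (Suc n * Suc k) / real (Suc n))"
  have xs: "0 < x ^ Suc n" "x ^ Suc n < 1" for n
    by (rule powers_less_1[OF x]; simp)+
  have wnn: "w p \<ge> 0" for p
    using x by (auto simp: w_def split: prod.split)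
  have row: "((\<lambda>n. w (n, k)) has_sum (- ln (1 - x ^ Suc k))) UNIV" for k
  proof (rule sums_nonneg_imp_has_sum)
    have "(\<lambda>n. - ((- (- (x ^ Suc k))) ^ n) / of_nat n) sums ln (1 + (- (x ^ Suc k)))"
      using xs[of k] by (intro ln_series') simp
    then have "(\<lambda>n. - ((x ^ Suc k) ^ n / real n)) sums ln (1 - x ^ Suc k)" by simp
    from sums_minus[OF this] have "(\<lambda>n. (x ^ Suc k) ^ n / real n) sums (- ln (1 - x ^ Suc k))"
      by simp
    \<comment> \<open>Dropping index 0 changes nothing: division by zero makes its term 0.\<close>
    then have "(\<lambda>n. (x ^ Suc k) ^ Suc n / real (Suc n)) sums (- ln (1 - x ^ Suc k) - (x ^ Suc k) ^ 0 / real 0)"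
      by (subst sums_Suc_iff) simp
    then show "(\<lambda>n. w (n, k)) sums (- ln (1 - x ^ Suc k))"
      unfolding w_def by (simp add: mult.commute flip: power_mult del: power_Suc)
  qed (rule wnn)
  have col: "((\<lambda>k. w (n, k)) has_sum (x ^ Suc n / (real (Suc n) * (1 - x ^ Suc n)))) UNIV" for n
  proof (rule sums_nonneg_imp_has_sum)
    have "(\<lambda>k. x ^ Suc n / real (Suc n) * (x ^ Suc n) ^ k) sums (x ^ Suc n / real (Suc n) * (1 / (1 - x ^ Suc n)))"
      using xs[of n] by (intro sums_mult geometric_sums) simp
    moreover have "x ^ Suc n / real (Suc n) * (x ^ Suc n) ^ k = w (n, k)" for k
    proof -
      have "x ^ (Suc n * Suc k) = x ^ Suc n * (x ^ Suc n) ^ k"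
        unfolding power_mult by (rule power_Suc)
      then show ?thesis unfolding w_def by (simp del: power_Suc)
    qed
    ultimately show "(\<lambda>k. w (n, k)) sums (x ^ Suc n / (real (Suc n) * (1 - x ^ Suc n)))"
      by (simp only: times_divide_times_eq mult_1_right)
  qed (rule wnn)
  have ln: "(\<lambda>k. - ln (1 - x ^ Suc k)) sums (- ln (qprod_inf x))"
    unfolding qprod_inf_def
    by (intro sums_minus has_prod_imp_sums_ln_real' convergent_prod_has_prod convergent_prod_qprod[OF x])
       (use xs in simp)
  have outer: "((\<lambda>k. - ln (1 - x ^ Suc k)) has_sum (- ln (qprod_inf x))) UNIV"
    using xs by (intro sums_nonneg_imp_has_sum[OF ln]) (simp add: x less_imp_le)
  have row': "((\<lambda>n. (\<lambda>(k, n). w (n, k)) (k, n)) has_sum (- ln (1 - x ^ Suc k))) UNIV" for k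
    using row by simp
  have "(\<lambda>(k, n). w (n, k)) summable_on (UNIV \<times> UNIV)"
    using row' outer wnn by (intro summable_on_SigmaI) (auto simp: summable_on_def)
  then have "((\<lambda>(k, n). w (n, k)) has_sum (- ln (qprod_inf x))) (UNIV \<times> UNIV)"
    using row' outer by (intro has_sum_SigmaI) auto
  then have "(w has_sum (- ln (qprod_inf x))) (UNIV \<times> UNIV)"
    by (subst has_sum_swap)
  then have "((\<lambda>n. x ^ Suc n / (real (Suc n) * (1 - x ^ Suc n))) has_sum (- ln (qprod_inf x))) UNIV"
    using col by (rule has_sum_SigmaD)
  then show ?thesis by (rule has_sum_imp_sums)
qed

section \<open>Conditionally convergent alternating series\<close>

text \<open>Twice the terms of even index minus all terms; the term of index 1 is the negative
  one.\<close>

lemma alternating_sums: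
  fixes u :: "nat \<Rightarrow> real"
  assumes A: "(\<lambda>n. u (Suc n)) sums A" and B: "(\<lambda>n. u (2 * Suc n)) sums B"
  shows "(\<lambda>n. (-1) ^ Suc n * u (Suc n)) sums (2 * B - A)"
proof -
  let ?e = "\<lambda>n. if even (Suc n) then u (Suc n) else 0"
  have "(\<lambda>n. ?e (2 * n + 1)) sums B \<longleftrightarrow> ?e sums B"
  proof (rule sums_mono_reindex)
    fix n :: nat assume "n \<notin> range (\<lambda>n. 2 * n + 1)"
    then have "even n" by (metis oddE rangeI)
    then show "?e n = 0" by simp
  qed (simp add: strict_mono_def)
  moreover have "?e (2 * n + 1) = u (2 * Suc n)" for n by simp
  ultimately have "?e sums B" using B by (simp only:)
  from sums_diff[OF sums_mult[OF this, of 2] A]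
  have "(\<lambda>n. 2 * ?e n - u (Suc n)) sums (2 * B - A)" .
  moreover have "2 * ?e n - u (Suc n) = (-1) ^ Suc n * u (Suc n)" for n by simp
  ultimately show ?thesis by (simp only:)
qed

text \<open>Leibniz's estimate: the sum is its first term minus a sum of the same kind from
  \<open>Suc p\<close> on, which lies between 0 and \<open>u (Suc p)\<close>.\<close>

lemma alternating_antimono_bounds:
  fixes u :: "nat \<Rightarrow> real"
  assumes "\<And>m. 0 \<le> u m" "\<And>m. m \<ge> p \<Longrightarrow> u (Suc m) \<le> u m"
  shows "0 \<le> (\<Sum>i<d. (-1) ^ i * u (p + i)) \<and> (\<Sum>i<d. (-1) ^ i * u (p + i)) \<le> u p"
  using assms(2)
proof (induction d arbitrary: p)
  case 0
  then show ?case using assms(1) by simp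
next
  case (Suc d)
  have "(\<Sum>i<Suc d. (-1) ^ i * u (p + i)) = u p - (\<Sum>i<d. (-1) ^ i * u (Suc p + i))"
    by (subst sum.lessThan_Suc_shift) (simp add: sum_negf)
  moreover have "0 \<le> (\<Sum>i<d. (-1) ^ i * u (Suc p + i)) \<and> (\<Sum>i<d. (-1) ^ i * u (Suc p + i)) \<le> u (Suc p)"
    using Suc.prems by (intro Suc.IH) auto
  ultimately show ?case using Suc.prems[of p] by force
qed

lemma alternating_antimono_tail:
  fixes u :: "nat \<Rightarrow> real" and K M :: nat
  assumes "\<And>m. 0 \<le> u m" "\<And>m. m \<ge> 1 \<Longrightarrow> u (Suc m) \<le> u m" and "K \<le> M"
  shows "\<bar>(\<Sum>m=1..M. (-1) ^ m * u m) - (\<Sum>m=1..K. (-1) ^ m * u m)\<bar> \<le> u (Suc K)"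
proof -
  obtain d where d: "M = K + d" using \<open>K \<le> M\<close> le_Suc_ex by blast
  have "(\<Sum>m=1..M. (-1) ^ m * u m) = (\<Sum>m=1..K. (-1) ^ m * u m) + (\<Sum>i<d. (-1) ^ (Suc K + i) * u (Suc K + i))"
    unfolding d One_nat_def sum.atLeast1_atMost_eq sum_lessThan_add by simp
  also have "(\<Sum>i<d. (-1) ^ (Suc K + i) * u (Suc K + i)) = (-1) ^ Suc K * (\<Sum>i<d. (-1) ^ i * u (Suc K + i))"
    by (simp add: sum_distrib_left power_add mult_ac)
  finally have "\<bar>(\<Sum>m=1..M. (-1) ^ m * u m) - (\<Sum>m=1..K. (-1) ^ m * u m)\<bar> = \<bar>\<Sum>i<d. (-1) ^ i * u (Suc K + i)\<bar>"
    by (simp add: abs_mult power_abs)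
  then show ?thesis
    using alternating_antimono_bounds[of u "Suc K" d] assms by auto
qed

text \<open>The tail in \<open>m\<close> beyond \<open>K\<close> is at most \<open>G (Suc K)\<close>
  for every \<open>N\<close> at once, so the sum by rows, the limit over rectangles and the sum by
  columns agree.\<close>

lemma alternating_double_series:
  fixes g :: "nat \<Rightarrow> nat \<Rightarrow> real"
  assumes nonneg: "\<And>m n. 0 \<le> g m n"
    and mono: "\<And>m n. m \<ge> 1 \<Longrightarrow> g (Suc m) n \<le> g m n"
    and rows: "\<And>m. m \<ge> 1 \<Longrightarrow> (\<lambda>n. g m (Suc n)) sums G m"
    and G0: "G \<longlonglongrightarrow> 0"
    and G: "(\<lambda>m. (-1) ^ Suc m * G (Suc m)) sums l"
  shows "((\<lambda>(M, N). \<Sum>m=1..M. \<Sum>n=1..N. (-1) ^ m * g m n) \<longlongrightarrow> l) (sequentially \<times>\<^sub>F sequentially)"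
    and "(\<And>n. n \<ge> 1 \<Longrightarrow> (\<lambda>m. (-1) ^ Suc m * g (Suc m) n) sums C n) \<Longrightarrow> (\<lambda>n. C (Suc n)) sums l"
proof -
  define S where "S = (\<lambda>M N. \<Sum>m=1..M. \<Sum>n=1..N. (-1) ^ m * g m n)"
  have S_alt: "S M N = (\<Sum>m=1..M. (-1) ^ m * (\<Sum>n=1..N. g m n))" for M N
    by (simp add: S_def sum_distrib_left)
  have le_G: "(\<Sum>n=1..N. g m n) \<le> G m" if "m \<ge> 1" for m N
    unfolding One_nat_def sum.atLeast1_atMost_eq using nonneg
    by (intro sum_le_suminf[OF sums_summable[OF rows[OF that]], THEN order_trans])
       (auto simp: sums_unique[OF rows[OF that], symmetric])
  have tail: "\<bar>S M N - S K N\<bar> \<le> G (Suc K)" if "K \<le> M" for K M N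
    unfolding S_alt
    by (rule order_trans[OF alternating_antimono_tail[OF _ _ that] le_G])
       (auto intro!: sum_nonneg sum_mono nonneg mono)
  define R where "R = (\<lambda>M. \<Sum>m=1..M. (-1) ^ m * G m)"
  have SR: "(\<lambda>N. S M N) \<longlonglongrightarrow> R M" for M
  proof -
    have "(\<lambda>N. \<Sum>n=1..N. g m n) \<longlonglongrightarrow> G m" if "m \<ge> 1" for m
      using rows[OF that] unfolding sums_def One_nat_def sum.atLeast1_atMost_eq .
    then show ?thesis
      unfolding S_alt R_def by (intro tendsto_intros) auto
  qed
  have Rl: "R \<longlonglongrightarrow> l"
    using G unfolding sums_def R_def One_nat_def sum.atLeast1_atMost_eq .
  \<comment> \<open>\<open>K\<close> is chosen before \<open>N\<close> and serves all
    \<open>M \<ge> K\<close>. This order of quantifiers permits both limits below: over the two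
    bounds jointly, and over \<open>M\<close> first.\<close>
  have main: "\<exists>K. \<forall>\<^sub>F N in sequentially. \<forall>M\<ge>K. \<bar>S M N - l\<bar> < \<epsilon>" if "\<epsilon> > 0" for \<epsilon>
  proof -
    have "(\<lambda>K. G (Suc K)) \<longlonglongrightarrow> 0" using G0 by (rule LIMSEQ_Suc)
    then have "\<forall>\<^sub>F K in sequentially. G (Suc K) < \<epsilon> / 3"
      using that by (intro order_tendstoD(2)) auto
    moreover have "\<forall>\<^sub>F K in sequentially. dist (R K) l < \<epsilon> / 3"
      using that by (intro tendstoD[OF Rl]) auto
    ultimately have "\<forall>\<^sub>F K in sequentially. G (Suc K) < \<epsilon> / 3 \<and> dist (R K) l < \<epsilon> / 3"
      by eventually_elim auto
    then obtain K where K: "G (Suc K) < \<epsilon> / 3" "dist (R K) l < \<epsilon> / 3"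
      by (auto simp: eventually_sequentially)
    have "\<forall>\<^sub>F N in sequentially. dist (S K N) (R K) < \<epsilon> / 3"
      using that by (intro tendstoD[OF SR]) auto
    then have "\<forall>\<^sub>F N in sequentially. \<forall>M\<ge>K. \<bar>S M N - l\<bar> < \<epsilon>"
    proof eventually_elim
      case (elim N)
      show ?case
      proof (intro allI impI)
        fix M assume "K \<le> M"
        from tail[OF this, of N] K elim show "\<bar>S M N - l\<bar> < \<epsilon>"
          unfolding dist_real_def by argo
      qed
    qed
    then show ?thesis by blast
  qed
  show "((\<lambda>(M, N). \<Sum>m=1..M. \<Sum>n=1..N. (-1) ^ m * g m n) \<longlongrightarrow> l) (sequentially \<times>\<^sub>F sequentially)"
  proof (rule tendstoI)
    fix \<epsilon> :: real assume "\<epsilon> > 0"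
    from main[OF this] obtain K N0 where *: "\<And>M N. M \<ge> K \<Longrightarrow> N \<ge> N0 \<Longrightarrow> \<bar>S M N - l\<bar> < \<epsilon>"
      unfolding eventually_sequentially by blast
    show "\<forall>\<^sub>F p in sequentially \<times>\<^sub>F sequentially. dist (case p of (K, N) \<Rightarrow> \<Sum>m=1..K. \<Sum>n=1..N. (-1) ^ m * g m n) l < \<epsilon>"
      unfolding eventually_prod_sequentially
      by (rule exI[of _ "max K N0"]) (use * in \<open>auto simp: S_def dist_real_def\<close>)
  qed
  assume C: "\<And>n. n \<ge> 1 \<Longrightarrow> (\<lambda>m. (-1) ^ Suc m * g (Suc m) n) sums C n"
  have SC: "(\<lambda>M. S M N) \<longlonglongrightarrow> (\<Sum>n=1..N. C n)" for N
  proof -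
    have "(\<lambda>M. \<Sum>m=1..M. (-1) ^ m * g m n) \<longlonglongrightarrow> C n" if "n \<ge> 1" for n
      using C[OF that] unfolding sums_def One_nat_def sum.atLeast1_atMost_eq .
    then have "(\<lambda>M. \<Sum>n=1..N. \<Sum>m=1..M. (-1) ^ m * g m n) \<longlonglongrightarrow> (\<Sum>n=1..N. C n)"
      by (intro tendsto_sum) auto
    then show ?thesis
      unfolding S_def by (subst (asm) sum.swap)
  qed
  have "(\<lambda>N. \<Sum>n=1..N. C n) \<longlonglongrightarrow> l"
  proof (rule tendstoI)
    fix \<epsilon> :: real assume "\<epsilon> > 0"
    then have "\<epsilon> / 2 > 0" by simp
    from main[OF this] obtain K where "\<forall>\<^sub>F N in sequentially. \<forall>M\<ge>K. \<bar>S M N - l\<bar> < \<epsilon> / 2"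
      by blast
    then show "\<forall>\<^sub>F N in sequentially. dist (\<Sum>n=1..N. C n) l < \<epsilon>"
    proof eventually_elim
      case (elim N)
      have "(\<lambda>M. \<bar>S M N - l\<bar>) \<longlonglongrightarrow> \<bar>(\<Sum>n=1..N. C n) - l\<bar>"
        by (intro tendsto_intros SC)
      moreover have "\<forall>\<^sub>F M in sequentially. \<bar>S M N - l\<bar> \<le> \<epsilon> / 2"
        using eventually_ge_at_top[of K] by eventually_elim (use elim in \<open>auto intro: less_imp_le\<close>)
      ultimately have "\<bar>(\<Sum>n=1..N. C n) - l\<bar> \<le> \<epsilon> / 2"
        by (intro tendsto_upperbound) auto
      then show ?case using \<open>\<epsilon> > 0\<close> by (simp add: dist_real_def)
    qed
  qed
  then show "(\<lambda>n. C (Suc n)) sums l"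
    unfolding sums_def One_nat_def sum.atLeast1_atMost_eq .
qed

text \<open>The two products are those of \<open>\<eta>(c \<i>)\<close> and \<open>\<eta>(2 c \<i>)\<close>.\<close>

definition L_closed :: "real \<Rightarrow> real" where
  "L_closed c = - (pi * ln 2 / (2 * c))
     + pi / c * (ln (qprod_inf (exp (- (2 * pi * c)))) - ln (qprod_inf (exp (- (4 * pi * c)))))
     + pi\<^sup>2 / (24 * c\<^sup>2)"

text \<open>The terms of even index are half the terms of the Lambert series in
  \<open>x\<^sup>2\<close>.\<close>

lemma Lambert_alternating_sums:
  assumes x: "0 < x" "x < 1"
  shows "(\<lambda>n. (-1) ^ Suc n * (x ^ Suc n / (real (Suc n) * (1 - x ^ Suc n)))) sums
     (ln (qprod_inf x) - ln (qprod_inf (x\<^sup>2)))"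
proof -
  let ?u = "\<lambda>n. x ^ n / (real n * (1 - x ^ n))"
  have "(\<lambda>n. 1 / 2 * ((x\<^sup>2) ^ Suc n / (real (Suc n) * (1 - (x\<^sup>2) ^ Suc n)))) sums (1 / 2 * (- ln (qprod_inf (x\<^sup>2))))"
    by (intro sums_mult Lambert_log_sums unit_interval_power2 x)
  moreover have "1 / 2 * ((x\<^sup>2) ^ Suc n / (real (Suc n) * (1 - (x\<^sup>2) ^ Suc n))) = ?u (2 * Suc n)" for n
    unfolding power_mult[symmetric] by (simp add: field_simps)
  ultimately have B: "(\<lambda>n. ?u (2 * Suc n)) sums (1 / 2 * (- ln (qprod_inf (x\<^sup>2))))"
    by (simp only:)
  from alternating_sums[of ?u, OF Lambert_log_sums[OF x] B] show ?thesis by simp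
qed

text \<open>Since (1 + z)/(1 - z) = 1 + 2 z/(1 - z), each row sum splits into a harmonic term, a
  Lambert term and an inverse square; their alternating sums are the three summands of
  \<open>L_closed\<close>.\<close>

lemma alternating_coth_sums:
  assumes c: "c > 0"
  shows "(\<lambda>m. (-1) ^ Suc m * coth_sum (c * real (Suc m))) sums L_closed c"
proof -
  define Q where "Q = exp (- (2 * pi * c))"
  have Q: "0 < Q" "Q < 1" using c by (auto simp: Q_def)
  have Q2: "Q\<^sup>2 = exp (- (4 * pi * c))"
    by (simp add: Q_def power2_eq_square flip: exp_add)
  have h1: "(\<lambda>m. (-1) ^ Suc m * (1 / real (Suc m))) sums (- ln 2)"
    using sums_minus[OF alternating_harmonic_series_sums] by simp
  have sq: "(\<lambda>n. 1 / (real (Suc n))\<^sup>2) sums (pi\<^sup>2 / 6)"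
    using inverse_squares_sums by (simp add: add.commute)
  have "(\<lambda>n. 1 / 4 * (1 / (real (Suc n))\<^sup>2)) sums (1 / 4 * (pi\<^sup>2 / 6))"
    by (rule sums_mult[OF sq])
  moreover have "1 / 4 * (1 / (real (Suc n))\<^sup>2) = 1 / (real (2 * Suc n))\<^sup>2" for n
    by (simp add: power2_eq_square algebra_simps)
  ultimately have "(\<lambda>n. 1 / (real (2 * Suc n))\<^sup>2) sums (1 / 4 * (pi\<^sup>2 / 6))"
    by (simp only:)
  from alternating_sums[of "\<lambda>n. 1 / (real n)\<^sup>2", OF sq this]
  have h2: "(\<lambda>m. (-1) ^ Suc m * (1 / (real (Suc m))\<^sup>2)) sums (- (pi\<^sup>2 / 12))" by simp
  have "(\<lambda>m. pi / (2 * c) * ((-1) ^ Suc m * (1 / real (Suc m)))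
       + pi / c * ((-1) ^ Suc m * (Q ^ Suc m / (real (Suc m) * (1 - Q ^ Suc m))))
       - 1 / (2 * c\<^sup>2) * ((-1) ^ Suc m * (1 / (real (Suc m))\<^sup>2)))
     sums (pi / (2 * c) * (- ln 2) + pi / c * (ln (qprod_inf Q) - ln (qprod_inf (Q\<^sup>2))) - 1 / (2 * c\<^sup>2) * (- (pi\<^sup>2 / 12)))"
    by (intro sums_add sums_diff sums_mult h1 h2 Lambert_alternating_sums Q)
  moreover have "pi / (2 * c) * (s * (1 / real (Suc m)))
       + pi / c * (s * (Q ^ Suc m / (real (Suc m) * (1 - Q ^ Suc m))))
       - 1 / (2 * c\<^sup>2) * (s * (1 / (real (Suc m))\<^sup>2)) = s * coth_sum (c * real (Suc m))" for m s
  proof -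
    have e: "exp (- (2 * pi * (c * real (Suc m)))) = Q ^ Suc m"
      unfolding Q_def exp_of_nat_mult[symmetric] by (simp add: algebra_simps)
    have "Q ^ Suc m < 1" using Q by (intro powers_less_1) auto
    then have "(1 + Q ^ Suc m) / (1 - Q ^ Suc m) = 1 + 2 * (Q ^ Suc m / (1 - Q ^ Suc m))"
      by (simp add: divide_simps)
    then have "coth_sum (c * real (Suc m)) = pi / (2 * (c * real (Suc m))) * (1 + 2 * (Q ^ Suc m / (1 - Q ^ Suc m))) - 1 / (2 * (c * real (Suc m))\<^sup>2)"
      unfolding coth_sum_def e by (simp only:)
    also have "\<dots> = pi / (2 * c) * (1 / real (Suc m))
       + pi / c * (Q ^ Suc m / (real (Suc m) * (1 - Q ^ Suc m)))
       - 1 / (2 * c\<^sup>2) * (1 / (real (Suc m))\<^sup>2)"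
      by (simp add: distrib_left power_mult_distrib del: power_Suc of_nat_Suc)
    finally show ?thesis by (simp add: distrib_left right_diff_distrib mult_ac del: power_Suc of_nat_Suc)
  qed
  moreover have "pi / (2 * c) * (- ln 2) + pi / c * (ln (qprod_inf Q) - ln (qprod_inf (Q\<^sup>2))) - 1 / (2 * c\<^sup>2) * (- (pi\<^sup>2 / 12)) = L_closed c"
    unfolding Q2 by (simp add: L_closed_def Q_def)
  ultimately show ?thesis by (simp only:)
qed

context
  fixes c :: real
  assumes c: "c > 0"
begin

lemma square_form_pos: "m \<ge> 1 \<Longrightarrow> 0 < (real n)\<^sup>2 + c\<^sup>2 * (real m)\<^sup>2"
  using c by (intro add_nonneg_pos) auto

lemma square_form_antimono:
  "m \<ge> 1 \<Longrightarrow> 1 / ((real n)\<^sup>2 + c\<^sup>2 * (real (Suc m))\<^sup>2) \<le> 1 / ((real n)\<^sup>2 + c\<^sup>2 * (real m)\<^sup>2)"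
  using square_form_pos[of m n] square_form_pos[of "Suc m" n]
  by (intro divide_left_mono mult_pos_pos add_left_mono mult_left_mono power_mono) auto

lemma square_form_rows:
  "m \<ge> 1 \<Longrightarrow> (\<lambda>n. 1 / ((real (Suc n))\<^sup>2 + c\<^sup>2 * (real m)\<^sup>2)) sums coth_sum (c * real m)"
  using sums_inverse_squares_coth[of "c * real m"] c by (simp add: power_mult_distrib)

lemmas square_form_double_series =
  alternating_double_series[of "\<lambda>m n. 1 / ((real n)\<^sup>2 + c\<^sup>2 * (real m)\<^sup>2)", OF _ square_form_antimono
    square_form_rows coth_sum_tendsto_0[OF c] alternating_coth_sums[OF c]]

end

lemma L_partial_tendsto:
  assumes "l \<ge> 1"
  shows "(L_partial l \<longlongrightarrow> L_closed (2 ^ (l - 1))) (sequentially \<times>\<^sub>F sequentially)"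
proof -
  have "(4::real) ^ (l - 1) = (2 ^ (l - 1))\<^sup>2"
    by (simp add: power_mult[symmetric] mult.commute power_mult[of 2 2])
  then have "L_partial l = (\<lambda>(M, N). \<Sum>m=1..M. \<Sum>n=1..N. (-1) ^ m * (1 / ((real n)\<^sup>2 + (2 ^ (l - 1))\<^sup>2 * (real m)\<^sup>2)))"
    unfolding L_partial_def by simp
  then show ?thesis
    using square_form_double_series(1)[of "2 ^ (l - 1)"] by simp
qed

lemma L_eq:
  assumes "l \<ge> 1"
  shows "L l = L_closed (2 ^ (l - 1))"
  unfolding L_def
  by (rule tendsto_Lim[OF _ L_partial_tendsto[OF assms]]) (simp add: prod_filter_eq_bot)

text \<open>Summing the rows and the columns of the symmetric series \<open>L 1\<close> gives two expressions for it;
  equating them yields the transformation of \<open>\<eta>\<close> under \<open>\<tau> \<mapsto> - 1 / \<tau>\<close> at \<open>\<tau> = 2 \<i>\<close>.\<close>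

lemma L_closed_1_alt:
  "L_closed 1 = pi * (ln (qprod_inf (exp (- (2 * pi)))) - ln (qprod_inf (exp (- pi)))) - pi\<^sup>2 / 12"
proof -
  define q where "q = exp (- pi)"
  have q: "0 < q" "q < 1" by (auto simp: q_def)
  have q2: "q\<^sup>2 = exp (- (2 * pi))"
    by (simp add: q_def power2_eq_square flip: exp_add)
  \<comment> \<open>The column sums: the terms of even index are 1 / (n^2 + (2m)^2), a quarter of
    those for \<open>n / 2\<close>. The half argument brings in the nome exp(- pi), that is eta(\<i>
    / 2).\<close>
  define C where "C = (\<lambda>n. coth_sum (real n / 2) / 2 - coth_sum (real n))"
  have "(\<lambda>m. (-1) ^ Suc m * (1 / ((real n)\<^sup>2 + 1\<^sup>2 * (real (Suc m))\<^sup>2))) sums C n" if n: "n \<ge> 1" for n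
  proof -
    let ?u = "\<lambda>m. 1 / ((real n)\<^sup>2 + 1\<^sup>2 * (real m)\<^sup>2)"
    have A: "(\<lambda>m. ?u (Suc m)) sums coth_sum (real n)"
      using sums_inverse_squares_coth[of "real n"] n by (simp add: add.commute)
    have "(\<lambda>m. 1 / 4 * (1 / ((real (Suc m))\<^sup>2 + (real n / 2)\<^sup>2))) sums (1 / 4 * coth_sum (real n / 2))"
      using n by (intro sums_mult sums_inverse_squares_coth) auto
    moreover have "1 / 4 * (1 / ((real (Suc m))\<^sup>2 + (real n / 2)\<^sup>2)) = ?u (2 * Suc m)" for m
    proof -
      have "4 * ((real (Suc m))\<^sup>2 + (real n / 2)\<^sup>2) = (real n)\<^sup>2 + 1\<^sup>2 * (real (2 * Suc m))\<^sup>2"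
        by (simp add: power2_eq_square algebra_simps)
      then show ?thesis by (metis mult.right_neutral times_divide_times_eq)
    qed
    ultimately have "(\<lambda>m. ?u (2 * Suc m)) sums (1 / 4 * coth_sum (real n / 2))"
      by (simp only:)
    from alternating_sums[of ?u, OF A this] show ?thesis by (simp add: C_def)
  qed
  then have "(\<lambda>n. C (Suc n)) sums L_closed 1"
    by (intro square_form_double_series(2)[of 1]) simp_all
  moreover have "(\<lambda>n. C (Suc n)) sums (pi * (- ln (qprod_inf q)) - pi * (- ln (qprod_inf (q\<^sup>2))) - 1 / 2 * (pi\<^sup>2 / 6))"
  proof -
    have sq: "(\<lambda>n. 1 / (real (Suc n))\<^sup>2) sums (pi\<^sup>2 / 6)"
      using inverse_squares_sums by (simp add: add.commute)
    have "(\<lambda>n. pi * (q ^ Suc n / (real (Suc n) * (1 - q ^ Suc n)))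
         - pi * ((q\<^sup>2) ^ Suc n / (real (Suc n) * (1 - (q\<^sup>2) ^ Suc n))) - 1 / 2 * (1 / (real (Suc n))\<^sup>2)) sums
      (pi * (- ln (qprod_inf q)) - pi * (- ln (qprod_inf (q\<^sup>2))) - 1 / 2 * (pi\<^sup>2 / 6))"
      by (intro sums_diff sums_mult Lambert_log_sums q unit_interval_power2 sq)
    \<comment> \<open>The harmonic parts pi / (2n) cancel here, unlike in the rows; the
      \<open>ln 2\<close> left over there becomes the factor sqrt 2 in
      \<open>eta_real_half\<close>.\<close>
    moreover have "pi * (q ^ Suc n / (real (Suc n) * (1 - q ^ Suc n)))
         - pi * ((q\<^sup>2) ^ Suc n / (real (Suc n) * (1 - (q\<^sup>2) ^ Suc n))) - 1 / 2 * (1 / (real (Suc n))\<^sup>2) = C (Suc n)" for n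
    proof -
      have mid: "(1 + z) / (1 - z) = 1 + 2 * (z / (1 - z))" if "z < 1" for z :: real
        using that by (simp add: divide_simps)
      have e1: "exp (- (2 * pi * (real (Suc n) / 2))) = q ^ Suc n"
        unfolding q_def exp_of_nat_mult[symmetric] by (simp add: algebra_simps)
      have e2: "exp (- (2 * pi * real (Suc n))) = (q\<^sup>2) ^ Suc n"
        unfolding q2 exp_of_nat_mult[symmetric] by (simp add: algebra_simps)
      have l1: "q ^ Suc n < 1" "(q\<^sup>2) ^ Suc n < 1"
        using powers_less_1[OF q, of "Suc n"] powers_less_1[OF unit_interval_power2[OF q], of "Suc n"] by blast+
      show ?thesis
        unfolding C_def coth_sum_def e1 e2 mid[OF l1(1)] mid[OF l1(2)]
        by (simp add: distrib_left diff_divide_distrib add_divide_distrib power_divide del: power_Suc of_nat_Suc)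
    qed
    ultimately show ?thesis by (simp only:)
  qed
  ultimately have "L_closed 1 = pi * (- ln (qprod_inf q)) - pi * (- ln (qprod_inf (q\<^sup>2))) - 1 / 2 * (pi\<^sup>2 / 6)"
    by (rule sums_unique2)
  then show ?thesis
    unfolding q2 by (simp add: q_def right_diff_distrib)
qed

section \<open>The eta function on the imaginary axis\<close>

definition eta_real :: "real \<Rightarrow> real" where
  "eta_real t = exp (- (pi * t / 12)) * qprod_inf (exp (- (2 * pi * t)))"

lemma eta_real_pos: "t > 0 \<Longrightarrow> eta_real t > 0"
  unfolding eta_real_def by (intro mult_pos_pos qprod_inf_pos) auto

lemma ln_eta_real: "t > 0 \<Longrightarrow> ln (eta_real t) = ln (qprod_inf (exp (- (2 * pi * t)))) - pi * t / 12"
  unfolding eta_real_def using qprod_inf_pos[of "exp (- (2 * pi * t))"]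
  by (subst ln_mult) auto

lemma qprod_inf_exp: "qprod_inf (exp (- (2 * pi * t))) = exp (pi * t / 12) * eta_real t"
  by (simp add: eta_real_def flip: exp_add mult.assoc)

text \<open>\<open>L_closed c\<close> solved for the logarithm of its second product. The term pi /
  (24 c) comes from the inverse squares, pi c / 12 from the factors q^(1/24).\<close>

lemma ln_eta_real_double:
  assumes c: "c > 0"
  shows "ln (eta_real (2 * c)) = ln (eta_real c) - c / pi * L_closed c - ln 2 / 2 + pi / (24 * c) - pi * c / 12"
proof -
  define A B where "A = ln (qprod_inf (exp (- (2 * pi * c))))" and "B = ln (qprod_inf (exp (- (4 * pi * c))))"
  have "c / pi * L_closed c = - (ln 2 / 2) + (A - B) + pi / (24 * c)"
    unfolding L_closed_def A_def[symmetric] B_def[symmetric] using c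
    by (simp add: field_simps power2_eq_square)
  moreover have "ln (eta_real c) = A - pi * c / 12"
    using ln_eta_real[OF c] by (simp add: A_def)
  moreover have "ln (eta_real (2 * c)) = B - pi * c / 6"
    using ln_eta_real[of "2 * c"] c by (simp add: B_def mult.assoc)
  ultimately show ?thesis by argo
qed

lemma eta_real_half: "eta_real (1 / 2) = sqrt 2 * eta_real 2"
proof -
  have h: "ln (eta_real (1 / 2)) = ln (qprod_inf (exp (- pi))) - pi / 24"
    using ln_eta_real[of "1 / 2"] by simp
  have 1: "ln (eta_real 1) = ln (qprod_inf (exp (- (2 * pi)))) - pi / 12"
    using ln_eta_real[of 1] by simp
  have 2: "ln (eta_real 2) = ln (eta_real 1) - L_closed 1 / pi - ln 2 / 2 + pi / 24 - pi / 12"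
    using ln_eta_real_double[of 1] by simp
  have "L_closed 1 / pi = ln (qprod_inf (exp (- (2 * pi)))) - ln (qprod_inf (exp (- pi))) - pi / 12"
    unfolding L_closed_1_alt by (simp add: field_simps power2_eq_square)
  with h 1 2 have "ln (eta_real (1 / 2)) = ln 2 / 2 + ln (eta_real 2)" by argo
  also have "\<dots> = ln (sqrt 2 * eta_real 2)"
    using eta_real_pos[of 2] by (simp add: ln_mult ln_sqrt)
  finally show ?thesis
    using eta_real_pos[of "1 / 2"] eta_real_pos[of 2] by (simp del: ln_mult)
qed

lemma exp_pi_powers:
  "(exp (- (pi * t)))\<^sup>2 = exp (- (2 * pi * t))"
  "(exp (- (pi * t))) ^ 4 = exp (- (2 * pi * (2 * t)))"
  "exp (- (pi * t)) = exp (- (2 * pi * (t / 2)))"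
  by (simp_all flip: exp_of_nat_mult)

lemma
  assumes t: "t > 0"
  shows theta3_eta: "theta3 (exp (- (pi * t))) = eta_real t ^ 5 / ((eta_real (t / 2))\<^sup>2 * (eta_real (2 * t))\<^sup>2)"
    and theta4_eta: "theta4 (exp (- (pi * t))) = (eta_real (t / 2))\<^sup>2 / eta_real t"
    and psi_eta: "psi (exp (- (pi * t))) = exp (pi * t / 4) * ((eta_real (2 * t))\<^sup>2 / eta_real t)"
proof -
  have x: "0 < exp (- (pi * t))" "exp (- (pi * t)) < 1" using t by auto
  \<comment> \<open>The factors between \<open>qprod_inf\<close> and \<open>eta_real\<close> at t/2,
    t and 2t are E, E^2 and E^4. They cancel in \<open>theta3\<close> and \<open>theta4\<close> and
    leave E^6 in \<open>psi\<close>, the inverse of the factor x^(1/4) of theta2.\<close>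
  define E where "E = exp (pi * t / 24)"
  have e: "exp (pi * (t / 2) / 12) = E" "exp (pi * t / 12) = E ^ 2" "exp (pi * (2 * t) / 12) = E ^ 4" "exp (pi * t / 4) = E ^ 6"
    by (simp_all add: E_def flip: exp_of_nat_mult)
  have E: "E \<noteq> 0" by (simp add: E_def)
  have q1: "qprod_inf (exp (- (pi * t))) = E * eta_real (t / 2)"
    using qprod_inf_exp[of "t / 2"] unfolding e exp_pi_powers(3)[symmetric] .
  have q2: "qprod_inf ((exp (- (pi * t)))\<^sup>2) = E ^ 2 * eta_real t"
    using qprod_inf_exp[of t] unfolding e exp_pi_powers(1)[symmetric] .
  have q4: "qprod_inf (exp (- (pi * t)) ^ 4) = E ^ 4 * eta_real (2 * t)"
    using qprod_inf_exp[of "2 * t"] unfolding e exp_pi_powers(2)[symmetric] .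
  note pos = eta_real_pos[of t] eta_real_pos[of "t / 2"] eta_real_pos[of "2 * t"]
  show "theta3 (exp (- (pi * t))) = eta_real t ^ 5 / ((eta_real (t / 2))\<^sup>2 * (eta_real (2 * t))\<^sup>2)"
    unfolding theta3_prod[OF x] q1 q2 q4 power_mult_distrib power_mult[symmetric] using E pos t
    by (simp add: field_simps flip: power_add)
  show "theta4 (exp (- (pi * t))) = (eta_real (t / 2))\<^sup>2 / eta_real t"
    unfolding theta4_prod[OF x] q1 q2 using E by (simp add: power_mult_distrib)
  show "psi (exp (- (pi * t))) = exp (pi * t / 4) * ((eta_real (2 * t))\<^sup>2 / eta_real t)"
    unfolding psi_prod[OF x] q2 q4 e power_mult_distrib power_mult[symmetric] using E pos t
    by (simp add: field_simps flip: power_add)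
qed

section \<open>Special values\<close>

text \<open>With eta(\<i> / 2) eliminated, the theta constants at exp(- pi) are monomials in
  \<open>e1\<close> and \<open>e2\<close>, up to the exponential in \<open>psi\<close>, and the
  quartic identity reads e1^24 = 512 e2^24. Positive roots are taken in two stages, cube and
  square.\<close>

lemma
  shows ln_eta_real_2: "ln (eta_real 2) = ln (eta_real 1) - 3 / 8 * ln 2"
    and theta3_exp_pi: "theta3 (exp (- pi)) = sqrt 2 * eta_real 1"
    and theta4_exp_pi: "(theta4 (exp (- pi)))\<^sup>2 = sqrt 2 * (eta_real 1)\<^sup>2"
proof -
  define e1 e2 where "e1 = eta_real 1" and "e2 = eta_real 2"
  have pos: "e1 > 0" "e2 > 0" by (auto simp: e1_def e2_def eta_real_pos)
  have half: "(eta_real (1 / 2))\<^sup>2 = 2 * e2\<^sup>2"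
    by (simp add: eta_real_half e2_def power_mult_distrib)
  have x: "0 < exp (- pi)" "exp (- pi) < 1" by auto
  have t3: "theta3 (exp (- pi)) = e1 ^ 5 / (2 * e2 ^ 4)"
    using theta3_eta[of 1] half by (simp add: e1_def e2_def flip: power_mult power_add)
  have t4: "theta4 (exp (- pi)) = 2 * e2\<^sup>2 / e1"
    using theta4_eta[of 1] half by (simp add: e1_def)
  have ps: "psi (exp (- pi)) = exp (pi / 4) * (e2\<^sup>2 / e1)"
    using psi_eta[of 1] by (simp add: e1_def e2_def)
  have "exp (- pi) * psi (exp (- pi)) ^ 4 = exp (- pi) * exp (pi / 4) ^ 4 * (e2\<^sup>2 / e1) ^ 4"
    unfolding ps by (simp only: power_mult_distrib mult.assoc)
  also have "exp (- pi) * exp (pi / 4) ^ 4 = 1"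
    by (simp flip: exp_of_nat_mult exp_add)
  finally have p: "16 * exp (- pi) * psi (exp (- pi)) ^ 4 = 16 * (e2 ^ 8 / e1 ^ 4)"
    by (simp add: power_divide flip: power_mult)
  have "(e1 ^ 5 / (2 * e2 ^ 4)) ^ 4 - (2 * e2\<^sup>2 / e1) ^ 4 = 16 * (e2 ^ 8 / e1 ^ 4)"
    using theta_quartic[OF x] unfolding t3 t4 p .
  then have "e1 ^ 20 / (16 * e2 ^ 16) = 32 * (e2 ^ 8 / e1 ^ 4)"
    by (simp add: power_divide power_mult_distrib flip: power_mult)
  then have "e1 ^ 24 = 512 * e2 ^ 24"
    using pos by (simp add: field_simps flip: power_add)
  then have "(e1 ^ 8) ^ 3 = (8 * e2 ^ 8) ^ 3"
    by (simp add: power_mult_distrib flip: power_mult)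
  then have "e1 ^ 8 = 8 * e2 ^ 8"
    using pos by (subst (asm) power_eq_iff_eq_base) auto
  then have "(e1 ^ 4)\<^sup>2 = (2 * sqrt 2 * e2 ^ 4)\<^sup>2"
    by (simp add: power_mult_distrib flip: power_mult)
  then have e: "e1 ^ 4 = 2 * sqrt 2 * e2 ^ 4"
    using pos by (subst (asm) power_eq_iff_eq_base) auto
  have "ln (e1 ^ 4) = ln (2 * sqrt 2 * e2 ^ 4)" by (simp only: e)
  then have "4 * ln e1 = ln 2 + ln 2 / 2 + 4 * ln e2"
    using pos by (simp add: ln_mult ln_sqrt ln_realpow)
  then show "ln (eta_real 2) = ln (eta_real 1) - 3 / 8 * ln 2"
    by (simp add: e1_def e2_def)
  have "e1 ^ 5 / (2 * e2 ^ 4) = e1 ^ 4 * e1 / (2 * e2 ^ 4)" by (simp add: eval_nat_numeral)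
  also have "\<dots> = sqrt 2 * e1" unfolding e using pos by simp
  finally show "theta3 (exp (- pi)) = sqrt 2 * eta_real 1"
    unfolding t3 by (simp add: e1_def)
  have "(2 * e2\<^sup>2 / e1)\<^sup>2 = 4 * e2 ^ 4 / e1\<^sup>2"
    by (simp add: power_divide power_mult_distrib flip: power_mult)
  also have "\<dots> = sqrt 2 * e1\<^sup>2"
  proof -
    have "sqrt 2 * (2 * sqrt 2 * e2 ^ 4) = 4 * e2 ^ 4"
      using real_sqrt_mult_self[of 2] by (simp add: mult.commute mult.left_commute)
    then have "4 * e2 ^ 4 = sqrt 2 * e1 ^ 4" unfolding e ..
    then show ?thesis using pos by (simp add: field_simps flip: power_add)
  qed
  finally show "(theta4 (exp (- pi)))\<^sup>2 = sqrt 2 * (eta_real 1)\<^sup>2"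
    unfolding t4 by (simp add: e1_def)
qed

text \<open>The two squares at the nome exp(- pi) are in the ratio sqrt 2 : 1, the lemniscatic case
  of the integral; homogeneity then isolates \<open>e\<^sup>2\<close>.\<close>

lemma eta_real_1: "eta_real 1 = pi powr (1 / 4) / Gamma (3 / 4) / sqrt 2"
proof -
  define e where "e = eta_real 1"
  have e: "e > 0" by (simp add: e_def eta_real_pos)
  have G: "Gamma (3 / 4 :: real) > 0" by (rule Gamma_real_pos) simp
  have "agm_integral ((theta3 (exp (- pi)))\<^sup>2) ((theta4 (exp (- pi)))\<^sup>2) = pi / 2"
    by (rule agm_integral_theta) auto
  note theta = this
  have "agm_integral ((sqrt 2 * e\<^sup>2) * sqrt 2) ((sqrt 2 * e\<^sup>2) * 1) = pi / 2"
  proof -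
    have "(sqrt 2 * e)\<^sup>2 = (sqrt 2 * e\<^sup>2) * sqrt 2"
      by (simp add: power2_eq_square mult_ac)
    then show ?thesis
      using theta unfolding theta3_exp_pi theta4_exp_pi e_def by (simp only: mult_1_right)
  qed
  then have "Beta (1 / 4) (1 / 2) / 4 / (sqrt 2 * e\<^sup>2) = pi / 2"
    using e by (subst (asm) agm_integral_scale) (simp_all add: agm_integral_lemniscate)
  then have "sqrt 2 * pi * sqrt pi / (Gamma (3 / 4))\<^sup>2 = 2 * pi * (sqrt 2 * e\<^sup>2)"
    unfolding Beta_quarter_half using e by (simp add: divide_simps)
  moreover have "(Gamma (3 / 4))\<^sup>2 > (0::real)" using G by (rule zero_less_power)
  moreover have "e\<^sup>2 = sqrt pi / (2 * g)" if "sqrt 2 * pi * sqrt pi / g = 2 * pi * (sqrt 2 * e\<^sup>2)" "g > 0" for g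
    using that by (simp add: field_simps)
  ultimately have "e\<^sup>2 = sqrt pi / (2 * (Gamma (3 / 4))\<^sup>2)"
    by blast
  also have "\<dots> = (pi powr (1 / 4) / Gamma (3 / 4) / sqrt 2)\<^sup>2"
  proof -
    have "(pi powr (1 / 4))\<^sup>2 = sqrt pi"
      by (simp add: power2_eq_square powr_half_sqrt flip: powr_add)
    then show ?thesis by (simp add: power_divide power_mult_distrib)
  qed
  finally show ?thesis
    using e G unfolding e_def by (subst (asm) power_eq_iff_eq_base) auto
qed

text \<open>At exp(- pi) the difference theta3^2 - theta4^2 is (2 - sqrt 2) eta(\<i>)^2, the source
  of sqrt 2 - 1; \<open>psi\<close> at the squared nome brings in eta(4 \<i>).\<close>

lemma ln_eta_real_4: "ln (eta_real 4) = ln (eta_real 2) - 7 / 16 * ln 2 + ln (sqrt 2 - 1) / 4"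
proof -
  define e1 e2 e4 where "e1 = eta_real 1" and "e2 = eta_real 2" and "e4 = eta_real 4"
  have pos: "e1 > 0" "e2 > 0" "e4 > 0" by (auto simp: e1_def e2_def e4_def eta_real_pos)
  have x: "0 < exp (- pi)" "exp (- pi) < 1" by auto
  have ps: "psi ((exp (- pi))\<^sup>2) = exp (pi / 2) * (e4\<^sup>2 / e2)"
    using psi_eta[of 2] exp_pi_powers(1)[of 1] by (simp add: e2_def e4_def mult.commute)
  have "exp (- pi) * (psi ((exp (- pi))\<^sup>2))\<^sup>2 = exp (- pi) * exp (pi / 2) ^ 2 * (e4\<^sup>2 / e2)\<^sup>2"
    unfolding ps by (simp only: power_mult_distrib mult.assoc)
  also have "exp (- pi) * exp (pi / 2) ^ 2 = 1"
    by (simp flip: exp_of_nat_mult exp_add)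
  finally have "8 * exp (- pi) * (psi ((exp (- pi))\<^sup>2))\<^sup>2 = 8 * (e4 ^ 4 / e2\<^sup>2)"
    by (simp add: power_divide flip: power_mult)
  then have "2 * e1\<^sup>2 - sqrt 2 * e1\<^sup>2 = 8 * (e4 ^ 4 / e2\<^sup>2)"
    using theta_square_diff[OF x] unfolding theta3_exp_pi theta4_exp_pi
    by (simp add: e1_def power_mult_distrib)
  moreover have "sqrt 2 * sqrt 2 = (2::real)" by simp
  ultimately have "8 * e4 ^ 4 = sqrt 2 * (sqrt 2 - 1) * (e1\<^sup>2 * e2\<^sup>2)"
    using pos by (simp add: field_simps)
  then have "ln (8 * e4 ^ 4) = ln (sqrt 2 * (sqrt 2 - 1) * (e1\<^sup>2 * e2\<^sup>2))"
    by (simp only:)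
  moreover have "ln (8 :: real) = 3 * ln 2"
    using ln_realpow[of 2 3] by simp
  moreover have "sqrt 2 - 1 > (0::real)" by simp
  ultimately have "3 * ln 2 + 4 * ln e4 = ln 2 / 2 + ln (sqrt 2 - 1) + (2 * ln e1 + 2 * ln e2)"
    using pos by (simp add: ln_mult ln_sqrt ln_realpow)
  then show ?thesis
    using ln_eta_real_2 unfolding e1_def e2_def e4_def by argo
qed

text \<open>The analogue with first powers: theta4 / theta3 = 2^(-1/4) at exp(- pi), and
  \<open>psi\<close> at the fourth power of the nome brings in eta(8 \<i>).\<close>

lemma ln_eta_real_8:
  "ln (eta_real 8) = ln (eta_real 4) - 11 / 32 * ln 2 - ln (sqrt 2 - 1) / 8 + ln (1 - 2 powr (- (1 / 4))) / 2"
proof -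
  define e1 e4 e8 where "e1 = eta_real 1" and "e4 = eta_real 4" and "e8 = eta_real 8"
  have pos: "e1 > 0" "e4 > 0" "e8 > 0" by (auto simp: e1_def e4_def e8_def eta_real_pos)
  have x: "0 < exp (- pi)" "exp (- pi) < 1" by auto
  have "theta4 (exp (- pi)) = sqrt 2 * e1 * 2 powr (- (1 / 4))"
  proof -
    have "(2 powr (- (1 / 4)))\<^sup>2 = 2 powr (- (1 / 2) :: real)"
      by (simp add: power2_eq_square flip: powr_add)
    also have "\<dots> = 1 / sqrt 2"
      by (simp add: powr_minus powr_half_sqrt inverse_eq_divide)
    finally have "(sqrt 2 * e1 * 2 powr (- (1 / 4)))\<^sup>2 = 2 * e1\<^sup>2 * (1 / sqrt 2)"
      by (simp only: power_mult_distrib) simp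
    also have "\<dots> = sqrt 2 * e1\<^sup>2"
    proof -
      have "2 * y * (1 / sqrt 2) = (2 / sqrt 2) * y" for y :: real by simp
      then show ?thesis using real_div_sqrt[of 2] by simp
    qed
    finally have "(theta4 (exp (- pi)))\<^sup>2 = (sqrt 2 * e1 * 2 powr (- (1 / 4)))\<^sup>2"
      unfolding theta4_exp_pi e1_def by simp
    then show ?thesis
      using theta4_pos[OF x] pos by (subst (asm) power_eq_iff_eq_base) auto
  qed
  moreover have "4 * exp (- pi) * psi (exp (- pi) ^ 4) = 4 * (e8\<^sup>2 / e4)"
    using psi_eta[of 4] exp_pi_powers(2)[of 1] by (simp add: e4_def e8_def mult.commute flip: exp_add)
  ultimately have "sqrt 2 * e1 - sqrt 2 * e1 * 2 powr (- (1 / 4)) = 4 * (e8\<^sup>2 / e4)"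
    using theta_diff[OF x] unfolding theta3_exp_pi by (simp add: e1_def)
  then have "4 * e8\<^sup>2 = sqrt 2 * e1 * (1 - 2 powr (- (1 / 4))) * e4"
    using pos by (simp add: field_simps)
  then have "ln (4 * e8\<^sup>2) = ln (sqrt 2 * e1 * (1 - 2 powr (- (1 / 4))) * e4)"
    by (simp only:)
  moreover have "ln (4 :: real) = 2 * ln 2"
    using ln_realpow[of 2 2] by simp
  moreover have "1 - 2 powr (- (1 / 4)) > (0::real)"
    using powr_less_mono[of "- (1 / 4)" 0 2] by simp
  ultimately have "2 * ln 2 + 2 * ln e8 = ln 2 / 2 + ln e1 + ln (1 - 2 powr (- (1 / 4))) + ln e4"
    using pos by (simp add: ln_mult ln_sqrt ln_realpow)
  then show ?thesis
    using ln_eta_real_2 ln_eta_real_4 unfolding e1_def e4_def e8_def by argo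
qed

lemma L_from_eta:
  assumes c: "c > 0" and r: "ln (eta_real (2 * c)) = ln (eta_real c) + d"
  shows "L_closed c = pi / c * (pi / (24 * c) - pi * c / 12 - ln 2 / 2 - d)"
proof -
  have "c / pi * L_closed c = pi / (24 * c) - pi * c / 12 - ln 2 / 2 - d"
    using ln_eta_real_double[OF c] r by argo
  moreover have "L_closed c = pi / c * (c / pi * L_closed c)" using c by simp
  ultimately show ?thesis by (simp only:)
qed

lemma L_1: "L 1 = - (pi ^ 2 / 24) - pi * ln 2 / 8"
proof -
  have "ln (eta_real (2 * 1)) = ln (eta_real 1) + (- (3 / 8 * ln 2))"
    using ln_eta_real_2 by simp
  from L_from_eta[OF _ this] show ?thesis
    by (simp add: L_eq field_simps power2_eq_square)
qed

lemma L_2: "L 2 = - (7 * pi ^ 2 / 96) - pi * ln 2 / 32 - pi * ln (sqrt 2 - 1) / 8"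
proof -
  have "ln (eta_real (2 * 2)) = ln (eta_real 2) + (- 7 / 16 * ln 2 + ln (sqrt 2 - 1) / 4)"
    using ln_eta_real_4 by simp
  from L_from_eta[OF _ this] show ?thesis
    by (simp add: L_eq field_simps power2_eq_square)
qed

lemma L_3: "L 3 = - (31 * pi ^ 2 / 384) - 5 * pi * ln 2 / 128 + pi * ln (sqrt 2 - 1) / 32
          - pi * ln (1 - 2 powr (- (1 / 4))) / 8"
proof -
  have "ln (eta_real (2 * 4)) = ln (eta_real 4) + (- 11 / 32 * ln 2 - ln (sqrt 2 - 1) / 8 + ln (1 - 2 powr (- (1 / 4))) / 2)"
    using ln_eta_real_8 by simp
  from L_from_eta[OF _ this] show ?thesis
    by (simp add: L_eq field_simps power2_eq_square)
qed

section \<open>Evaluation of the expansion at \<open>2 ^ r * \<i>\<close>\<close>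

text \<open>The doubling formula telescopes from eta(\<i>) = a / sqrt 2; the last two terms are the
  geometric sums of pi / (24 2^j) and pi 2^j / 12 over j < s.\<close>

lemma ln_eta_real_power_2:
  assumes "a = pi powr (1 / 4) / Gamma (3 / 4)"
  shows "ln (eta_real (2 ^ s)) = ln a - ln 2 / 2 - 1 / (2 * pi) * (\<Sum>m=1..s. 2 ^ m * L m)
     - real s * (ln 2 / 2) + pi / 24 * (2 - 2 / 2 ^ s) - pi / 12 * (2 ^ s - 1)"
proof (induction s)
  case 0
  have "a > 0" unfolding assms by (intro divide_pos_pos Gamma_real_pos) auto
  then have "ln (eta_real 1) = ln a - ln 2 / 2"
    unfolding eta_real_1 assms[symmetric] by (simp add: ln_div ln_sqrt)
  then show ?case by simp
next
  case (Suc s)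
  have 1: "ln (eta_real (2 ^ Suc s)) = ln (eta_real (2 ^ s)) - 2 ^ s / pi * L (Suc s) - ln 2 / 2 + pi / (24 * 2 ^ s) - pi * 2 ^ s / 12"
    using ln_eta_real_double[of "2 ^ s"] by (simp add: L_eq)
  have 2: "(\<Sum>m=1..Suc s. 2 ^ m * L m) = (\<Sum>m=1..s. 2 ^ m * L m) + 2 * 2 ^ s * L (Suc s)"
    by simp
  show ?case
    unfolding 1 2 Suc.IH by (simp add: field_simps)
qed

lemma eta_imaginary:
  assumes t: "t > 0"
  shows "eta (of_real t * \<i>) = of_real (eta_real t)"
proof -
  have e: "exp (2 * of_real pi * \<i> * (of_real t * \<i>)) = complex_of_real (exp (- (2 * pi * t)))"
    by (simp add: exp_of_real[symmetric] mult_ac)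
  have e': "exp (2 * of_real pi * \<i> * (of_real t * \<i>) / 24) = complex_of_real (exp (- (pi * t / 12)))"
    by (simp add: exp_of_real[symmetric] mult_ac)
  have "convergent_prod (\<lambda>n. 1 - exp (- (2 * pi * t)) ^ Suc n)"
    using t by (intro convergent_prod_qprod) auto
  then have "(\<lambda>n. 1 - exp (- (2 * pi * t)) ^ Suc n) has_prod qprod_inf (exp (- (2 * pi * t)))"
    unfolding qprod_inf_def by (rule convergent_prod_has_prod)
  then have "(\<lambda>n. complex_of_real (1 - exp (- (2 * pi * t)) ^ Suc n)) has_prod of_real (qprod_inf (exp (- (2 * pi * t))))"
    by (simp only: has_prod_of_real_iff)
  then have "(\<Prod>n. 1 - complex_of_real (exp (- (2 * pi * t))) ^ Suc n) = of_real (qprod_inf (exp (- (2 * pi * t))))"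
    by (simp add: has_prod_iff)
  then show ?thesis
    unfolding eta_def e e' by (simp add: eta_real_def)
qed

lemma theta_imaginary:
  assumes t: "t > 0"
  shows "theta (of_real t * \<i>) = of_real (theta3 (exp (- (2 * pi * t))))"
proof -
  define x where "x = exp (- (2 * pi * t))"
  have x: "0 < x" "x < 1" using t by (auto simp: x_def)
  have pos: "((\<lambda>k. x ^ (Suc k)\<^sup>2) has_sum ((theta3 x - 1) / 2)) UNIV"
    using x by (intro sums_nonneg_imp_has_sum theta3_sums) auto
  let ?g = "\<lambda>n::int. x ^ (nat \<bar>n\<bar>)\<^sup>2"
  have 1: "(?g has_sum ((theta3 x - 1) / 2)) {0<..}"
    by (rule iffD1[OF has_sum_reindex_bij_witness[where i = "\<lambda>n. nat n - 1" and j = "\<lambda>k. int (Suc k)"] pos])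
       (auto simp del: of_nat_Suc)
  have 2: "(?g has_sum ((theta3 x - 1) / 2)) {..<0}"
    by (rule iffD1[OF has_sum_reindex_bij_witness[where i = uminus and j = uminus] 1]) auto
  have 3: "(?g has_sum 1) {0}"
    using has_sum_finite[of "{0}" ?g] by simp
  have "(?g has_sum ((theta3 x - 1) / 2 + 1)) ({0<..} \<union> {0})"
    by (rule has_sum_Un_disjoint[OF 1 3]) simp
  from has_sum_Un_disjoint[OF this 2]
  have "(?g has_sum ((theta3 x - 1) / 2 + 1 + (theta3 x - 1) / 2)) ({0<..} \<union> {0} \<union> {..<0})"
    by fastforce
  moreover have "{0<..} \<union> {0} \<union> {..<0} = (UNIV :: int set)" by auto
  moreover have "(theta3 x - 1) / 2 + 1 + (theta3 x - 1) / 2 = theta3 x" by argo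
  ultimately have "(?g has_sum theta3 x) UNIV" by (simp only:)
  then have "((\<lambda>n. complex_of_real (?g n)) has_sum of_real (theta3 x)) UNIV"
    by (rule has_sum_of_real)
  moreover have "complex_of_real (?g n) = exp (2 * of_real pi * \<i> * (of_real t * \<i>) * of_int (n ^ 2))" for n
  proof -
    have "?g n = exp (real ((nat \<bar>n\<bar>)\<^sup>2) * (- (2 * pi * t)))"
      unfolding x_def by (rule exp_of_nat_mult[symmetric])
    also have "real ((nat \<bar>n\<bar>)\<^sup>2) = of_int (n ^ 2)" by simp
    finally show ?thesis
      by (simp add: exp_of_real[symmetric] mult_ac)
  qed
  ultimately have "((\<lambda>n. exp (2 * of_real pi * \<i> * (of_real t * \<i>) * of_int (n ^ 2))) has_sum of_real (theta3 x)) UNIV"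
    by (simp only:)
  then show ?thesis
    unfolding theta_def x_def[symmetric] by (rule infsumI)
qed

theorem theorem1p4:
  fixes k r :: nat and \<alpha> \<beta> :: "nat \<Rightarrow> complex" and a :: real and \<tau> :: complex
  assumes "k \<ge> 1"
    and "H_expansion k \<alpha> \<beta>"
    and "a = pi powr (1 / 4) / Gamma (3 / 4)"
    and "\<tau> = 2 ^ r * \<i>"
  shows "(\<forall>l\<ge>1. (L_partial l \<longlongrightarrow> L l) (sequentially \<times>\<^sub>F sequentially)) \<and>
    H k \<tau> = of_real (a ^ (4 * k + 2) / 2 ^ ((2 * k + 1) * (r + 3))) *
       (of_real (exp (- (2 ^ (r + 1) * (real k + 1) * pi)) / 4 ^ (k + 1))
        + (\<Sum>l=1..k-1. \<alpha> l / 4 ^ l * of_real (exp (M k l r)))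
        + (\<Sum>l=k..2*k. \<beta> l / 4 ^ l * of_real (exp (M k l r)))) *
       of_real (exp (J k r)) \<and>
    L 1 = - (pi ^ 2 / 24) - pi * ln 2 / 8 \<and>
    L 2 = - (7 * pi ^ 2 / 96) - pi * ln 2 / 32 - pi * ln (sqrt 2 - 1) / 8 \<and>
    L 3 = - (31 * pi ^ 2 / 384) - 5 * pi * ln 2 / 128 + pi * ln (sqrt 2 - 1) / 32
          - pi * ln (1 - 2 powr (- (1 / 4))) / 8"
proof (intro conjI)
  show "\<forall>l\<ge>1. (L_partial l \<longlongrightarrow> L l) (sequentially \<times>\<^sub>F sequentially)"
    using L_partial_tendsto by (simp add: L_eq)
  define T :: real where "T = 2 ^ r"
  have T: "T > 0" by (simp add: T_def)
  \<comment> \<open>Only eta at 2 \<tau>, 4 \<tau> and 8 \<tau> occurs. In the logarithms of the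
    first value and of the two successive ratios every product is linear, and \<open>v\<close> and
    \<open>w\<close> involve a single value of \<open>L\<close> each.\<close>
  define u v w where "u = ln (eta_real (2 * T))"
    and "v = ln (eta_real (4 * T)) - ln (eta_real (2 * T))"
    and "w = ln (eta_real (8 * T)) - ln (eta_real (4 * T))"
  have e2: "eta_real (2 * T) = exp u" and e4: "eta_real (4 * T) = exp (u + v)"
    and e8: "eta_real (8 * T) = exp (u + v + w)"
    using T by (simp_all add: u_def v_def w_def eta_real_pos)
  have tau: "\<tau> = of_real T * \<i>" by (simp add: assms T_def)
  have c_eta: "eta (2 * \<tau>) = of_real (exp u)" "eta (4 * \<tau>) = of_real (exp (u + v))"
    "eta (8 * \<tau>) = of_real (exp (u + v + w))"
    using eta_imaginary[of "2 * T"] eta_imaginary[of "4 * T"] eta_imaginary[of "8 * T"] T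
    unfolding tau e2 e4 e8 by (simp_all add: mult.assoc)
  have c_theta: "theta (2 * \<tau>) = of_real (exp (u + 3 * v - 2 * w))"
  proof -
    have "theta (2 * \<tau>) = of_real (theta3 (exp (- (pi * (4 * T)))))"
      using theta_imaginary[of "2 * T"] T by (simp add: tau mult_ac)
    also have "theta3 (exp (- (pi * (4 * T)))) = exp (u + v) ^ 5 / ((exp u)\<^sup>2 * (exp (u + v + w))\<^sup>2)"
      using theta3_eta[of "4 * T"] T by (simp add: e2 e4 e8)
    also have "\<dots> = exp (u + 3 * v - 2 * w)"
      by (simp add: algebra_simps flip: exp_of_nat_mult exp_add exp_diff)
    finally show ?thesis .
  qed
  have c_F: "F \<tau> = of_real (exp (4 * u + 8 * v))"
  proof -
    have "F \<tau> = of_real (exp (u + v) ^ 8 / exp u ^ 4)"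
      unfolding F_def c_eta by simp
    also have "exp (u + v) ^ 8 / exp u ^ 4 = exp (4 * u + 8 * v)"
      by (simp add: algebra_simps flip: exp_of_nat_mult exp_diff)
    finally show ?thesis .
  qed
  have c_F2: "F (2 * \<tau>) = of_real (exp (4 * u + 4 * v + 8 * w))"
  proof -
    have "F (2 * \<tau>) = of_real (exp (u + v + w) ^ 8 / exp (u + v) ^ 4)"
      unfolding F_def using c_eta by simp
    also have "exp (u + v + w) ^ 8 / exp (u + v) ^ 4 = exp (4 * u + 4 * v + 8 * w)"
      by (simp add: algebra_simps flip: exp_of_nat_mult exp_diff)
    finally show ?thesis .
  qed
  define S where "S = (4 * real k + 2) * u + (8 * real k + 2) * v + 4 * w"
  \<comment> \<open>The logarithm of theta(2 \<tau>)^4 / F(\<tau>) and also of F(\<tau>) / F(2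
    \<tau>), hence the same exponent in \<open>c_\<alpha>\<close> and
    \<open>c_\<beta>\<close>.\<close>
  define d where "d = 4 * v - 8 * w"
  have c_f: "f k \<tau> = of_real (exp S)"
  proof -
    have "f k \<tau> = of_real (exp (u + v) ^ (8 * k - 2) * exp (u + v + w) ^ 4 / exp u ^ (4 * k))"
      unfolding f_def c_eta by simp
    also have "exp (u + v) ^ (8 * k - 2) * exp (u + v + w) ^ 4 / exp u ^ (4 * k) = exp S"
      using \<open>k \<ge> 1\<close> unfolding exp_of_nat_mult[symmetric] exp_add[symmetric] exp_diff[symmetric] S_def
      by (simp add: of_nat_diff algebra_simps)
    finally show ?thesis .
  qed
  have c_\<alpha>: "F \<tau> ^ l * theta (2 * \<tau>) ^ (4 * (k - l) + 2) = of_real (exp (S + (real k - real l + 1) * d))"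
    if "l \<le> k" for l
  proof -
    have "exp (4 * u + 8 * v) ^ l * exp (u + 3 * v - 2 * w) ^ (4 * (k - l) + 2) = exp (S + (real k - real l + 1) * d)"
      using that unfolding exp_of_nat_mult[symmetric] exp_add[symmetric] S_def d_def
      by (simp add: of_nat_diff algebra_simps)
    then show ?thesis
      unfolding c_F c_theta of_real_power[symmetric] of_real_mult[symmetric] by (simp only:)
  qed
  have c_\<beta>: "F \<tau> ^ (2 * k - l) * F (2 * \<tau>) ^ (l - k) * theta (2 * \<tau>) ^ 2 = of_real (exp (S + (real k - real l + 1) * d))"
    if "k \<le> l" "l \<le> 2 * k" for l
  proof -
    have "exp (4 * u + 8 * v) ^ (2 * k - l) * exp (4 * u + 4 * v + 8 * w) ^ (l - k) * exp (u + 3 * v - 2 * w) ^ 2 = exp (S + (real k - real l + 1) * d)"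
      using that unfolding exp_of_nat_mult[symmetric] exp_add[symmetric] S_def d_def
      by (simp add: of_nat_diff algebra_simps)
    then show ?thesis
      unfolding c_F c_F2 c_theta of_real_power[symmetric] of_real_mult[symmetric] by (simp only:)
  qed
  have a: "a > 0" unfolding assms by (intro divide_pos_pos Gamma_real_pos) auto
  define Y where "Y = (\<Sum>m=1..r+1. 2 ^ m * L m)"
  have u: "u = ln a - ln 2 / 2 - 1 / (2 * pi) * Y - (real r + 1) * (ln 2 / 2) + pi / 24 * (2 - 1 / T) - pi / 12 * (2 * T - 1)"
    using ln_eta_real_power_2[OF assms(3), of "r + 1"] by (simp add: u_def T_def Y_def add.commute)
  have v: "v = - (2 * T / pi * L (r + 2)) - ln 2 / 2 + pi / (48 * T) - pi * T / 6"
    using ln_eta_real_double[of "2 * T"] T by (simp add: v_def T_def L_eq)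
  have w: "w = - (4 * T / pi * L (r + 3)) - ln 2 / 2 + pi / (96 * T) - pi * T / 3"
    using ln_eta_real_double[of "4 * T"] T by (simp add: w_def T_def L_eq power3_eq_cube)
  have pw: "2 ^ (r + 1) = 2 * T" "2 ^ (r + 2) = 4 * T" "2 ^ (r + 3) = 8 * T" "2 ^ (r + 4) = 16 * T" "2 ^ (r + 5) = 32 * T"
    by (simp_all add: T_def power_add)
  \<comment> \<open>The terms in 1/T of 4v and 8w cancel. The summand 2 ln 2 yields 4^(k-l+1), which
    against the 4^(k+1) below \<open>f k\<close> leaves 4^l in the denominator; 2 T pi likewise
    leaves the first term of \<open>M\<close>.\<close>
  have d: "d = 2 * ln 2 + 2 * T * pi - 8 * T / pi * L (r + 2) + 32 * T / pi * L (r + 3)"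
    unfolding d_def v w using T by (simp add: field_simps)
  define N where "N = (4 * real k + 2) * ln a - (2 * real k + 1) * (real r + 3) * ln 2"
  \<comment> \<open>The powers of 2 from \<open>u\<close>, \<open>v\<close> and \<open>w\<close> add
    up to (2k+1)(r+3) + 2(k+1): the first part goes into \<open>N\<close>, the second is the 4^(k+1)
    below the contribution of \<open>f k\<close>. The terms in 1/T cancel again.\<close>
  have S: "S = N + J k r - 2 * T * (real k + 1) * pi - 2 * (real k + 1) * ln 2"
    unfolding S_def u v w N_def J_def pw Y_def[symmetric] using T by (simp add: field_simps)
  have expN: "exp N = a ^ (4 * k + 2) / 2 ^ ((2 * k + 1) * (r + 3))"
  proof -
    have "ln (a ^ (4 * k + 2) / 2 ^ ((2 * k + 1) * (r + 3))) = N"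
      unfolding N_def using a by (simp add: ln_div ln_realpow algebra_simps del: power_Suc add_2_eq_Suc')
    then show ?thesis
      using a by (metis divide_pos_pos exp_ln zero_less_numeral zero_less_power)
  qed
  have exp4: "exp (2 * real n * ln 2) = 4 ^ n" for n
  proof -
    have "exp (2 * real n * ln 2) = exp (real n * (ln 2 + ln 2))" by (simp add: algebra_simps)
    also have "\<dots> = 4 ^ n" unfolding exp_of_nat_mult exp_add by simp
    finally show ?thesis .
  qed
  have expS: "exp S = exp N * (exp (- (2 ^ (r + 1) * (real k + 1) * pi)) / 4 ^ (k + 1)) * exp (J k r)"
    unfolding exp4[symmetric] pw exp_diff[symmetric] exp_add[symmetric] S
    by (simp add: algebra_simps)
  have expM: "exp (S + (real k - real l + 1) * d) = exp N * (exp (M k l r) / 4 ^ l) * exp (J k r)" for l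
    unfolding exp4[symmetric] exp_diff[symmetric] exp_add[symmetric] S M_def pw d
    by (rule arg_cong[where f = exp]) (simp add: field_simps)
  have "H k \<tau> = f k \<tau>
       + (\<Sum>l=1..k-1. \<alpha> l * F \<tau> ^ l * theta (2 * \<tau>) ^ (4 * (k - l) + 2))
       + (\<Sum>l=k..2*k. \<beta> l * F \<tau> ^ (2 * k - l) * F (2 * \<tau>) ^ (l - k) * theta (2 * \<tau>) ^ 2)"
    using assms(2) T unfolding H_expansion_def tau by simp
  also have "(\<Sum>l=1..k-1. \<alpha> l * F \<tau> ^ l * theta (2 * \<tau>) ^ (4 * (k - l) + 2)) =
     of_real (exp N) * (\<Sum>l=1..k-1. \<alpha> l / 4 ^ l * of_real (exp (M k l r))) * of_real (exp (J k r))"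
    unfolding sum_distrib_left sum_distrib_right
  proof (intro sum.cong refl)
    fix l assume "l \<in> {1..k-1}"
    then have "l \<le> k" by auto
    have "\<alpha> l * F \<tau> ^ l * theta (2 * \<tau>) ^ (4 * (k - l) + 2) = \<alpha> l * of_real (exp N * (exp (M k l r) / 4 ^ l) * exp (J k r))"
      using c_\<alpha>[OF \<open>l \<le> k\<close>] unfolding expM by (simp only: mult.assoc)
    then show "\<alpha> l * F \<tau> ^ l * theta (2 * \<tau>) ^ (4 * (k - l) + 2) =
      of_real (exp N) * (\<alpha> l / 4 ^ l * of_real (exp (M k l r))) * of_real (exp (J k r))"
      by simp
  qed
  also have "(\<Sum>l=k..2*k. \<beta> l * F \<tau> ^ (2 * k - l) * F (2 * \<tau>) ^ (l - k) * theta (2 * \<tau>) ^ 2) =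
     of_real (exp N) * (\<Sum>l=k..2*k. \<beta> l / 4 ^ l * of_real (exp (M k l r))) * of_real (exp (J k r))"
    unfolding sum_distrib_left sum_distrib_right
  proof (intro sum.cong refl)
    fix l assume "l \<in> {k..2*k}"
    then have l: "k \<le> l" "l \<le> 2 * k" by auto
    have "\<beta> l * F \<tau> ^ (2 * k - l) * F (2 * \<tau>) ^ (l - k) * theta (2 * \<tau>) ^ 2 = \<beta> l * of_real (exp N * (exp (M k l r) / 4 ^ l) * exp (J k r))"
      using c_\<beta>[OF l] unfolding expM by (simp only: mult.assoc)
    then show "\<beta> l * F \<tau> ^ (2 * k - l) * F (2 * \<tau>) ^ (l - k) * theta (2 * \<tau>) ^ 2 =
      of_real (exp N) * (\<beta> l / 4 ^ l * of_real (exp (M k l r))) * of_real (exp (J k r))"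
      by simp
  qed
  also have "f k \<tau> = of_real (exp N) * of_real (exp (- (2 ^ (r + 1) * (real k + 1) * pi)) / 4 ^ (k + 1)) * of_real (exp (J k r))"
    unfolding c_f expS by (simp only: of_real_mult)
  finally show "H k \<tau> = of_real (a ^ (4 * k + 2) / 2 ^ ((2 * k + 1) * (r + 3))) *
       (of_real (exp (- (2 ^ (r + 1) * (real k + 1) * pi)) / 4 ^ (k + 1))
        + (\<Sum>l=1..k-1. \<alpha> l / 4 ^ l * of_real (exp (M k l r)))
        + (\<Sum>l=k..2*k. \<beta> l / 4 ^ l * of_real (exp (M k l r)))) *
       of_real (exp (J k r))"
    unfolding expN[symmetric] by (simp only: distrib_left distrib_right)
qed (fact L_1 L_2 L_3)+

end
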